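(* Let $\omega>0$, $\mu\in\{0,1\}$, and let $\phi_\omega$ be a Ruf-Sani soliton (as defined in the context). Then the Schrödinger operators $$\mathcal L_-=-\Delta+\omega-(e^{4\pi\phi_\omega^2}-1-4\pi\mu\phi_\omega^2),\qquad \mathcal L_+=-\Delta+\omega-\left(e^{4\pi\phi_\omega^2}(8\pi\phi_\omega^2+1)-1-12\mu\pi\phi_\omega^2\right)$$ on $L^2(\mathbb R^2)$ have the following properties: - $\mathcal L_-\ge0$, with a simple eigenvalue at zero, $\mathrm{Ker}[\mathcal L_-]=\mathrm{span}[\phi_\omega]$. - $\mathcal L_+$ has Morse index $1$, that is, $n(\mathcal L_+)=1$.
   Context: $\|\cdot\|$ denotes the norm of $L^2(\mathbb R^2)$. For $\mu\in\{0,1\}$ let $f_\mu(u)=(e^{4\pi|u|^2}-1-4\pi\mu|u|^2)u$ and $F_\mu(u)=\frac1{8\pi}\left(e^{4\pi|u|^2}-1-4\pi|u|^2-8\pi^2\mu|u|^4\right)$. **Ruf-Sani solitons.** A function is bell-shaped if it is equal to its Schwarz (symmetric decreasing) rearrangement. Let $Q_\omega\in C^2\cap L^\infty$ be a bell-shaped function that is a minimizer of the problem: minimize $\|\nabla u\|$ over $u\in H^1(\mathbb R^2)\setminus\{0\}$ subject to $\frac12\|u\|^2-\frac1\omega\int_{\mathbb R^2}F_\mu(u)\,dx=0$, and which solves the Euler-Lagrange equation $-\Delta Q_\omega+Q_\omega=\frac1\omega f_\mu(Q_\omega)$, is exponentially decaying at infinity, and satisfies $0<\|\nabla Q_\omega\|<1$.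 (Such $Q_\omega$ exists by a result of Ruf and Sani.) The function $\phi_\omega(x):=Q_\omega(\sqrt\omega\,x)$ is called a Ruf-Sani soliton. It is bell-shaped, belongs to $C^2\cap L^\infty$, solves $-\Delta\phi_\omega+\omega\phi_\omega=f_\mu(\phi_\omega)$, and satisfies $0<\|\nabla\phi_\omega\|<1$, $\frac\omega2\|\phi_\omega\|^2=\int F_\mu(\phi_\omega)$ and $\|\nabla\phi_\omega\|^2+\omega\|\phi_\omega\|^2=\int f_\mu(\phi_\omega)\phi_\omega$. **Morse index.** The operators $\mathcal L_\pm$ are self-adjoint with domain $H^2(\mathbb R^2)$. For a self-adjoint operator $S$, bounded from below and with finite dimensional negative subspace $X_-$, the Morse index is $n(S)=\dim X_-$, the number of negative eigenvalues of $S$ counted with multiplicity. *)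

theory Defs
  imports "HOL-Analysis.Analysis"
begin

section \<open>The complex Hilbert space of square-integrable functions on the plane\<close>

definition sq_integrable :: "(real^2 \<Rightarrow> complex) \<Rightarrow> bool" where
  "sq_integrable f \<longleftrightarrow>
     f \<in> borel_measurable lborel \<and> integrable lborel (\<lambda>x. (cmod (f x))\<^sup>2)"

definition L2_eq :: "(real^2 \<Rightarrow> complex) \<Rightarrow> (real^2 \<Rightarrow> complex) \<Rightarrow> bool" where
  "L2_eq f g \<longleftrightarrow> sq_integrable f \<and> sq_integrable g \<and> (AE x in lborel. f x = g x)"

lemma sq_integrable_zero: "sq_integrable (\<lambda>x. 0)"
  by (simp add: sq_integrable_def)

lemma sq_integrable_measurable: "sq_integrable f \<Longrightarrow> f \<in> borel_measurable borel"
  by (simp add: sq_integrable_def)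

lemma sq_integrable_scale:
  assumes "sq_integrable f" shows "sq_integrable (\<lambda>x. c * f x)"
  using assms by (auto simp: sq_integrable_def norm_mult power_mult_distrib)

lemma sq_integrable_add:
  assumes f: "sq_integrable f" and g: "sq_integrable g"
  shows "sq_integrable (\<lambda>x. f x + g x)"
proof -
  note [measurable] = sq_integrable_measurable[OF f] sq_integrable_measurable[OF g]
  have i: "integrable lborel (\<lambda>x. 2 * (cmod (f x))\<^sup>2 + 2 * (cmod (g x))\<^sup>2)"
    using f g by (auto simp: sq_integrable_def)
  have "(cmod (f x + g x))\<^sup>2 \<le> 2 * (cmod (f x))\<^sup>2 + 2 * (cmod (g x))\<^sup>2" for x
  proof -
    have "(cmod (f x + g x))\<^sup>2 \<le> (cmod (f x) + cmod (g x))\<^sup>2"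
      by (intro power_mono norm_triangle_ineq) auto
    also have "\<dots> \<le> 2 * (cmod (f x))\<^sup>2 + 2 * (cmod (g x))\<^sup>2"
      using sum_squares_bound[of "cmod (f x)" "cmod (g x)"] by (simp add: power2_sum)
    finally show ?thesis .
  qed
  then have "integrable lborel (\<lambda>x. (cmod (f x + g x))\<^sup>2)"
    by (intro Bochner_Integration.integrable_bound[OF i]) auto
  then show ?thesis by (simp add: sq_integrable_def)
qed

lemma sq_integrable_mult_cnj:
  assumes f: "sq_integrable f" and g: "sq_integrable g"
  shows "integrable lborel (\<lambda>x. f x * cnj (g x))"
proof -
  note [measurable] = sq_integrable_measurable[OF f] sq_integrable_measurable[OF g]
  have i: "integrable lborel (\<lambda>x. (cmod (f x))\<^sup>2 + (cmod (g x))\<^sup>2)"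
    using f g by (auto simp: sq_integrable_def)
  have "cmod (f x) * cmod (g x) \<le> (cmod (f x))\<^sup>2 + (cmod (g x))\<^sup>2" for x
    using sum_squares_bound[of "cmod (f x)" "cmod (g x)"]
      mult_nonneg_nonneg[OF norm_ge_zero[of "f x"] norm_ge_zero[of "g x"]] by linarith
  moreover have "(\<lambda>x. f x * cnj (g x)) \<in> borel_measurable lborel"
    by (intro borel_measurable_times measurable_compose[OF _ borel_measurable_continuous_onI[of cnj]]
      continuous_intros) auto
  ultimately show ?thesis
    by (intro Bochner_Integration.integrable_bound[OF i]) (auto simp: norm_mult)
qed

quotient_type L2 = "real^2 \<Rightarrow> complex" / partial: L2_eq
proof (rule part_equivpI)
  show "\<exists>f. L2_eq f f"
    using sq_integrable_zero by (auto simp: L2_eq_def)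
  show "symp L2_eq"
    by (auto simp: symp_def L2_eq_def elim: AE_mp)
  show "transp L2_eq"
    by (auto simp: transp_def L2_eq_def elim: AE_mp)
qed

lift_definition cscale :: "complex \<Rightarrow> L2 \<Rightarrow> L2" is "\<lambda>c f x. c * f x"
  by (auto simp: L2_eq_def sq_integrable_scale)

text \<open>The inner product is linear in its first argument.\<close>

lift_definition cinner :: "L2 \<Rightarrow> L2 \<Rightarrow> complex"
  is "\<lambda>f g. LINT x|lborel. f x * cnj (g x)"
proof -
  fix f f' g g' assume "L2_eq f f'" "L2_eq g g'"
  then show "(LINT x|lborel. f x * cnj (g x)) = (LINT x|lborel. f' x * cnj (g' x))"
    by (intro integral_cong_AE borel_measurable_integrable sq_integrable_mult_cnj)
       (auto simp: L2_eq_def)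
qed

instantiation L2 :: ab_group_add
begin

lift_definition zero_L2 :: L2 is "\<lambda>x. 0"
  by (simp add: L2_eq_def sq_integrable_zero)

lift_definition plus_L2 :: "L2 \<Rightarrow> L2 \<Rightarrow> L2" is "\<lambda>f g x. f x + g x"
  by (auto simp: L2_eq_def sq_integrable_add)

definition uminus_L2 :: "L2 \<Rightarrow> L2" where "uminus_L2 u = cscale (-1) u"

definition minus_L2 :: "L2 \<Rightarrow> L2 \<Rightarrow> L2" where "minus_L2 u v = u + cscale (-1) v"

instance
proof
  fix u v w :: L2
  show "u + v + w = u + (v + w)"
    by transfer (auto simp: L2_eq_def sq_integrable_add add.assoc)
  show "u + v = v + u"
    by transfer (auto simp: L2_eq_def sq_integrable_add add.commute)
  show "0 + u = u"
    by transfer (auto simp: L2_eq_def)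
  show "- u + u = 0"
    unfolding uminus_L2_def
    by transfer (auto simp: L2_eq_def sq_integrable_zero)
  show "u - v = u + - v"
    by (simp add: uminus_L2_def minus_L2_def)
qed

end

global_interpretation cL2: vector_space cscale
proof
  fix a b :: complex and u v :: L2
  show "cscale a (u + v) = cscale a u + cscale a v"
    by transfer (auto simp: L2_eq_def algebra_simps intro!: sq_integrable_add sq_integrable_scale)
  show "cscale (a + b) u = cscale a u + cscale b u"
    by transfer (auto simp: L2_eq_def algebra_simps intro!: sq_integrable_add sq_integrable_scale)
  show "cscale a (cscale b u) = cscale (a * b) u"
    by transfer (auto simp: L2_eq_def mult.assoc
      intro: sq_integrable_scale sq_integrable_scale[of _ "a * b", unfolded mult.assoc])
  show "cscale 1 u = u"
    by transfer (auto simp: L2_eq_def)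
qed

text \<open>
  The underlying real Hilbert space structure; it supplies the norm and the norm topology.
\<close>

instantiation L2 :: real_vector
begin

definition scaleR_L2 :: "real \<Rightarrow> L2 \<Rightarrow> L2" where "scaleR_L2 r u = cscale (of_real r) u"

instance
proof
  fix u v :: L2 and r s :: real
  show "r *\<^sub>R (u + v) = r *\<^sub>R u + r *\<^sub>R v"
    by (simp add: scaleR_L2_def cL2.scale_right_distrib)
  show "(r + s) *\<^sub>R u = r *\<^sub>R u + s *\<^sub>R u"
    by (simp add: scaleR_L2_def cL2.scale_left_distrib)
  show "r *\<^sub>R s *\<^sub>R u = (r * s) *\<^sub>R u"
    by (simp add: scaleR_L2_def)
  show "1 *\<^sub>R u = u"
    by (simp add: scaleR_L2_def)
qed

end

instantiation L2 :: real_inner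
begin

definition inner_L2 :: "L2 \<Rightarrow> L2 \<Rightarrow> real" where "inner_L2 u v = Re (cinner u v)"
definition norm_L2 :: "L2 \<Rightarrow> real" where "norm_L2 u = sqrt (Re (cinner u u))"
definition sgn_L2 :: "L2 \<Rightarrow> L2" where "sgn_L2 u = inverse (norm u) *\<^sub>R u"
definition dist_L2 :: "L2 \<Rightarrow> L2 \<Rightarrow> real" where "dist_L2 u v = norm (u - v)"
definition uniformity_L2 :: "(L2 \<times> L2) filter" where
  "uniformity_L2 = (INF e\<in>{0 <..}. principal {(x, y). dist x y < e})"
definition open_L2 :: "L2 set \<Rightarrow> bool" where
  "open_L2 U \<longleftrightarrow> (\<forall>x\<in>U. eventually (\<lambda>(x', y). x' = x \<longrightarrow> y \<in> U) uniformity)"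

instance
proof
  fix u v w :: L2 and r :: real and U :: "L2 set"
  show "dist u v = norm (u - v)" by (rule dist_L2_def)
  show "sgn u = u /\<^sub>R norm u" by (rule sgn_L2_def)
  show "(uniformity :: (L2 \<times> L2) filter) = (INF e\<in>{0 <..}. principal {(x, y). dist x y < e})"
    by (rule uniformity_L2_def)
  show "open U = (\<forall>x\<in>U. eventually (\<lambda>(x', y). x' = x \<longrightarrow> y \<in> U) uniformity)"
    by (rule open_L2_def)
  show "inner u v = inner v u"
    unfolding inner_L2_def
  proof (transfer, unfold L2_eq_def, clarify)
    fix f g assume fg: "sq_integrable f" "sq_integrable g"
    have "Re (LINT x|lborel. f x * cnj (g x)) = (LINT x|lborel. Re (f x * cnj (g x)))"
      by (rule integral_Re[OF sq_integrable_mult_cnj[OF fg], symmetric])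
    also have "\<dots> = (LINT x|lborel. Re (g x * cnj (f x)))"
      by (simp add: mult.commute)
    also have "\<dots> = Re (LINT x|lborel. g x * cnj (f x))"
      by (rule integral_Re[OF sq_integrable_mult_cnj[OF fg(2,1)]])
    finally show "Re (LINT x|lborel. f x * cnj (g x)) = Re (LINT x|lborel. g x * cnj (f x))" .
  qed
  show "inner (u + v) w = inner u w + inner v w"
    unfolding inner_L2_def
    by transfer (auto simp: L2_eq_def distrib_right Bochner_Integration.integral_add[OF
      sq_integrable_mult_cnj sq_integrable_mult_cnj])
  show "inner (r *\<^sub>R u) v = r * inner u v"
    unfolding inner_L2_def scaleR_L2_def
    by transfer (simp add: mult.assoc)
  have nn: "Re (LINT x|lborel. f x * cnj (f x)) = (LINT x|lborel. (cmod (f x))\<^sup>2)" for f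
    by (simp only: complex_norm_square[symmetric] integral_complex_of_real Re_complex_of_real)
  show "0 \<le> inner u u"
    unfolding inner_L2_def by transfer (simp add: nn)
  show "inner u u = 0 \<longleftrightarrow> u = 0"
    unfolding inner_L2_def
  proof (transfer, unfold L2_eq_def, clarify)
    fix f assume f: "sq_integrable f"
    have "(LINT x|lborel. (cmod (f x))\<^sup>2) = 0 \<longleftrightarrow> (AE x in lborel. (cmod (f x))\<^sup>2 = 0)"
      using f by (intro integral_nonneg_eq_0_iff_AE) (auto simp: sq_integrable_def)
    then show "(Re (LINT x|lborel. f x * cnj (f x)) = 0) =
       (sq_integrable f \<and> sq_integrable (\<lambda>x. 0) \<and> (AE x in lborel. f x = 0))"
      using f sq_integrable_zero by (simp add: nn)
  qed
  show "norm u = sqrt (inner u u)"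
    by (simp add: norm_L2_def inner_L2_def)
qed

end


section \<open>Sobolev spaces and differential operators\<close>

definition pd :: "2 \<Rightarrow> (real^2 \<Rightarrow> real) \<Rightarrow> real^2 \<Rightarrow> real" where
  "pd i f x = frechet_derivative f (at x) (axis i 1)"

primrec Ck :: "nat \<Rightarrow> (real^2 \<Rightarrow> real) \<Rightarrow> bool" where
  "Ck 0 f \<longleftrightarrow> continuous_on UNIV f"
| "Ck (Suc k) f \<longleftrightarrow> (\<forall>x. f differentiable (at x)) \<and> (\<forall>i. Ck k (pd i f))"

definition classical_laplacian :: "(real^2 \<Rightarrow> real) \<Rightarrow> real^2 \<Rightarrow> real" where
  "classical_laplacian f x = (\<Sum>i\<in>UNIV. pd i (pd i f) x)"

definition test_function :: "(real^2 \<Rightarrow> real) \<Rightarrow> bool" where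
  "test_function \<psi> \<longleftrightarrow> (\<forall>k. Ck k \<psi>) \<and> compact (closure {x. \<psi> x \<noteq> 0})"

definition has_weak_pd :: "2 \<Rightarrow> L2 \<Rightarrow> L2 \<Rightarrow> bool" where
  "has_weak_pd i u v \<longleftrightarrow>
     (\<forall>\<psi>. test_function \<psi> \<longrightarrow>
       (LINT x|lborel. pd i \<psi> x *\<^sub>R rep_L2 u x) = - (LINT x|lborel. \<psi> x *\<^sub>R rep_L2 v x))"

text \<open>Weak derivatives are unique as elements of \<open>L2\<close>; \<open>weak_pd\<close> is meaningful on \<open>sobolev 1\<close>.\<close>

definition weak_pd :: "2 \<Rightarrow> L2 \<Rightarrow> L2" where
  "weak_pd i u = (THE v. has_weak_pd i u v)"

primrec sobolev :: "nat \<Rightarrow> L2 set" where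
  "sobolev 0 = UNIV"
| "sobolev (Suc k) = {u. \<forall>i. \<exists>v\<in>sobolev k. has_weak_pd i u v}"

definition grad_norm :: "L2 \<Rightarrow> real" where
  "grad_norm u = sqrt (\<Sum>i\<in>UNIV. (norm (weak_pd i u))\<^sup>2)"

definition laplacian :: "L2 \<Rightarrow> L2" where
  "laplacian u = (\<Sum>i\<in>UNIV. weak_pd i (weak_pd i u))"

text \<open>
  The class of a real-valued function, and multiplication by a real potential \<open>V\<close>. Both are
  meaningful only for square-integrable functions and for bounded measurable \<open>V\<close>, respectively.
\<close>

definition to_L2 :: "(real^2 \<Rightarrow> real) \<Rightarrow> L2" where
  "to_L2 f = abs_L2 (\<lambda>x. complex_of_real (f x))"

definition mult_op :: "(real^2 \<Rightarrow> real) \<Rightarrow> L2 \<Rightarrow> L2" where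
  "mult_op V u = abs_L2 (\<lambda>x. complex_of_real (V x) * rep_L2 u x)"

definition schrodinger :: "real \<Rightarrow> (real^2 \<Rightarrow> real) \<Rightarrow> L2 \<Rightarrow> L2" where
  "schrodinger \<omega> V u = - laplacian u + \<omega> *\<^sub>R u - mult_op V u"


section \<open>Unbounded operators\<close>

text \<open>An operator is given by its domain \<open>D\<close> and a map \<open>T\<close> that is only relevant on \<open>D\<close>.\<close>

definition linear_operator :: "L2 set \<Rightarrow> (L2 \<Rightarrow> L2) \<Rightarrow> bool" where
  "linear_operator D T \<longleftrightarrow> cL2.subspace D \<and>
     (\<forall>u\<in>D. \<forall>v\<in>D. T (u + v) = T u + T v) \<and> (\<forall>c. \<forall>u\<in>D. T (cscale c u) = cscale c (T u))"

text \<open>The last conjunct says that the graph of the adjoint is the graph of the operator.\<close>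

definition self_adjoint :: "L2 set \<Rightarrow> (L2 \<Rightarrow> L2) \<Rightarrow> bool" where
  "self_adjoint D T \<longleftrightarrow> linear_operator D T \<and> closure D = UNIV \<and>
     {(v, w). \<forall>u\<in>D. cinner (T u) v = cinner u w} = {(v, T v) |v. v \<in> D}"

definition nonneg_operator :: "L2 set \<Rightarrow> (L2 \<Rightarrow> L2) \<Rightarrow> bool" where
  "nonneg_operator D T \<longleftrightarrow> (\<forall>u\<in>D. cinner (T u) u \<in> \<real> \<and> 0 \<le> Re (cinner (T u) u))"

definition bounded_below :: "L2 set \<Rightarrow> (L2 \<Rightarrow> L2) \<Rightarrow> bool" where
  "bounded_below D T \<longleftrightarrow> (\<exists>c. \<forall>u\<in>D. c * (norm u)\<^sup>2 \<le> Re (cinner (T u) u))"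

definition eigenspace :: "L2 set \<Rightarrow> (L2 \<Rightarrow> L2) \<Rightarrow> complex \<Rightarrow> L2 set" where
  "eigenspace D T z = {u \<in> D. T u = cscale z u}"

definition op_kernel :: "L2 set \<Rightarrow> (L2 \<Rightarrow> L2) \<Rightarrow> L2 set" where
  "op_kernel D T = {u \<in> D. T u = 0}"

definition simple_eigenvalue :: "L2 set \<Rightarrow> (L2 \<Rightarrow> L2) \<Rightarrow> complex \<Rightarrow> bool" where
  "simple_eigenvalue D T z \<longleftrightarrow> cL2.dim (eigenspace D T z) = 1"

definition negative_eigenvectors_span :: "L2 set \<Rightarrow> (L2 \<Rightarrow> L2) \<Rightarrow> L2 set" where
  "negative_eigenvectors_span D T = cL2.span (\<Union>r\<in>{..<0::real}. eigenspace D T (of_real r))"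

text \<open>
  For a self-adjoint operator the negative subspace is the range of the spectral projection of
  \<open>{..<0}\<close>. If it is finite-dimensional, it is spanned by the eigenvectors with negative
  eigenvalues; conversely, the finite-dimensional span \<open>X\<close> of these eigenvectors is the whole
  negative subspace exactly if the form is nonnegative on the orthogonal complement of \<open>X\<close>.
  Since eigenspaces of different eigenvalues are orthogonal, the dimension of \<open>X\<close> counts the
  negative eigenvalues with multiplicity.
\<close>

definition has_morse_index :: "L2 set \<Rightarrow> (L2 \<Rightarrow> L2) \<Rightarrow> nat \<Rightarrow> bool" where
  "has_morse_index D T n \<longleftrightarrow>
     self_adjoint D T \<and> bounded_below D T \<and>
     (let X = negative_eigenvectors_span D T in
        (\<exists>B. finite B \<and> cL2.span B = X) \<and>
        (\<forall>u\<in>D. (\<forall>v\<in>X. cinner u v = 0) \<longrightarrow> 0 \<le> Re (cinner (T u) u)) \<and>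
        cL2.dim X = n)"


section \<open>Ruf-Sani solitons\<close>

definition f_nl :: "real \<Rightarrow> real \<Rightarrow> real" where
  "f_nl \<mu> u = (exp (4 * pi * \<bar>u\<bar>\<^sup>2) - 1 - 4 * pi * \<mu> * \<bar>u\<bar>\<^sup>2) * u"

definition F_nl :: "real \<Rightarrow> complex \<Rightarrow> real" where
  "F_nl \<mu> u = 1 / (8 * pi) *
     (exp (4 * pi * (cmod u)\<^sup>2) - 1 - 4 * pi * (cmod u)\<^sup>2 - 8 * pi\<^sup>2 * \<mu> * (cmod u) ^ 4)"

text \<open>
  Schwarz rearrangement by the layer-cake formula: each superlevel set is replaced by the centred
  open disc of the same area. This presupposes that all these areas are finite, as they are for
  square-integrable functions.
\<close>

definition schwarz_set :: "(real^2) set \<Rightarrow> (real^2) set" where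
  "schwarz_set A = ball 0 (sqrt (measure lborel A / pi))"

definition schwarz_rearrangement :: "(real^2 \<Rightarrow> real) \<Rightarrow> real^2 \<Rightarrow> real" where
  "schwarz_rearrangement u x =
     (LINT t:{0<..}|lborel. indicator (schwarz_set {y. t < \<bar>u y\<bar>}) x)"

definition bell_shaped :: "(real^2 \<Rightarrow> real) \<Rightarrow> bool" where
  "bell_shaped u \<longleftrightarrow> schwarz_rearrangement u = u"

definition exp_decaying :: "(real^2 \<Rightarrow> real) \<Rightarrow> bool" where
  "exp_decaying u \<longleftrightarrow> (\<exists>C. \<exists>\<delta>>0. \<forall>x. \<bar>u x\<bar> \<le> C * exp (- \<delta> * norm x))"

definition admissible :: "real \<Rightarrow> real \<Rightarrow> L2 \<Rightarrow> bool" where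
  "admissible \<omega> \<mu> u \<longleftrightarrow> u \<in> sobolev 1 - {0} \<and>
     1 / 2 * (norm u)\<^sup>2 - 1 / \<omega> * (LINT x|lborel. F_nl \<mu> (rep_L2 u x)) = 0"

definition ruf_sani_profile :: "real \<Rightarrow> real \<Rightarrow> (real^2 \<Rightarrow> real) \<Rightarrow> bool" where
  "ruf_sani_profile \<omega> \<mu> Q \<longleftrightarrow>
     Ck 2 Q \<and> bounded (range Q) \<and> bell_shaped Q \<and>
     sq_integrable (\<lambda>x. complex_of_real (Q x)) \<and>
     admissible \<omega> \<mu> (to_L2 Q) \<and>
     (\<forall>u. admissible \<omega> \<mu> u \<longrightarrow> grad_norm (to_L2 Q) \<le> grad_norm u) \<and>
     (\<forall>x. - classical_laplacian Q x + Q x = 1 / \<omega> * f_nl \<mu> (Q x)) \<and>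
     exp_decaying Q \<and>
     0 < grad_norm (to_L2 Q) \<and> grad_norm (to_L2 Q) < 1"

definition ruf_sani_soliton :: "real \<Rightarrow> real \<Rightarrow> (real^2 \<Rightarrow> real) \<Rightarrow> bool" where
  "ruf_sani_soliton \<omega> \<mu> \<phi> \<longleftrightarrow>
     (\<exists>Q. ruf_sani_profile \<omega> \<mu> Q \<and> \<phi> = (\<lambda>x. Q (sqrt \<omega> *\<^sub>R x)))"


section \<open>The linearised operators\<close>

definition L_minus :: "real \<Rightarrow> real \<Rightarrow> (real^2 \<Rightarrow> real) \<Rightarrow> L2 \<Rightarrow> L2" where
  "L_minus \<omega> \<mu> \<phi> =
     schrodinger \<omega> (\<lambda>x. exp (4 * pi * (\<phi> x)\<^sup>2) - 1 - 4 * pi * \<mu> * (\<phi> x)\<^sup>2)"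

definition L_plus :: "real \<Rightarrow> real \<Rightarrow> (real^2 \<Rightarrow> real) \<Rightarrow> L2 \<Rightarrow> L2" where
  "L_plus \<omega> \<mu> \<phi> =
     schrodinger \<omega> (\<lambda>x. exp (4 * pi * (\<phi> x)\<^sup>2) * (8 * pi * (\<phi> x)\<^sup>2 + 1) - 1
                         - 12 * \<mu> * pi * (\<phi> x)\<^sup>2)"

end

theory Submission
  imports Defs
begin

text \<open>
  Regularity. If \<open>v \<in> L2\<close> is orthogonal to \<open>(1 - \<Delta>)\<psi>\<close> for all test functions, then for each test
  function \<open>\<eta>\<close> the function \<open>x \<mapsto> \<integral> v(y) \<eta>(y + x) dy\<close> vanishes at infinity and equals its own
  Laplacian, so it is zero by the maximum principle, and \<open>v = 0\<close>. Hence \<open>1 - \<Delta>\<close> maps the test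
  functions onto a dense subspace; as it controls all derivatives up to order two, test functions
  form a core and \<open>sobolev 2\<close> is exactly the domain of the distributional Laplacian. Self-adjointness
  of the Schroedinger operators and all form inequalities then reduce to test functions.

  \<open>L-minus\<close>. The soliton is positive, and on test functions the form is
  \<open>\<Sum> \<integral> (\<partial>\<^sub>i u - u \<partial>\<^sub>i \<phi> / \<phi>)\<^sup>2\<close>. For \<open>u\<close> in the kernel \<open>u / \<phi>\<close> therefore has vanishing weak
  gradient, is invariant under translations, and is constant.

  \<open>L-plus\<close>. Since the energy is minimal on \<open>G = 0\<close>, hence also on \<open>G < 0\<close>, a second order expansion
  along \<open>(1 + K t\<^sup>2) \<phi> + t h\<close> shows that the form is nonnegative for \<open>h\<close> orthogonal to \<open>\<Delta>\<phi>\<close>, while it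
  is negative at \<open>\<phi>\<close>. A self-adjoint operator which is bounded below and has these two properties
  has Morse index one.
\<close>

text \<open>The exceptional direction \<Delta>\<phi> comes from the equation: it makes the
  derivative of G at \<phi> equal to h \<mapsto> \<integral> \<Delta>\<phi> h, and that of the
  energy E is -2 times the same functional. So \<phi> is a critical point of E + 2 G, and the second
  variation of E + 2 G is twice the form of L-plus. A perturbation t h with h orthogonal to
  \<Delta>\<phi> moves neither E nor G to first order, which leaves a correction of order t^2 along
  \<phi> to decide the sign of both changes at once.

  The obstacle is that the domain consists of complex classes with weak derivatives, while the
  soliton is a classical real function without compact support. Three devices bridge the gap:
  splitting into real and imaginary parts, which real potentials respect; approximation by test
  functions, simultaneously for u and \<Delta>u; and a class of regular real trial functions that
  contains the test functions and \<phi>, with the energy expressed through the Laplacian alone, so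
  that no integrability of gradients has to be shown.\<close>

section \<open>Arithmetic of the quotient space and of its complex inner product\<close>

lemma abs_L2_rep: "abs_L2 (rep_L2 u) = u"
  by (rule Quotient3_abs_rep[OF Quotient3_L2])

lemma L2_eq_rep_abs: "sq_integrable f \<Longrightarrow> L2_eq (rep_L2 (abs_L2 f)) f"
  by (rule rep_abs_rsp_left[OF Quotient3_L2]) (simp add: L2_eq_def)

lemma sq_integrable_rep: "sq_integrable (rep_L2 u)"
  using Quotient3_rep_reflp[OF Quotient3_L2, of u] by (simp add: L2_eq_def)

text \<open>The representative picked by \<open>rep_L2\<close> is arbitrary, so identities between
  representatives hold almost everywhere only.\<close>

lemma rep_abs_L2: "sq_integrable f \<Longrightarrow> AE x in lborel. rep_L2 (abs_L2 f) x = f x"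
  using L2_eq_rep_abs by (simp add: L2_eq_def)

lemma abs_L2_eqI:
  assumes "sq_integrable f" "sq_integrable g" "AE x in lborel. f x = g x"
  shows "abs_L2 f = abs_L2 g"
  using assms by (intro Quotient3_rel_abs[OF Quotient3_L2]) (simp add: L2_eq_def)

lemma abs_L2_eqD:
  assumes "sq_integrable f" "sq_integrable g" "abs_L2 f = abs_L2 g"
  shows "AE x in lborel. f x = g x"
  using assms Quotient3_rel[OF Quotient3_L2, of f g] by (simp add: L2_eq_def)

lemma borel_measurable_rep [measurable]: "rep_L2 u \<in> borel_measurable borel"
  using sq_integrable_measurable[OF sq_integrable_rep] .

lemma cscale_abs: "sq_integrable f \<Longrightarrow> cscale c (abs_L2 f) = abs_L2 (\<lambda>x. c * f x)"
  by (rule cscale.abs_eq) (simp add: L2_eq_def)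

lemma plus_abs: "sq_integrable f \<Longrightarrow> sq_integrable g \<Longrightarrow> abs_L2 f + abs_L2 g = abs_L2 (\<lambda>x. f x + g x)"
  by (rule plus_L2.abs_eq) (simp_all add: L2_eq_def)

lemma cinner_abs: "sq_integrable f \<Longrightarrow> sq_integrable g \<Longrightarrow>
    cinner (abs_L2 f) (abs_L2 g) = (LINT x|lborel. f x * cnj (g x))"
  by (rule cinner.abs_eq) (simp_all add: L2_eq_def)

lemma rep_cscale: "AE x in lborel. rep_L2 (cscale c u) x = c * rep_L2 u x"
  using rep_abs_L2[OF sq_integrable_scale[OF sq_integrable_rep[of u], of c]]
  by (simp add: cscale_abs[OF sq_integrable_rep, of c u, symmetric] abs_L2_rep)

lemma rep_plus: "AE x in lborel. rep_L2 (u + v) x = rep_L2 u x + rep_L2 v x"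
  using rep_abs_L2[OF sq_integrable_add[OF sq_integrable_rep[of u] sq_integrable_rep[of v]]]
  by (simp add: plus_abs[OF sq_integrable_rep sq_integrable_rep, of u v, symmetric] abs_L2_rep)

lemma minus_eq_cscale: "u - v = u + cscale (-1) v"
  by (rule minus_L2_def)

lemma rep_minus: "AE x in lborel. rep_L2 (u - v) x = rep_L2 u x - rep_L2 v x"
  using rep_plus[of u "cscale (-1) v"] rep_cscale[of "-1" v]
  unfolding minus_eq_cscale[symmetric] by eventually_elim simp

lemma cinner_rep: "cinner u v = (LINT x|lborel. rep_L2 u x * cnj (rep_L2 v x))"
  using cinner_abs[OF sq_integrable_rep sq_integrable_rep, of u v] by (simp add: abs_L2_rep)

lemma scaleR_eq_cscale: "r *\<^sub>R u = cscale (of_real r) u"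
  by (simp add: scaleR_L2_def)

lemma cinner_add_left: "cinner (u + v) w = cinner u w + cinner v w"
  by transfer (auto simp: L2_eq_def distrib_right Bochner_Integration.integral_add[OF
      sq_integrable_mult_cnj sq_integrable_mult_cnj])

lemma cinner_add_right: "cinner u (v + w) = cinner u v + cinner u w"
  by transfer (auto simp: L2_eq_def distrib_left Bochner_Integration.integral_add[OF
      sq_integrable_mult_cnj sq_integrable_mult_cnj])

lemma cinner_cscale_left: "cinner (cscale c u) v = c * cinner u v"
  by transfer (simp add: mult.assoc)

lemma cinner_commute: "cinner u v = cnj (cinner v u)"
proof (transfer)
  fix f g
  have "(LINT x|lborel. f x * cnj (g x)) = (LINT x|lborel. cnj (g x * cnj (f x)))"
    by (simp add: mult.commute)
  then show "(LINT x|lborel. f x * cnj (g x)) = cnj (LINT x|lborel. g x * cnj (f x))"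
    by (simp only: Bochner_Integration.integral_cnj)
qed

lemma cinner_cscale_right: "cinner u (cscale c v) = cnj c * cinner u v"
  by (metis cinner_commute cinner_cscale_left complex_cnj_mult)

lemma cinner_minus_left: "cinner (- u) v = - cinner u v"
  unfolding uminus_L2_def cinner_cscale_left by simp

lemma cinner_minus_right: "cinner u (- v) = - cinner u v"
  unfolding uminus_L2_def cinner_cscale_right by simp

lemma cinner_diff_left: "cinner (u - v) w = cinner u w - cinner v w"
  unfolding minus_eq_cscale[of u v] cinner_add_left cinner_cscale_left by simp

lemma cinner_diff_right: "cinner u (v - w) = cinner u v - cinner u w"
  unfolding minus_eq_cscale[of v w] cinner_add_right cinner_cscale_right by simp

lemma cinner_zero_left [simp]: "cinner 0 v = 0"
  using cinner_diff_left[of 0 0 v] by simp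

lemma cinner_zero_right [simp]: "cinner v 0 = 0"
  using cinner_diff_right[of v 0 0] by simp

lemma cinner_scaleR_left: "cinner (r *\<^sub>R u) v = of_real r * cinner u v"
  by (simp add: scaleR_eq_cscale cinner_cscale_left)

lemma cinner_scaleR_right: "cinner u (r *\<^sub>R v) = of_real r * cinner u v"
  by (simp add: scaleR_eq_cscale cinner_cscale_right)

lemma cinner_sum_left: "cinner (\<Sum>i\<in>A. u i) v = (\<Sum>i\<in>A. cinner (u i) v)"
  by (induction A rule: infinite_finite_induct) (auto simp: cinner_add_left)

lemma Re_cinner: "Re (cinner u v) = inner u v"
  by (simp add: inner_L2_def)

text \<open>Since the inner product is antilinear in its second argument, its imaginary part is the
  real inner product with \<i> v. Continuity of \<open>cinner\<close> thus reduces to that of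
  \<open>inner\<close>.\<close>

lemma cinner_eq_Complex: "cinner u v = Complex (inner u v) (inner u (cscale \<i> v))"
  by (simp add: complex_eq_iff inner_L2_def cinner_cscale_right)

lemma cinner_same: "cinner u u = of_real ((norm u)\<^sup>2)"
proof -
  have "Im (cinner u u) = - Im (cinner u u)"
    by (subst cinner_commute) simp
  then show ?thesis
    by (simp add: complex_eq_iff Re_cinner power2_norm_eq_inner)
qed

lemma norm_cscale: "norm (cscale c u) = cmod c * norm u"
proof -
  have "(norm (cscale c u))\<^sup>2 = Re (cinner (cscale c u) (cscale c u))"
    by (simp only: cinner_same Re_complex_of_real)
  also have "\<dots> = Re (c * cnj c * of_real ((norm u)\<^sup>2))"
    by (subst cinner_cscale_left, subst cinner_cscale_right) (simp only: cinner_same mult.assoc)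
  also have "\<dots> = (cmod c * norm u)\<^sup>2"
    by (simp only: complex_norm_square[symmetric] of_real_mult[symmetric] Re_complex_of_real power_mult_distrib)
  finally show ?thesis
    by (simp add: power2_eq_iff_nonneg)
qed

lemma tendsto_cinner:
  assumes "(f \<longlongrightarrow> a) F" "(g \<longlongrightarrow> b) F"
  shows "((\<lambda>x. cinner (f x) (g x)) \<longlongrightarrow> cinner a b) F"
proof -
  have s: "((\<lambda>x. cscale \<i> (g x)) \<longlongrightarrow> cscale \<i> b) F"
  proof -
    have "dist (cscale \<i> (g x)) (cscale \<i> b) = dist (g x) b" for x
      by (simp add: dist_norm cL2.scale_right_diff_distrib[symmetric] norm_cscale)
    then show ?thesis
      using assms(2) by (simp add: tendsto_iff)
  qed
  show ?thesis
    unfolding cinner_eq_Complex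
    by (intro tendsto_Complex tendsto_inner assms s)
qed

section \<open>Real-valued elements\<close>

definition sqi :: "(real^2 \<Rightarrow> real) \<Rightarrow> bool" where
  "sqi f \<longleftrightarrow> f \<in> borel_measurable borel \<and> integrable lborel (\<lambda>x. (f x)\<^sup>2)"

lemma sq_integrable_of_real: "sq_integrable (\<lambda>x. complex_of_real (f x)) \<longleftrightarrow> sqi f"
proof -
  have "f \<in> borel_measurable borel" if "(\<lambda>x. complex_of_real (f x)) \<in> borel_measurable borel"
    using measurable_compose[OF that borel_measurable_Re] by simp
  then have "(\<lambda>x. complex_of_real (f x)) \<in> borel_measurable borel \<longleftrightarrow> f \<in> borel_measurable borel"
    using measurable_compose[OF _ borel_measurable_continuous_onI[of complex_of_real], of f borel]
    by (intro iffI) (simp_all add: continuous_on_of_real_id)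
  then show ?thesis
    by (simp add: sq_integrable_def sqi_def)
qed

lemma sqi_measurable: "sqi f \<Longrightarrow> f \<in> borel_measurable borel"
  by (simp add: sqi_def)

lemma sqi_add: "sqi f \<Longrightarrow> sqi g \<Longrightarrow> sqi (\<lambda>x. f x + g x)"
  using sq_integrable_add[of "\<lambda>x. complex_of_real (f x)" "\<lambda>x. complex_of_real (g x)"]
  by (simp add: sq_integrable_of_real[symmetric])

lemma sqi_cmult: "sqi f \<Longrightarrow> sqi (\<lambda>x. c * f x)"
  using sq_integrable_scale[of "\<lambda>x. complex_of_real (f x)" "complex_of_real c"]
  by (simp add: sq_integrable_of_real[symmetric])

lemma sqi_minus: "sqi f \<Longrightarrow> sqi (\<lambda>x. - f x)"
  using sqi_cmult[of f "-1"] by simp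

lemma sqi_diff: "sqi f \<Longrightarrow> sqi g \<Longrightarrow> sqi (\<lambda>x. f x - g x)"
  using sqi_add[of f "\<lambda>x. - g x"] by (simp add: sqi_minus)

lemma sqi_bound:
  assumes g: "sqi g" and f: "f \<in> borel_measurable borel" and le: "\<And>x. \<bar>f x\<bar> \<le> \<bar>g x\<bar>"
  shows "sqi f"
proof -
  have "integrable lborel (\<lambda>x. (f x)\<^sup>2)"
  proof (rule Bochner_Integration.integrable_bound)
    show "integrable lborel (\<lambda>x. (g x)\<^sup>2)"
      using g by (simp add: sqi_def)
    show "(\<lambda>x. (f x)\<^sup>2) \<in> borel_measurable lborel"
      using f by simp
    show "AE x in lborel. norm ((f x)\<^sup>2) \<le> norm ((g x)\<^sup>2)"
      by (rule AE_I2) (simp only: real_norm_def abs_power2 abs_le_square_iff[symmetric] le)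
  qed
  then show ?thesis
    using f by (simp add: sqi_def)
qed

lemma sqi_mult_bounded:
  assumes g: "sqi g" and f: "f \<in> borel_measurable borel" and le: "\<And>x. \<bar>f x\<bar> \<le> M"
  shows "sqi (\<lambda>x. f x * g x)"
proof (rule sqi_bound[OF sqi_cmult[OF g, of M]])
  show "(\<lambda>x. f x * g x) \<in> borel_measurable borel"
    using f g by (auto simp: sqi_def)
  show "\<bar>f x * g x\<bar> \<le> \<bar>M * g x\<bar>" for x
    using le[of x] by (auto simp: abs_mult intro!: mult_right_mono)
qed

lemma sqi_integrable_mult:
  assumes "sqi f" "sqi g"
  shows "integrable lborel (\<lambda>x. f x * g x)"
  using sq_integrable_mult_cnj[of "\<lambda>x. complex_of_real (f x)" "\<lambda>x. complex_of_real (g x)"] assms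
    integrable_Re
  by (fastforce simp: sq_integrable_of_real)

lemma cinner_to_L2:
  assumes "sqi f" "sqi g"
  shows "cinner (to_L2 f) (to_L2 g) = complex_of_real (LINT x|lborel. f x * g x)"
  unfolding to_L2_def
  by (subst cinner_abs) (simp_all add: sq_integrable_of_real assms flip: of_real_mult)

lemma inner_to_L2:
  assumes "sqi f" "sqi g"
  shows "inner (to_L2 f) (to_L2 g) = (LINT x|lborel. f x * g x)"
  using cinner_to_L2[OF assms] by (simp flip: Re_cinner)

lemma norm_to_L2: "sqi f \<Longrightarrow> (norm (to_L2 f))\<^sup>2 = (LINT x|lborel. (f x)\<^sup>2)"
  unfolding power2_norm_eq_inner by (simp add: inner_to_L2 power2_eq_square)

lemma to_L2_add: "sqi f \<Longrightarrow> sqi g \<Longrightarrow> to_L2 f + to_L2 g = to_L2 (\<lambda>x. f x + g x)"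
  by (simp add: to_L2_def plus_abs sq_integrable_of_real)

lemma to_L2_cscale: "sqi f \<Longrightarrow> cscale (of_real c) (to_L2 f) = to_L2 (\<lambda>x. c * f x)"
  by (simp add: to_L2_def cscale_abs sq_integrable_of_real)

lemma to_L2_scaleR: "sqi f \<Longrightarrow> c *\<^sub>R (to_L2 f) = to_L2 (\<lambda>x. c * f x)"
  by (simp add: scaleR_L2_def to_L2_cscale)

lemma to_L2_minus: "sqi f \<Longrightarrow> - to_L2 f = to_L2 (\<lambda>x. - f x)"
  using to_L2_scaleR[of f "-1"] by simp

lemma to_L2_diff: "sqi f \<Longrightarrow> sqi g \<Longrightarrow> to_L2 f - to_L2 g = to_L2 (\<lambda>x. f x - g x)"
  using to_L2_add[of f "\<lambda>x. - g x"] by (simp add: sqi_minus to_L2_minus[symmetric])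

lemma rep_to_L2: "sqi f \<Longrightarrow> AE x in lborel. rep_L2 (to_L2 f) x = of_real (f x)"
  unfolding to_L2_def by (rule rep_abs_L2) (simp add: sq_integrable_of_real)

lemma to_L2_eq_iff: "sqi f \<Longrightarrow> sqi g \<Longrightarrow> to_L2 f = to_L2 g \<longleftrightarrow> (AE x in lborel. f x = g x)"
  unfolding to_L2_def
  using abs_L2_eqI[of "\<lambda>x. of_real (f x)" "\<lambda>x. of_real (g x)"]
    abs_L2_eqD[of "\<lambda>x. of_real (f x)" "\<lambda>x. of_real (g x)"]
  by (auto simp: sq_integrable_of_real)

lemma to_L2_eq_0_iff: "sqi f \<Longrightarrow> to_L2 f = 0 \<longleftrightarrow> (AE x in lborel. f x = 0)"
proof -
  assume f: "sqi f"
  have "to_L2 (\<lambda>x. 0) = 0" by (simp add: to_L2_def zero_L2_def)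
  then show ?thesis
    using to_L2_eq_iff[OF f, of "\<lambda>x. 0"] by (simp add: sqi_def)
qed

lemma cinner_to_L2_right:
  assumes "sqi \<psi>"
  shows "cinner u (to_L2 \<psi>) = (LINT x|lborel. \<psi> x *\<^sub>R rep_L2 u x)"
proof -
  note [measurable] = sqi_measurable[OF assms]
  have "cinner u (to_L2 \<psi>) = cinner (abs_L2 (rep_L2 u)) (to_L2 \<psi>)"
    by (simp add: abs_L2_rep)
  also have "\<dots> = (LINT x|lborel. rep_L2 u x * cnj (of_real (\<psi> x)))"
    unfolding to_L2_def by (rule cinner_abs) (simp_all add: sq_integrable_of_real assms sq_integrable_rep)
  finally show ?thesis
    by (simp add: scaleR_conv_of_real mult.commute)
qed

text \<open>Decomposition into real and imaginary part. All potentials are real, so the quadratic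
  forms split along it and estimates are needed for real functions only.\<close>

definition to_L2c :: "(real^2 \<Rightarrow> real) \<Rightarrow> (real^2 \<Rightarrow> real) \<Rightarrow> L2" where
  "to_L2c a b = to_L2 a + cscale \<i> (to_L2 b)"

lemma inner_to_L2_i:
  assumes "sqi a" "sqi b"
  shows "inner (to_L2 a) (cscale \<i> (to_L2 b)) = 0" "inner (cscale \<i> (to_L2 b)) (to_L2 a) = 0"
  by (simp_all add: cinner_to_L2 assms cinner_cscale_left cinner_cscale_right flip: Re_cinner)

lemma inner_cscale_i: "inner (cscale \<i> u) (cscale \<i> v) = inner u v"
  by (simp add: cinner_cscale_left cinner_cscale_right flip: Re_cinner)

lemma inner_to_L2c:
  assumes "sqi a" "sqi b" "sqi c" "sqi d"
  shows "inner (to_L2c a b) (to_L2c c d) = (LINT x|lborel. a x * c x) + (LINT x|lborel. b x * d x)"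
  using assms by (simp add: to_L2c_def inner_add_left inner_add_right inner_to_L2_i inner_cscale_i inner_to_L2)

lemma norm_to_L2c:
  assumes "sqi a" "sqi b"
  shows "(norm (to_L2c a b))\<^sup>2 = (norm (to_L2 a))\<^sup>2 + (norm (to_L2 b))\<^sup>2"
  unfolding power2_norm_eq_inner using assms by (simp add: inner_to_L2c inner_to_L2)

lemma to_L2c_add:
  assumes "sqi a" "sqi b" "sqi c" "sqi d"
  shows "to_L2c a b + to_L2c c d = to_L2c (\<lambda>x. a x + c x) (\<lambda>x. b x + d x)"
  using assms by (simp add: to_L2c_def cL2.scale_right_distrib flip: to_L2_add)

lemma to_L2c_diff:
  assumes "sqi a" "sqi b" "sqi c" "sqi d"
  shows "to_L2c a b - to_L2c c d = to_L2c (\<lambda>x. a x - c x) (\<lambda>x. b x - d x)"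
  using assms by (simp add: to_L2c_def cL2.scale_right_diff_distrib flip: to_L2_diff)

lemma L2_eq_to_L2c:
  obtains a b where "sqi a" "sqi b" "u = to_L2c a b"
proof -
  let ?a = "\<lambda>x. Re (rep_L2 u x)" and ?b = "\<lambda>x. Im (rep_L2 u x)"
  have i: "integrable lborel (\<lambda>x. (cmod (rep_L2 u x))\<^sup>2)"
    using sq_integrable_rep[of u] by (simp add: sq_integrable_def)
  have "integrable lborel (\<lambda>x. (?a x)\<^sup>2)" "integrable lborel (\<lambda>x. (?b x)\<^sup>2)"
    by (rule Bochner_Integration.integrable_bound[OF i]; auto simp: cmod_power2)+
  then have ab: "sqi ?a" "sqi ?b"
    by (auto simp: sqi_def)
  have "to_L2c ?a ?b = abs_L2 (\<lambda>x. of_real (?a x) + \<i> * of_real (?b x))"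
    unfolding to_L2c_def to_L2_def using ab
    by (simp add: cscale_abs sq_integrable_of_real plus_abs sq_integrable_scale)
  also have "\<dots> = u"
    by (simp add: complex_eq[symmetric] abs_L2_rep)
  finally show ?thesis using that ab by metis
qed

section \<open>Completeness\<close>

lemma norm_rep: "(norm u)\<^sup>2 = (LINT x|lborel. (cmod (rep_L2 u x))\<^sup>2)"
proof -
  have "complex_of_real ((norm u)\<^sup>2) = (LINT x|lborel. complex_of_real ((cmod (rep_L2 u x))\<^sup>2))"
    by (simp only: cinner_same[symmetric] cinner_rep complex_norm_square)
  also have "\<dots> = complex_of_real (LINT x|lborel. (cmod (rep_L2 u x))\<^sup>2)"
    by (rule integral_complex_of_real)
  finally show ?thesis
    by (simp only: of_real_eq_iff)
qed

text \<open>The norm as a nonnegative integral, so that Fatou's lemma and termwise integration of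
  series apply before the limit is known to be square-integrable.\<close>

lemma nn_integral_rep_diff:
  "(\<integral>\<^sup>+x. ennreal ((cmod (rep_L2 u x - rep_L2 v x))\<^sup>2) \<partial>lborel) = ennreal ((norm (u - v))\<^sup>2)"
proof -
  have "(\<integral>\<^sup>+x. ennreal ((cmod (rep_L2 u x - rep_L2 v x))\<^sup>2) \<partial>lborel) =
        (\<integral>\<^sup>+x. ennreal ((cmod (rep_L2 (u - v) x))\<^sup>2) \<partial>lborel)"
    using rep_minus[of u v] by (intro nn_integral_cong_AE) (auto elim!: eventually_mono)
  also have "\<dots> = ennreal (LINT x|lborel. (cmod (rep_L2 (u - v) x))\<^sup>2)"
    using sq_integrable_rep[of "u - v"]
    by (intro nn_integral_eq_integral) (simp_all add: sq_integrable_def)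
  finally show ?thesis
    by (simp only: norm_rep)
qed

text \<open>Riesz-Fischer: geometrically small increments force pointwise convergence almost
  everywhere, and Fatou's lemma turns the pointwise limit into a limit in norm.\<close>

lemma L2_limit_of_fast_Cauchy:
  fixes Y :: "nat \<Rightarrow> L2"
  assumes Y: "\<And>n. norm (Y (Suc n) - Y n) \<le> (1/2) ^ n"
    and C: "Cauchy Y"
  shows "\<exists>u. Y \<longlonglongrightarrow> u"
proof -
  define d where "d n x = cmod (rep_L2 (Y (Suc n)) x - rep_L2 (Y n) x)" for n x
  have [measurable]: "d n \<in> borel_measurable borel" for n
    unfolding d_def by measurable
  have dn: "(\<integral>\<^sup>+x. ennreal ((d n x)\<^sup>2) \<partial>lborel) \<le> ennreal ((1/4) ^ n)" for n
  proof -
    have "(norm (Y (Suc n) - Y n))\<^sup>2 \<le> ((1/2) ^ n)\<^sup>2"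
      by (rule power_mono[OF Y norm_ge_zero])
    also have "((1/2) ^ n)\<^sup>2 = ((1/4)::real) ^ n"
      by (simp add: power2_eq_square flip: power_mult_distrib)
    finally show ?thesis
      unfolding d_def nn_integral_rep_diff by (rule ennreal_leI)
  qed
  \<comment> \<open>The weight 2^n is affordable because the squared increments integrate to at most
    4^-n. Finiteness of the sum then gives \<open>d n x\<close> \<le> sqrt K 2^(-n/2) at almost
    every x, a summable bound.\<close>
  have "(\<integral>\<^sup>+x. (\<Sum>n. ennreal (2 ^ n * (d n x)\<^sup>2)) \<partial>lborel) =
        (\<Sum>n. \<integral>\<^sup>+x. ennreal (2 ^ n * (d n x)\<^sup>2) \<partial>lborel)"
    by (rule nn_integral_suminf) measurable
  also have "\<dots> \<le> (\<Sum>n. ennreal ((1/2) ^ n))"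
  proof (rule suminf_le)
    fix n
    have "(\<integral>\<^sup>+x. ennreal (2 ^ n * (d n x)\<^sup>2) \<partial>lborel) = ennreal (2 ^ n) * (\<integral>\<^sup>+x. ennreal ((d n x)\<^sup>2) \<partial>lborel)"
      by (subst nn_integral_cmult[symmetric]) (auto simp: ennreal_mult)
    also have "\<dots> \<le> ennreal (2 ^ n) * ennreal ((1/4) ^ n)"
      by (rule mult_left_mono[OF dn]) simp
    also have "\<dots> = ennreal (2 ^ n * (1/4) ^ n)"
      by (rule ennreal_mult[symmetric]) auto
    also have "2 ^ n * (1/4) ^ n = ((1/2)::real) ^ n"
      by (simp add: power_mult_distrib[symmetric])
    finally show "(\<integral>\<^sup>+x. ennreal (2 ^ n * (d n x)\<^sup>2) \<partial>lborel) \<le> ennreal ((1/2) ^ n)" .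
  qed auto
  also have "\<dots> = ennreal (\<Sum>n. (1/2) ^ n)"
    by (rule suminf_ennreal2) (auto intro: summable_geometric)
  also have "\<dots> < \<infinity>"
    by (rule ennreal_less_top[folded infinity_ennreal_def])
  finally have "AE x in lborel. (\<Sum>n. ennreal (2 ^ n * (d n x)\<^sup>2)) \<noteq> \<infinity>"
    by (intro nn_integral_PInf_AE) auto
  then have conv: "AE x in lborel. convergent (\<lambda>n. rep_L2 (Y n) x)"
  proof eventually_elim
    case (elim x)
    have "summable (\<lambda>n. 2 ^ n * (d n x)\<^sup>2)"
      by (rule summable_suminf_not_top) (use elim in auto)
    then have "Bseq (\<lambda>n. 2 ^ n * (d n x)\<^sup>2)"
      using summable_LIMSEQ_zero convergent_imp_Bseq convergentI by blast
    then obtain K where K: "\<And>n. norm (2 ^ n * (d n x)\<^sup>2) \<le> K" "K > 0"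
      by (auto simp: Bseq_def)
    have le: "d n x \<le> sqrt K * (sqrt (1/2)) ^ n" for n
    proof -
      have "(d n x)\<^sup>2 \<le> K * (1/2) ^ n"
        using K(1)[of n] by (simp add: field_simps power_one_over)
      then have "sqrt ((d n x)\<^sup>2) \<le> sqrt (K * (1/2) ^ n)"
        by (rule real_sqrt_le_mono)
      then show ?thesis
        by (simp add: d_def real_sqrt_mult real_sqrt_power)
    qed
    have "sqrt (1/2) < (1::real)"
      using real_sqrt_less_mono[of "1/2" 1] by simp
    then have "summable (\<lambda>n. sqrt K * (sqrt (1/2)) ^ n)"
      by (intro summable_mult summable_geometric) simp
    then have "summable (\<lambda>n. rep_L2 (Y (Suc n)) x - rep_L2 (Y n) x)"
      by (rule summable_comparison_test') (use le in \<open>simp add: d_def\<close>)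
    then have "convergent (\<lambda>n. (\<Sum>i<n. rep_L2 (Y (Suc i)) x - rep_L2 (Y i) x) + rep_L2 (Y 0) x)"
      unfolding summable_iff_convergent by (rule convergent_add[OF _ convergent_const])
    then show ?case
      by (simp add: sum_lessThan_telescope[of "\<lambda>i. rep_L2 (Y i) x"])
  qed
  define f where "f x = lim (\<lambda>n. rep_L2 (Y n) x)" for x
  have [measurable]: "f \<in> borel_measurable borel"
    unfolding f_def by (rule borel_measurable_lim_metric) simp
  have lim: "AE x in lborel. (\<lambda>n. rep_L2 (Y n) x) \<longlonglongrightarrow> f x"
    using conv by eventually_elim (simp add: f_def convergent_LIMSEQ_iff)
  \<comment> \<open>Fatou's lemma in m, with n fixed; it serves both for square-integrability of
    \<open>f\<close> and for convergence.\<close>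
  have fat: "(\<integral>\<^sup>+x. ennreal ((cmod (f x - rep_L2 (Y n) x))\<^sup>2) \<partial>lborel) \<le> ennreal (e\<^sup>2)"
    if n: "\<And>m. m \<ge> N \<Longrightarrow> norm (Y m - Y n) \<le> e" for n N e
  proof -
    have "(\<integral>\<^sup>+x. ennreal ((cmod (f x - rep_L2 (Y n) x))\<^sup>2) \<partial>lborel) =
      (\<integral>\<^sup>+x. liminf (\<lambda>m. ennreal ((cmod (rep_L2 (Y m) x - rep_L2 (Y n) x))\<^sup>2)) \<partial>lborel)"
    proof (rule nn_integral_cong_AE, use lim in eventually_elim)
      case (elim x)
      have "(\<lambda>m. ennreal ((cmod (rep_L2 (Y m) x - rep_L2 (Y n) x))\<^sup>2))
          \<longlonglongrightarrow> ennreal ((cmod (f x - rep_L2 (Y n) x))\<^sup>2)"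
        by (intro tendsto_ennrealI tendsto_power tendsto_norm tendsto_diff elim tendsto_const)
      then show ?case
        by (intro lim_imp_Liminf[symmetric]) auto
    qed
    also have "\<dots> \<le> liminf (\<lambda>m. \<integral>\<^sup>+x. ennreal ((cmod (rep_L2 (Y m) x - rep_L2 (Y n) x))\<^sup>2) \<partial>lborel)"
      by (rule nn_integral_liminf) measurable
    also have "\<dots> = liminf (\<lambda>m. ennreal ((norm (Y m - Y n))\<^sup>2))"
      by (simp only: nn_integral_rep_diff)
    also have "\<dots> \<le> limsup (\<lambda>m. ennreal ((norm (Y m - Y n))\<^sup>2))"
      by (rule Liminf_le_Limsup) simp
    also have "\<dots> \<le> ennreal (e\<^sup>2)"
      using n by (intro Limsup_bounded)
        (auto simp: eventually_sequentially intro!: exI[of _ N] ennreal_leI power_mono)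
    finally show ?thesis .
  qed
  have sq: "sq_integrable f"
  proof -
    obtain N where N: "\<And>m n. m \<ge> N \<Longrightarrow> n \<ge> N \<Longrightarrow> norm (Y m - Y n) < 1"
      using C unfolding Cauchy_iff by (meson zero_less_one)
    have "(\<integral>\<^sup>+x. ennreal ((cmod (f x - rep_L2 (Y N) x))\<^sup>2) \<partial>lborel) \<le> ennreal (1\<^sup>2)"
      by (rule fat[of N]) (use N in \<open>auto intro: less_imp_le\<close>)
    then have "integrable lborel (\<lambda>x. (cmod (f x - rep_L2 (Y N) x))\<^sup>2)"
      by (intro integrableI_bounded) (auto simp: less_top[symmetric] top_unique)
    then have "sq_integrable (\<lambda>x. f x - rep_L2 (Y N) x)"
      by (simp add: sq_integrable_def)
    from sq_integrable_add[OF this sq_integrable_rep[of "Y N"]] show ?thesis by simp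
  qed
  have "Y \<longlonglongrightarrow> abs_L2 f"
  proof (rule LIMSEQ_I)
    fix r :: real assume r: "r > 0"
    obtain N where N: "\<And>m n. m \<ge> N \<Longrightarrow> n \<ge> N \<Longrightarrow> norm (Y m - Y n) < r / 2"
      using C r unfolding Cauchy_iff by (meson half_gt_zero)
    show "\<exists>no. \<forall>n\<ge>no. norm (Y n - abs_L2 f) < r"
    proof (intro exI allI impI)
      fix n assume n: "n \<ge> N"
      have "ennreal ((norm (abs_L2 f - Y n))\<^sup>2) =
          (\<integral>\<^sup>+x. ennreal ((cmod (f x - rep_L2 (Y n) x))\<^sup>2) \<partial>lborel)"
        unfolding nn_integral_rep_diff[symmetric]
        by (rule nn_integral_cong_AE, use rep_abs_L2[OF sq] in eventually_elim) simp
      also have "\<dots> \<le> ennreal ((r / 2)\<^sup>2)"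
        by (rule fat[of N]) (use N n in \<open>auto intro: less_imp_le\<close>)
      finally have "(norm (abs_L2 f - Y n))\<^sup>2 \<le> (r / 2)\<^sup>2"
        by (simp add: ennreal_le_iff)
      then have "norm (abs_L2 f - Y n) \<le> r / 2"
        by (rule power2_le_imp_le) (use r in simp)
      then show "norm (Y n - abs_L2 f) < r"
        using r by (simp add: norm_minus_commute)
    qed
  qed
  then show ?thesis ..
qed

instance L2 :: complete_space
proof
  fix X :: "nat \<Rightarrow> L2" assume X: "Cauchy X"
  have "\<exists>M. \<forall>m\<ge>M. \<forall>k\<ge>M. norm (X m - X k) < (1/2) ^ n" for n
    using X unfolding Cauchy_iff by simp
  then obtain M where M: "\<And>n m k. m \<ge> M n \<Longrightarrow> k \<ge> M n \<Longrightarrow> norm (X m - X k) < (1/2) ^ n"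
    by metis
  \<comment> \<open>Summing the thresholds keeps \<open>r n\<close> above \<open>M n\<close>, and
    the extra \<open>n\<close> makes \<open>r\<close> strictly increasing.\<close>
  define r where "r n = n + (\<Sum>i\<le>n. M i)" for n
  have r: "r n \<ge> M n" "r n \<ge> n" "r (Suc n) > r n" for n
    unfolding r_def by (auto intro: trans_le_add2 member_le_sum)
  have sm: "strict_mono r"
    using r(3) by (simp add: strict_mono_Suc_iff)
  have C: "Cauchy (\<lambda>n. X (r n))"
    using Cauchy_subseq_Cauchy[OF X sm] by (simp add: o_def)
  have "norm (X (r (Suc n)) - X (r n)) \<le> (1/2) ^ n" for n
    using M[of n "r (Suc n)" "r n"] r(1)[of n] r(3)[of n] by simp
  then obtain u where u: "(\<lambda>n. X (r n)) \<longlonglongrightarrow> u"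
    using L2_limit_of_fast_Cauchy[OF _ C] by auto
  have "X \<longlonglongrightarrow> u"
    using Cauchy_converges_subseq[OF X sm] u by (simp add: o_def)
  then show "convergent X"
    by (auto simp: convergent_def)
qed

section \<open>Orthogonal projection and density\<close>

text \<open>Every point f has a nearest point p in the closure of S, and f - p is orthogonal to S;
  by assumption f = p.\<close>

lemma dense_if_orthogonal_trivial:
  fixes S :: "'a::{real_inner, complete_space} set"
  assumes S: "subspace S" and orth: "\<And>v. (\<And>s. s \<in> S \<Longrightarrow> inner s v = 0) \<Longrightarrow> v = 0"
  shows "closure S = UNIV"
proof -
  have "f \<in> closure S" for f
  proof -
    have ne: "S \<noteq> {}" using subspace_0[OF S] by auto
    define d where "d = infdist f S"
    have d0: "d \<ge> 0" by (simp add: d_def infdist_nonneg)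
    have dle: "d \<le> norm (f - p)" if "p \<in> closure S" for p
      using infdist_triangle[of f S p] in_closure_iff_infdist_zero[OF ne, of p] that
      by (simp add: d_def dist_norm)
    have "\<exists>s\<in>S. dist f s < d + 1 / Suc n" for n
      using cInf_lessD[of "dist f ` S" "d + 1 / Suc n"] ne
      unfolding d_def infdist_def by (auto simp del: of_nat_Suc)
    then obtain s where s: "\<And>n. s n \<in> S" "\<And>n. norm (f - s n) < d + 1 / Suc n"
      unfolding dist_norm by metis
    \<comment> \<open>Parallelogram law; the midpoint of two elements of S again has distance at
      least \<open>d\<close> from f, so a minimizing sequence is Cauchy.\<close>
    have par: "(norm (s n - s m))\<^sup>2 \<le> 2 * (norm (f - s n))\<^sup>2 + 2 * (norm (f - s m))\<^sup>2 - 4 * d\<^sup>2" for n m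
    proof -
      have "(1/2) *\<^sub>R (s n + s m) \<in> S"
        by (intro subspace_scale subspace_add S s)
      then have "d \<le> norm (f - (1/2) *\<^sub>R (s n + s m))"
        using dle closure_subset by blast
      then have "d\<^sup>2 \<le> (norm (f - (1/2) *\<^sub>R (s n + s m)))\<^sup>2"
        using d0 by (rule power_mono)
      moreover have "(norm (s n - s m))\<^sup>2 + 4 * (norm (f - (1/2) *\<^sub>R (s n + s m)))\<^sup>2 =
          2 * (norm (f - s n))\<^sup>2 + 2 * (norm (f - s m))\<^sup>2"
        unfolding power2_norm_eq_inner
        by (simp add: inner_diff_left inner_diff_right inner_add_left inner_add_right inner_commute algebra_simps)
      ultimately show ?thesis by linarith
    qed
    have "Cauchy s"
    proof (rule CauchyI)
      fix e :: real assume e: "e > 0"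
      have "(\<lambda>n. 4 * (d + 1 / Suc n)\<^sup>2 - 4 * d\<^sup>2) \<longlonglongrightarrow> 4 * (d + 0)\<^sup>2 - 4 * d\<^sup>2"
        by (intro tendsto_intros LIMSEQ_Suc[OF lim_inverse_n'])
      then have "\<forall>\<^sub>F n in sequentially. 4 * (d + 1 / Suc n)\<^sup>2 - 4 * d\<^sup>2 < e\<^sup>2"
        by (rule order_tendstoD) (use e in simp)
      then obtain N where N: "4 * (d + 1 / Suc N)\<^sup>2 - 4 * d\<^sup>2 < e\<^sup>2"
        by (auto simp: eventually_sequentially)
      have b: "(norm (f - s n))\<^sup>2 \<le> (d + 1 / Suc N)\<^sup>2" if "n \<ge> N" for n
      proof -
        have "1 / real (Suc n) \<le> 1 / real (Suc N)"
          using that by (intro divide_left_mono) auto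
        then have "norm (f - s n) \<le> d + 1 / Suc N"
          using s(2)[of n] by linarith
        then show ?thesis by (intro power_mono) auto
      qed
      have "norm (s m - s n) < e" if "m \<ge> N" "n \<ge> N" for m n
      proof -
        have "(norm (s m - s n))\<^sup>2 < e\<^sup>2"
          using par[of m n] b[OF that(1)] b[OF that(2)] N by linarith
        then show ?thesis using e by (simp add: power2_less_imp_less)
      qed
      then show "\<exists>M. \<forall>m\<ge>M. \<forall>n\<ge>M. norm (s m - s n) < e" by blast
    qed
    then obtain p where p: "s \<longlonglongrightarrow> p"
      using Cauchy_convergent convergent_def by blast
    have pS: "p \<in> closure S"
      unfolding closure_sequential by (intro exI[of _ s]) (simp add: p s(1))
    have np: "norm (f - p) \<le> d"
    proof (rule LIMSEQ_le)
      show "(\<lambda>n. norm (f - s n)) \<longlonglongrightarrow> norm (f - p)" by (intro tendsto_intros p)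
      show "(\<lambda>n. d + 1 / Suc n) \<longlonglongrightarrow> d"
        using tendsto_add[OF tendsto_const[of d] LIMSEQ_Suc[OF lim_inverse_n']] by simp
      show "\<exists>N. \<forall>n\<ge>N. norm (f - s n) \<le> d + 1 / Suc n"
        using s(2) less_imp_le by blast
    qed
    have "inner u (f - p) = 0" if u: "u \<in> S" for u
    proof (rule ccontr)
      assume "inner u (f - p) \<noteq> 0"
      define a where "a = inner u (f - p)"
      \<comment> \<open>The optimal step in direction \<open>u\<close>: it lowers the squared
        distance by \<open>a\<^sup>2 / (norm u)\<^sup>2\<close>.\<close>
      define t where "t = a / (norm u)\<^sup>2"
      have a: "a \<noteq> 0" "u \<noteq> 0" using \<open>inner u (f - p) \<noteq> 0\<close> by (auto simp: a_def)
      have "p + t *\<^sub>R u \<in> closure S"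
      proof -
        have "(\<lambda>n. s n + t *\<^sub>R u) \<longlonglongrightarrow> p + t *\<^sub>R u"
          by (intro tendsto_intros p)
        moreover have "s n + t *\<^sub>R u \<in> S" for n
          by (intro subspace_add subspace_scale S s(1) u)
        ultimately show ?thesis
          unfolding closure_sequential by (intro exI[of _ "\<lambda>n. s n + t *\<^sub>R u"]) simp
      qed
      then have "norm (f - p) \<le> norm (f - p - t *\<^sub>R u)"
        using np dle[of "p + t *\<^sub>R u"] by (simp add: algebra_simps)
      then have "(norm (f - p))\<^sup>2 \<le> (norm (f - p - t *\<^sub>R u))\<^sup>2"
        by (intro power_mono) auto
      also have "\<dots> = (norm (f - p))\<^sup>2 - 2 * t * a + t\<^sup>2 * (norm u)\<^sup>2"
        unfolding power2_norm_eq_inner a_def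
        by (simp add: inner_diff_left inner_diff_right inner_commute power2_eq_square algebra_simps)
      also have "\<dots> = (norm (f - p))\<^sup>2 - a\<^sup>2 / (norm u)\<^sup>2"
        using a by (simp add: t_def field_simps power2_eq_square)
      finally have "a\<^sup>2 / (norm u)\<^sup>2 \<le> 0" by simp
      moreover have "a\<^sup>2 / (norm u)\<^sup>2 > 0" using a by simp
      ultimately show False by simp
    qed
    then have "f - p = 0" by (rule orth)
    then show ?thesis using pS by simp
  qed
  then show ?thesis by blast
qed

section \<open>Calculus of k times differentiable functions on the plane\<close>

definition smooth :: "(real^2 \<Rightarrow> real) \<Rightarrow> bool" where
  "smooth f \<longleftrightarrow> (\<forall>k. Ck k f)"

abbreviation bsupp :: "(real^2 \<Rightarrow> real) \<Rightarrow> bool" where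
  "bsupp f \<equiv> bounded {x. f x \<noteq> 0}"

lemma pd_eqI: "(f has_derivative f') (at x) \<Longrightarrow> pd i f x = f' (axis i 1)"
  unfolding pd_def by (simp add: frechet_derivative_at[symmetric])

lemma has_derivative_frechet:
  "f differentiable (at x) \<Longrightarrow> (f has_derivative frechet_derivative f (at x)) (at x)"
  by (simp add: frechet_derivative_works)

lemma Ck_Suc_pd: "Ck (Suc k) f \<Longrightarrow> Ck k (pd i f)"
  by simp

lemma Ck_SucD: "Ck (Suc k) f \<Longrightarrow> Ck k f"
proof (induction k arbitrary: f)
  case 0
  then show ?case
    by (auto intro!: continuous_at_imp_continuous_on differentiable_imp_continuous_within)
next
  case (Suc k)
  then show ?case by (metis Ck.simps(2))
qed

lemma Ck_mono: "Ck n f \<Longrightarrow> m \<le> n \<Longrightarrow> Ck m f"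
  by (induction n) (auto simp del: Ck.simps(2) simp: le_Suc_eq dest: Ck_SucD)

lemma Ck_continuous: "Ck k f \<Longrightarrow> continuous_on UNIV f"
  using Ck_mono[of k f 0] by simp

lemma Ck_1_pd_continuous: "Ck (Suc k) f \<Longrightarrow> continuous_on UNIV (pd i f)"
  using Ck_continuous by auto

lemma smoothD: "smooth f \<Longrightarrow> Ck k f"
  by (simp add: smooth_def)

lemma smooth_pd: "smooth f \<Longrightarrow> smooth (pd i f)"
  unfolding smooth_def by (metis Ck.simps(2))

lemma pd_const: "pd i (\<lambda>x. c) = (\<lambda>x. 0)"
  by (rule ext, subst pd_eqI[OF has_derivative_const]) simp

lemma pd_add:
  assumes "\<And>x. f differentiable (at x)" "\<And>x. g differentiable (at x)"
  shows "pd i (\<lambda>x. f x + g x) = (\<lambda>x. pd i f x + pd i g x)"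
  by (rule ext, subst pd_eqI[OF has_derivative_add[OF has_derivative_frechet has_derivative_frechet]])
    (simp_all add: assms pd_def)

lemma pd_mult:
  assumes "\<And>x. f differentiable (at x)" "\<And>x. g differentiable (at x)"
  shows "pd i (\<lambda>x. f x * g x) = (\<lambda>x. pd i f x * g x + f x * pd i g x)"
  by (rule ext, subst pd_eqI[OF has_derivative_mult[OF has_derivative_frechet has_derivative_frechet]])
    (simp_all add: assms pd_def)

lemma pd_cmult:
  assumes "\<And>x. f differentiable (at x)"
  shows "pd i (\<lambda>x. c * f x) = (\<lambda>x. c * pd i f x)"
  using pd_mult[OF differentiable_const[of c] assms, of i] by (simp add: pd_const)

lemma pd_compose:
  assumes "\<And>x. f differentiable (at x)"
    and "\<And>x. (g has_real_derivative g' (f x)) (at (f x))"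
  shows "pd i (\<lambda>x. g (f x)) = (\<lambda>x. g' (f x) * pd i f x)"
proof
  fix x
  have "((\<lambda>x. g (f x)) has_derivative (\<lambda>h. g' (f x) * frechet_derivative f (at x) h)) (at x)"
    using has_derivative_compose[OF has_derivative_frechet[OF assms(1)]
        assms(2)[unfolded has_field_derivative_def]] .
  then show "pd i (\<lambda>x. g (f x)) x = g' (f x) * pd i f x"
    using pd_eqI[of "\<lambda>x. g (f x)" _ x i] by (simp add: pd_def[of i f x])
qed

lemma Ck_const: "Ck k (\<lambda>x. c)"
  by (induction k arbitrary: c) (simp_all add: pd_const)

lemma Ck_add: "Ck k f \<Longrightarrow> Ck k g \<Longrightarrow> Ck k (\<lambda>x. f x + g x)"
proof (induction k arbitrary: f g)
  case 0
  then show ?case by (auto intro: continuous_intros)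
next
  case (Suc k)
  then show ?case by (auto simp: pd_add)
qed

lemma Ck_mult: "Ck k f \<Longrightarrow> Ck k g \<Longrightarrow> Ck k (\<lambda>x. f x * g x)"
proof (induction k arbitrary: f g)
  case 0
  then show ?case by (auto intro: continuous_intros)
next
  case (Suc k)
  have "Ck k f" "Ck k g" using Suc.prems by (auto intro: Ck_SucD)
  with Suc show ?case by (auto simp: pd_mult intro!: Ck_add differentiable_mult)
qed

lemma Ck_cmult: "Ck k f \<Longrightarrow> Ck k (\<lambda>x. c * f x)"
  by (intro Ck_mult Ck_const)

lemma Ck_diff: "Ck k f \<Longrightarrow> Ck k g \<Longrightarrow> Ck k (\<lambda>x. f x - g x)"
  using Ck_add[of k f "\<lambda>x. (-1) * g x"] Ck_cmult[of k g "-1"] by simp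

lemma Ck_prod: "(\<And>i. i \<in> A \<Longrightarrow> Ck k (f i)) \<Longrightarrow> Ck k (\<lambda>x. \<Prod>i\<in>A. f i x)"
  by (induction A rule: infinite_finite_induct) (auto intro: Ck_const Ck_mult)

text \<open>\<open>G\<close> lists a function together with all its derivatives: the chain rule
  leads from \<open>G j\<close> to \<open>G (Suc j)\<close>, so the induction has to cover every j
  at once.\<close>

lemma Ck_compose:
  assumes G: "\<And>j t. (G j has_real_derivative G (Suc j) t) (at t)" and f: "Ck k f"
  shows "Ck k (\<lambda>x. G j (f x))"
  using f
proof (induction k arbitrary: f j)
  case 0
  have "continuous_on UNIV (G j)"
    by (rule DERIV_continuous_on[of UNIV _ "G (Suc j)"]) (rule G)
  with 0 show ?case using continuous_on_compose2[of UNIV "G j" UNIV f] by simp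
next
  case (Suc k)
  have d: "f differentiable (at x)" for x using Suc.prems by simp
  have "(\<lambda>x. G j (f x)) differentiable (at x)" for x
    by (rule differentiableI)
      (rule has_derivative_compose[OF has_derivative_frechet[OF d] G[unfolded has_field_derivative_def]])
  moreover have "Ck k (\<lambda>x. G (Suc j) (f x) * pd i f x)" for i
    using Suc by (intro Ck_mult Suc.IH) (auto intro: Ck_SucD)
  ultimately show ?case
    using pd_compose[OF d G] by simp
qed

lemma has_derivative_nth: "((\<lambda>x::real^2. x $ j) has_derivative (\<lambda>h. h $ j)) F"
  by (rule bounded_linear.has_derivative[OF bounded_linear_vec_nth has_derivative_ident])

lemma pd_nth: "pd i (\<lambda>x. x $ j) = (\<lambda>x. if i = j then 1 else 0)"
  by (rule ext, subst pd_eqI[OF has_derivative_nth]) (simp add: axis_def)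

lemma Ck_nth: "Ck k (\<lambda>x. x $ j)"
proof (cases k)
  case 0
  then show ?thesis by (auto intro: continuous_intros)
next
  case (Suc m)
  then show ?thesis
    using has_derivative_nth by (auto simp: pd_nth Ck_const intro: differentiableI)
qed

lemma affine_has_derivative:
  "((\<lambda>x::real^2. c *\<^sub>R x + a) has_derivative (\<lambda>h. c *\<^sub>R h)) (at x)"
  by (auto intro!: derivative_eq_intros)

lemma pd_affine:
  assumes "\<And>x. f differentiable (at x)"
  shows "pd i (\<lambda>x. f (c *\<^sub>R x + a)) = (\<lambda>x. c * pd i f (c *\<^sub>R x + a))"
proof
  fix x
  have d: "(f has_derivative frechet_derivative f (at (c *\<^sub>R x + a))) (at (c *\<^sub>R x + a))"
    by (rule has_derivative_frechet[OF assms])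
  show "pd i (\<lambda>x. f (c *\<^sub>R x + a)) x = c * pd i f (c *\<^sub>R x + a)"
    using pd_eqI[OF has_derivative_compose[OF affine_has_derivative d]] linear_cmul[OF has_derivative_linear[OF d]]
    by (simp add: pd_def)
qed

lemma Ck_affine: "Ck k f \<Longrightarrow> Ck k (\<lambda>x. f (c *\<^sub>R x + a))"
proof (induction k arbitrary: f)
  case 0
  then show ?case
    by (auto intro!: continuous_on_compose2[of UNIV f] continuous_intros)
next
  case (Suc k)
  have d: "f differentiable (at x)" for x using Suc.prems by simp
  have "(\<lambda>x. f (c *\<^sub>R x + a)) differentiable (at x)" for x
    by (rule differentiableI)
      (rule has_derivative_compose[OF affine_has_derivative has_derivative_frechet[OF d]])
  then show ?case
    using Suc by (auto simp: pd_affine[OF d] intro!: Ck_cmult)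
qed

lemma line_derivative:
  assumes "\<And>x. f differentiable (at x)"
  shows "((\<lambda>t. f (x + t *\<^sub>R axis i 1)) has_real_derivative pd i f (x + t *\<^sub>R axis i 1)) (at t)"
proof -
  let ?y = "x + t *\<^sub>R axis i 1"
  have d: "(f has_derivative frechet_derivative f (at ?y)) (at ?y)"
    by (rule has_derivative_frechet[OF assms])
  have l: "((\<lambda>t. x + t *\<^sub>R axis i (1::real)) has_derivative (\<lambda>h. h *\<^sub>R axis i 1)) (at t)"
    by (auto intro!: derivative_eq_intros)
  have "(\<lambda>h. frechet_derivative f (at ?y) (h *\<^sub>R axis i 1)) = (*) (pd i f ?y)"
    using linear_cmul[OF has_derivative_linear[OF d]] by (auto simp: pd_def mult.commute)
  then show ?thesis
    using has_derivative_compose[OF l d] by (simp add: has_field_derivative_def)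
qed

text \<open>The mean value theorem is applied in direction i to the increment of f along j, and then
  in direction j to the partial derivative.\<close>

lemma second_difference_mean_value:
  assumes f: "Ck 2 f" and h: "h > 0"
  shows "\<exists>s t. 0 < s \<and> s < h \<and> 0 < t \<and> t < h \<and>
    f (x + h *\<^sub>R axis i 1 + h *\<^sub>R axis j 1) - f (x + h *\<^sub>R axis i 1) - f (x + h *\<^sub>R axis j 1) + f x =
    h\<^sup>2 * pd j (pd i f) (x + s *\<^sub>R axis i 1 + t *\<^sub>R axis j 1)"
proof -
  have f2: "Ck (Suc (Suc 0)) f" using f by (simp add: numeral_2_eq_2)
  have df: "f differentiable (at x)" for x using f2 by simp
  have dpf: "pd i f differentiable (at x)" for x using f2 by simp
  define g where "g s = f (x + h *\<^sub>R axis j 1 + s *\<^sub>R axis i 1) - f (x + s *\<^sub>R axis i 1)" for s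
  have "(g has_real_derivative pd i f (x + h *\<^sub>R axis j 1 + s *\<^sub>R axis i 1) - pd i f (x + s *\<^sub>R axis i 1)) (at s)" for s
    unfolding g_def by (intro DERIV_diff line_derivative df)
  then obtain s where s: "0 < s" "s < h"
    "g h - g 0 = (h - 0) * (pd i f (x + h *\<^sub>R axis j 1 + s *\<^sub>R axis i 1) - pd i f (x + s *\<^sub>R axis i 1))"
    using MVT2[OF h, of g "\<lambda>s. pd i f (x + h *\<^sub>R axis j 1 + s *\<^sub>R axis i 1) - pd i f (x + s *\<^sub>R axis i 1)"] by blast
  define k where "k t = pd i f (x + s *\<^sub>R axis i 1 + t *\<^sub>R axis j 1)" for t
  have "(k has_real_derivative pd j (pd i f) (x + s *\<^sub>R axis i 1 + t *\<^sub>R axis j 1)) (at t)" for t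
    unfolding k_def by (intro line_derivative dpf)
  then obtain t where t: "0 < t" "t < h"
    "k h - k 0 = (h - 0) * pd j (pd i f) (x + s *\<^sub>R axis i 1 + t *\<^sub>R axis j 1)"
    using MVT2[OF h, of k "\<lambda>t. pd j (pd i f) (x + s *\<^sub>R axis i 1 + t *\<^sub>R axis j 1)"] by blast
  have "f (x + h *\<^sub>R axis i 1 + h *\<^sub>R axis j 1) - f (x + h *\<^sub>R axis i 1) - f (x + h *\<^sub>R axis j 1) + f x = g h - g 0"
    by (simp add: g_def algebra_simps)
  also have "\<dots> = h * (k h - k 0)"
    unfolding s(3) k_def by (simp add: algebra_simps)
  finally show ?thesis
    using s t by (auto simp: power2_eq_square)
qed

text \<open>The second difference quotient is symmetric in i and j, and by the preceding mean value
  formula each of the two mixed derivatives is its limit.\<close>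

lemma pd_commute:
  assumes f: "Ck 2 f"
  shows "pd i (pd j f) = pd j (pd i f)"
proof
  fix x
  define D where "D n = (let h = 1 / real (Suc n) in
    (f (x + h *\<^sub>R axis i 1 + h *\<^sub>R axis j 1) - f (x + h *\<^sub>R axis i 1) - f (x + h *\<^sub>R axis j 1) + f x) / h\<^sup>2)" for n
  have lim: "E \<longlonglongrightarrow> pd b (pd a f) x"
    if E: "\<And>n. \<exists>s t. 0 < s \<and> s < 1 / real (Suc n) \<and> 0 < t \<and> t < 1 / real (Suc n) \<and>
      E n = pd b (pd a f) (x + s *\<^sub>R axis a 1 + t *\<^sub>R axis b 1)" for E a b
  proof -
    obtain s t where st': "\<And>n. 0 < s n \<and> s n < 1 / real (Suc n) \<and> 0 < t n \<and> t n < 1 / real (Suc n) \<and>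
      E n = pd b (pd a f) (x + s n *\<^sub>R axis a 1 + t n *\<^sub>R axis b 1)"
      using E by metis
    have st: "\<And>n. 0 < s n" "\<And>n. s n < 1 / real (Suc n)" "\<And>n. 0 < t n" "\<And>n. t n < 1 / real (Suc n)"
      "\<And>n. E n = pd b (pd a f) (x + s n *\<^sub>R axis a 1 + t n *\<^sub>R axis b 1)"
      using st' by auto
    have l: "(\<lambda>n. 1 / real (Suc n)) \<longlonglongrightarrow> 0" by (rule LIMSEQ_Suc[OF lim_inverse_n'])
    have s: "s \<longlonglongrightarrow> 0"
      by (rule tendsto_sandwich[OF _ _ tendsto_const l]; intro always_eventually allI less_imp_le st)
    have t: "t \<longlonglongrightarrow> 0"
      by (rule tendsto_sandwich[OF _ _ tendsto_const l]; intro always_eventually allI less_imp_le st)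
    have "(\<lambda>n. x + s n *\<^sub>R axis a 1 + t n *\<^sub>R axis b 1) \<longlonglongrightarrow> x + 0 *\<^sub>R axis a 1 + 0 *\<^sub>R axis b 1"
      by (intro tendsto_intros s t)
    moreover have "continuous_on UNIV (pd b (pd a f))"
      using f by (simp add: numeral_2_eq_2)
    ultimately have "(\<lambda>n. pd b (pd a f) (x + s n *\<^sub>R axis a 1 + t n *\<^sub>R axis b 1)) \<longlonglongrightarrow> pd b (pd a f) x"
      using continuous_on_tendsto_compose by fastforce
    moreover have "E = (\<lambda>n. pd b (pd a f) (x + s n *\<^sub>R axis a 1 + t n *\<^sub>R axis b 1))"
      using st(5) by blast
    ultimately show ?thesis by simp
  qed
  have mv: "\<exists>s t. 0 < s \<and> s < h \<and> 0 < t \<and> t < h \<and>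
      (f (x + h *\<^sub>R axis a 1 + h *\<^sub>R axis b 1) - f (x + h *\<^sub>R axis a 1) - f (x + h *\<^sub>R axis b 1) + f x) / h\<^sup>2
        = pd b (pd a f) (x + s *\<^sub>R axis a 1 + t *\<^sub>R axis b 1)" if h: "h > 0" for h a b
  proof -
    obtain s t where st: "0 < s" "s < h" "0 < t" "t < h"
      "f (x + h *\<^sub>R axis a 1 + h *\<^sub>R axis b 1) - f (x + h *\<^sub>R axis a 1) - f (x + h *\<^sub>R axis b 1) + f x =
       h\<^sup>2 * pd b (pd a f) (x + s *\<^sub>R axis a 1 + t *\<^sub>R axis b 1)"
      using second_difference_mean_value[OF f h] by blast
    show ?thesis
      by (intro exI[of _ s] exI[of _ t]) (simp only: st, use h in simp)
  qed
  have "D \<longlonglongrightarrow> pd j (pd i f) x"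
    unfolding D_def Let_def by (rule lim, rule mv) simp
  moreover have "D \<longlonglongrightarrow> pd i (pd j f) x"
  proof -
    have "D n = (let h = 1 / real (Suc n) in
    (f (x + h *\<^sub>R axis j 1 + h *\<^sub>R axis i 1) - f (x + h *\<^sub>R axis j 1) - f (x + h *\<^sub>R axis i 1) + f x) / h\<^sup>2)" for n
      unfolding D_def Let_def by (simp add: add.assoc add.commute[of "_ *\<^sub>R axis i 1"] del: of_nat_Suc)
    then have "D = (\<lambda>n. let h = 1 / real (Suc n) in
    (f (x + h *\<^sub>R axis j 1 + h *\<^sub>R axis i 1) - f (x + h *\<^sub>R axis j 1) - f (x + h *\<^sub>R axis i 1) + f x) / h\<^sup>2)"
      by blast
    then show ?thesis
      unfolding Let_def by (simp only:) (rule lim, rule mv, simp)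
  qed
  ultimately show "pd i (pd j f) x = pd j (pd i f) x"
    by (rule LIMSEQ_unique[symmetric])
qed

section \<open>Test functions\<close>

lemma test_function_iff: "test_function \<psi> \<longleftrightarrow> smooth \<psi> \<and> bsupp \<psi>"
  by (simp add: test_function_def smooth_def)

lemma bsupp_pd: "bsupp f \<Longrightarrow> bsupp (pd i f)"
proof (rule bounded_subset[OF bounded_closure])
  show "{x. pd i f x \<noteq> 0} \<subseteq> closure {x. f x \<noteq> 0}"
  proof
    fix x assume x: "x \<in> {x. pd i f x \<noteq> 0}"
    show "x \<in> closure {x. f x \<noteq> 0}"
    proof (rule ccontr)
      assume n: "x \<notin> closure {x. f x \<noteq> 0}"
      have "(f has_derivative (\<lambda>h. 0)) (at x)"
      proof (rule has_derivative_transform_within_open[OF has_derivative_const])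
        show "open (- closure {x. f x \<noteq> 0})" by (simp add: open_Compl)
        show "x \<in> - closure {x. f x \<noteq> 0}" using n by simp
        show "0 = f y" if "y \<in> - closure {x. f x \<noteq> 0}" for y
        proof -
          have "y \<notin> {x. f x \<noteq> 0}"
            using that closure_subset[of "{x. f x \<noteq> 0}"] by blast
          then show ?thesis by simp
        qed
      qed
      then show False using x pd_eqI by fastforce
    qed
  qed
qed

lemma bsupp_mult_left: "bsupp f \<Longrightarrow> bsupp (\<lambda>x. f x * g x)"
  by (erule bounded_subset) auto

lemma bsupp_mult_right: "bsupp f \<Longrightarrow> bsupp (\<lambda>x. g x * f x)"
  by (erule bounded_subset) auto

lemma bsupp_add: "bsupp f \<Longrightarrow> bsupp g \<Longrightarrow> bsupp (\<lambda>x. f x + g x)"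
  by (rule bounded_subset[of "{x. f x \<noteq> 0} \<union> {x. g x \<noteq> 0}"]) auto

lemma test_function_pd: "test_function f \<Longrightarrow> test_function (pd i f)"
  by (simp add: test_function_iff smooth_pd bsupp_pd)

lemma test_function_add: "test_function f \<Longrightarrow> test_function g \<Longrightarrow> test_function (\<lambda>x. f x + g x)"
  by (simp add: test_function_iff smooth_def Ck_add bsupp_add)

lemma test_function_cmult: "test_function f \<Longrightarrow> test_function (\<lambda>x. c * f x)"
  by (auto simp: test_function_iff smooth_def Ck_cmult intro: bounded_subset)

lemma test_function_diff: "test_function f \<Longrightarrow> test_function g \<Longrightarrow> test_function (\<lambda>x. f x - g x)"
  using test_function_add[of f "\<lambda>x. (-1) * g x"] test_function_cmult[of g "-1"] by simp

lemma test_function_affine: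
  assumes "test_function f" "c \<noteq> 0"
  shows "test_function (\<lambda>x. f (c *\<^sub>R x + a))"
proof -
  have "{x. f (c *\<^sub>R x + a) \<noteq> 0} \<subseteq> (\<lambda>y. (1/c) *\<^sub>R (y - a)) ` {x. f x \<noteq> 0}"
    using assms(2) by (auto simp: image_iff intro!: exI[of _ "c *\<^sub>R _ + a"])
  moreover have "bounded ((\<lambda>y. (1/c) *\<^sub>R (y - a)) ` {x. f x \<noteq> 0})"
    using assms(1) bounded_scaling[OF bounded_translation_minus, of "{x. f x \<noteq> 0}" "1/c" a]
    by (simp add: test_function_iff image_image)
  ultimately show ?thesis
    using assms(1) by (auto simp: test_function_iff smooth_def Ck_affine intro: bounded_subset)
qed

lemma laplacian_UNIV_2: "classical_laplacian f x = pd 1 (pd 1 f) x + pd 2 (pd 2 f) x"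
  by (simp add: classical_laplacian_def sum_2)

lemma pd_pd_add:
  assumes "Ck 2 u" "Ck 2 v"
  shows "pd i (pd i (\<lambda>x. u x + v x)) = (\<lambda>x. pd i (pd i u) x + pd i (pd i v) x)"
proof -
  have d: "u differentiable (at x)" "v differentiable (at x)"
    "pd i u differentiable (at x)" "pd i v differentiable (at x)" for x
    using assms by (auto simp: numeral_2_eq_2)
  show ?thesis by (simp add: pd_add d)
qed

lemma laplacian_add:
  assumes "Ck 2 u" "Ck 2 v"
  shows "classical_laplacian (\<lambda>x. u x + v x) = (\<lambda>x. classical_laplacian u x + classical_laplacian v x)"
  unfolding laplacian_UNIV_2[abs_def] pd_pd_add[OF assms] by (simp add: algebra_simps)

lemma laplacian_cmult:
  assumes "Ck 2 u"
  shows "classical_laplacian (\<lambda>x. c * u x) = (\<lambda>x. c * classical_laplacian u x)"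
proof -
  have d: "u differentiable (at x)" "pd i u differentiable (at x)" for x i
    using assms by (auto simp: numeral_2_eq_2)
  show ?thesis unfolding laplacian_UNIV_2[abs_def] by (simp add: pd_cmult d algebra_simps)
qed

lemma test_function_laplacian: "test_function f \<Longrightarrow> test_function (classical_laplacian f)"
  unfolding laplacian_UNIV_2[abs_def] by (intro test_function_add test_function_pd)

section \<open>Smooth cut-off functions\<close>

text \<open>Functions of the form p(1/t) exp(-1/t), continued by zero: a family that is closed under
  differentiation and contains the standard flat function, for p = 1.\<close>

definition flat :: "real poly \<Rightarrow> real \<Rightarrow> real" where
  "flat p t = (if t \<le> 0 then 0 else poly p (1 / t) * exp (- (1 / t)))"

lemma poly_times_exp_tendsto_0: "((\<lambda>x. poly p x * exp (- x)) \<longlongrightarrow> (0::real)) at_top"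
proof -
  have "((\<lambda>x. \<Sum>i\<le>degree p. coeff p i * (x ^ i / exp x)) \<longlongrightarrow> (\<Sum>i\<le>degree p. coeff p i * 0)) at_top"
    by (intro tendsto_intros tendsto_power_div_exp_0)
  then show ?thesis
    by (simp add: poly_altdef exp_minus field_simps sum_divide_distrib sum_distrib_left)
qed

text \<open>With s = 1/t, the derivative of p(s) exp(-s) with respect to t is s^2 (p - p')(s)
  exp(-s). At t = 0 the exponential beats every polynomial.\<close>

lemma has_derivative_flat:
  "(flat p has_real_derivative flat ([:0, 0, 1:] * (p - pderiv p)) t) (at t)"
proof -
  consider "t < 0" | "t > 0" | "t = 0" by linarith
  then show ?thesis
  proof cases
    case 1
    have "((\<lambda>t. 0) has_real_derivative 0) (at t)" by simp
    then have "(flat p has_real_derivative 0) (at t)"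
      by (rule has_field_derivative_transform_within_open[of _ _ _ "{..<0}"]) (use 1 in \<open>auto simp: flat_def\<close>)
    then show ?thesis using 1 by (simp add: flat_def)
  next
    case 2
    have "((\<lambda>t. poly p (1 / t) * exp (- (1 / t))) has_real_derivative
        flat ([:0, 0, 1:] * (p - pderiv p)) t) (at t)"
      using 2 by (auto intro!: derivative_eq_intros poly_DERIV[THEN DERIV_chain2]
          simp: flat_def field_simps power2_eq_square)
    then show ?thesis
      by (rule has_field_derivative_transform_within_open[of _ _ _ "{0<..}"]) (use 2 in \<open>auto simp: flat_def\<close>)
  next
    case 3
    have l: "((\<lambda>h. flat p h / h) \<longlongrightarrow> 0) (at_left 0)"
      by (rule Lim_transform_eventually[OF tendsto_const])
        (auto simp: eventually_at_filter flat_def)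
    \<comment> \<open>Division by h = 1/x multiplies the polynomial by x, whence
      \<open>pCons 0 p\<close>.\<close>
    have "((\<lambda>x. poly (pCons 0 p) x * exp (- x)) \<longlongrightarrow> (0::real)) at_top"
      by (rule poly_times_exp_tendsto_0)
    then have "((\<lambda>h. poly (pCons 0 p) (inverse h) * exp (- inverse h)) \<longlongrightarrow> (0::real)) (at_right 0)"
      by (rule filterlim_compose[OF _ filterlim_inverse_at_top_right])
    then have r: "((\<lambda>h. flat p h / h) \<longlongrightarrow> 0) (at_right 0)"
      by (rule Lim_transform_eventually)
        (auto simp: eventually_at_filter flat_def field_simps)
    have "((\<lambda>h. flat p h / h) \<longlongrightarrow> 0) (at 0)"
      using l r by (simp add: filterlim_split_at)
    then show ?thesis
      using 3 by (simp add: has_field_derivative_iff flat_def)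
  qed
qed

text \<open>\<open>flat (flat_poly n)\<close> is the n-th derivative of
  \<open>flat 1\<close>.\<close>

primrec flat_poly :: "nat \<Rightarrow> real poly" where
  "flat_poly 0 = 1"
| "flat_poly (Suc n) = [:0, 0, 1:] * (flat_poly n - pderiv (flat_poly n))"

lemma Ck_flat: "Ck k f \<Longrightarrow> Ck k (\<lambda>x. flat 1 (f x))"
  using Ck_compose[of "\<lambda>j. flat (flat_poly j)" k f 0] has_derivative_flat by simp

lemma Ck_exp: "Ck k f \<Longrightarrow> Ck k (\<lambda>x. exp (f x))"
  by (rule Ck_compose[of "\<lambda>j. exp"]) (auto intro: DERIV_exp)

lemma flat_pos_iff: "flat 1 t > 0 \<longleftrightarrow> t > 0" "flat 1 t \<ge> 0"
  by (auto simp: flat_def)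

definition box_fun :: "real^2 \<Rightarrow> real^2 \<Rightarrow> real^2 \<Rightarrow> real" where
  "box_fun a b x = (\<Prod>i\<in>UNIV. flat 1 (x $ i - a $ i) * flat 1 (b $ i - x $ i))"

lemma box_fun_nonneg: "box_fun a b x \<ge> 0"
  unfolding box_fun_def by (intro prod_nonneg ballI mult_nonneg_nonneg flat_pos_iff(2))

lemma box_fun_pos: "x \<in> box a b \<Longrightarrow> box_fun a b x > 0"
  unfolding box_fun_def mem_box_cart
  by (intro prod_pos ballI mult_pos_pos) (auto simp: flat_pos_iff(1))

lemma box_fun_eq_0:
  assumes "x \<notin> box a b" shows "box_fun a b x = 0"
proof -
  obtain i where "x $ i - a $ i \<le> 0 \<or> b $ i - x $ i \<le> 0"
    using assms by (auto simp: mem_box_cart not_less)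
  then have "flat 1 (x $ i - a $ i) * flat 1 (b $ i - x $ i) = 0"
    by (auto simp: flat_def)
  then show ?thesis
    unfolding box_fun_def by (intro prod_zero) auto
qed

lemma smooth_box_fun: "smooth (box_fun a b)"
  unfolding box_fun_def[abs_def] smooth_def
  by (intro allI Ck_prod Ck_mult Ck_flat Ck_diff Ck_nth Ck_const)

text \<open>As n grows these functions increase to the indicator of the open box, because
  \<open>box_fun\<close> is positive exactly there. They are the test functions from which the
  fundamental lemma recovers integrals over boxes.\<close>

lemma test_function_indicator_approx:
  "test_function (\<lambda>x. 1 - exp (- real n * box_fun a b x))"
proof -
  have "{x. 1 - exp (- real n * box_fun a b x) \<noteq> 0} \<subseteq> box a b"
    using box_fun_eq_0 by fastforce
  then have "bsupp (\<lambda>x. 1 - exp (- real n * box_fun a b x))"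
    using bounded_subset[OF bounded_box] by blast
  moreover have "smooth (\<lambda>x. 1 - exp (- real n * box_fun a b x))"
    unfolding smooth_def by (intro allI Ck_diff Ck_const Ck_exp Ck_mult smoothD smooth_box_fun)
  ultimately show ?thesis
    by (simp only: test_function_iff simp_thms)
qed

section \<open>Integrability of continuous functions with bounded support\<close>

lemma bounded_in_cball_0:
  fixes S :: "'a::real_normed_vector set"
  assumes "bounded S" obtains R where "S \<subseteq> cball 0 R"
proof -
  obtain R where "\<forall>x\<in>S. norm x \<le> R" using assms unfolding bounded_iff by (elim exE)
  then have "S \<subseteq> cball 0 R" by auto
  then show ?thesis by (rule that)
qed

lemma continuous_bsupp_bound:
  assumes f: "continuous_on UNIV f" and b: "bsupp f"
  obtains M R where "M \<ge> 0" "\<And>x. \<bar>f x\<bar> \<le> M * indicator (cball 0 R) x"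
proof -
  obtain R where R: "{x. f x \<noteq> 0} \<subseteq> cball 0 R"
    by (rule bounded_in_cball_0[OF b])
  have "bounded (f ` cball 0 R)"
    by (rule compact_imp_bounded[OF compact_continuous_image[OF continuous_on_subset[OF f subset_UNIV] compact_cball]])
  then obtain M where "\<forall>y\<in>f ` cball 0 R. norm y \<le> M"
    unfolding bounded_iff by (elim exE)
  then have M: "\<And>x. x \<in> cball 0 R \<Longrightarrow> \<bar>f x\<bar> \<le> M"
    by simp
  show ?thesis
  proof
    show "max M 0 \<ge> 0" by simp
    show "\<bar>f x\<bar> \<le> max M 0 * indicator (cball 0 R) x" for x
    proof (cases "x \<in> cball 0 R")
      case True
      then show ?thesis using M[OF True] by simp
    next
      case False
      then have "f x = 0" using R by blast
      then show ?thesis by simp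
    qed
  qed
qed

lemma continuous_borel: "continuous_on UNIV (f :: real^2 \<Rightarrow> real) \<Longrightarrow> f \<in> borel_measurable borel"
  by (rule borel_measurable_continuous_onI)

lemma integrable_indicator_cball:
  "integrable lborel (\<lambda>x::real^2. c * indicator (cball 0 R) x :: real)"
  by (intro integrable_mult_right integrable_real_indicator) (use emeasure_lborel_cball_finite in simp_all)

lemma integrable_bounded_support:
  assumes f: "f \<in> borel_measurable borel" and b: "\<And>x. \<bar>f x\<bar> \<le> M * indicator (cball 0 R) x"
  shows "integrable lborel (f :: real^2 \<Rightarrow> real)"
proof (rule Bochner_Integration.integrable_bound[OF integrable_indicator_cball[of M R]])
  show "f \<in> borel_measurable lborel" using f by simp
  show "AE x in lborel. norm (f x) \<le> norm (M * indicator (cball 0 R) x :: real)"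
    by (rule AE_I2) (use b order_trans[OF b abs_ge_self] in simp)
qed

lemma continuous_bsupp_integrable:
  assumes "continuous_on UNIV f" "bsupp f"
  shows "integrable lborel f"
proof -
  obtain M R where "M \<ge> 0" "\<And>x. \<bar>f x\<bar> \<le> M * indicator (cball 0 R) x"
    using continuous_bsupp_bound[OF assms] by blast
  then show ?thesis
    by (intro integrable_bounded_support[OF continuous_borel[OF assms(1)], of M R]) simp
qed

lemma continuous_bsupp_sqi:
  assumes "continuous_on UNIV f" "bsupp f"
  shows "sqi f"
proof -
  have "integrable lborel (\<lambda>x. f x * f x)"
    by (rule continuous_bsupp_integrable[OF continuous_on_mult[OF assms(1) assms(1)] bsupp_mult_left[OF assms(2)]])
  then show ?thesis
    using continuous_borel[OF assms(1)] by (simp add: sqi_def power2_eq_square)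
qed

lemma test_function_Ck: "test_function f \<Longrightarrow> Ck k f"
  by (simp add: test_function_def)

lemma test_function_continuous: "test_function f \<Longrightarrow> continuous_on UNIV f"
  by (rule Ck_continuous[OF test_function_Ck[of _ 0]])

lemma test_function_bsupp: "test_function f \<Longrightarrow> bsupp f"
  by (simp add: test_function_iff)

lemma test_function_sqi: "test_function f \<Longrightarrow> sqi f"
  by (intro continuous_bsupp_sqi test_function_continuous test_function_bsupp)

lemma test_function_differentiable: "test_function f \<Longrightarrow> f differentiable (at x)"
  using test_function_Ck[of f 1] by simp

section \<open>Translations and dilations of the integral\<close>

lemma integral_translate:
  fixes f :: "real^2 \<Rightarrow> 'b::{banach, second_countable_topology}"
  assumes [measurable]: "f \<in> borel_measurable borel"
  shows "(LINT x|lborel. f (x + a)) = (LINT x|lborel. f x)"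
proof -
  have "(LINT x|lborel. f x) = (LINT x|distr lborel borel ((+) a). f x)"
    by (simp add: lborel_distr_plus)
  also have "\<dots> = (LINT x|lborel. f (a + x))"
    by (rule integral_distr) auto
  finally show ?thesis by (simp add: add.commute)
qed

lemma integrable_translate:
  fixes f :: "real^2 \<Rightarrow> 'b::{banach, second_countable_topology}"
  assumes [measurable]: "f \<in> borel_measurable borel"
  shows "integrable lborel (\<lambda>x. f (x + a)) \<longleftrightarrow> integrable lborel f"
proof -
  have "integrable lborel f \<longleftrightarrow> integrable (distr lborel borel ((+) a)) f"
    by (simp add: lborel_distr_plus)
  also have "\<dots> \<longleftrightarrow> integrable lborel (\<lambda>x. f (a + x))"
    by (rule integrable_distr_eq) auto
  finally show ?thesis by (simp add: add.commute)
qed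

lemma lborel_scale:
  fixes c :: real assumes "c \<noteq> 0"
  shows "(lborel :: (real^2) measure) = density (distr lborel borel (\<lambda>x. c *\<^sub>R x)) (\<lambda>_. ennreal (c\<^sup>2))"
  using lborel_affine[OF assms, of "0::real^2"] by simp

lemma integral_scale:
  fixes f :: "real^2 \<Rightarrow> 'b::{banach, second_countable_topology}"
  assumes [measurable]: "f \<in> borel_measurable borel" and c: "c \<noteq> 0"
  shows "(LINT x|lborel. f x) = c\<^sup>2 *\<^sub>R (LINT x|lborel. f (c *\<^sub>R x))"
proof -
  have "(LINT x|lborel. f x) = (LINT x|density (distr lborel borel (\<lambda>x. c *\<^sub>R x)) (\<lambda>_. ennreal (c\<^sup>2)). f x)"
    by (simp only: lborel_scale[OF c, symmetric])
  also have "\<dots> = (LINT x|distr lborel borel (\<lambda>x. c *\<^sub>R x). c\<^sup>2 *\<^sub>R f x)"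
    by (rule integral_density) auto
  also have "\<dots> = (LINT x|lborel. c\<^sup>2 *\<^sub>R f (c *\<^sub>R x))"
    by (rule integral_distr) auto
  finally show ?thesis by simp
qed

lemma integrable_scale:
  fixes f :: "real^2 \<Rightarrow> 'b::{banach, second_countable_topology}"
  assumes [measurable]: "f \<in> borel_measurable borel" and c: "c \<noteq> 0"
  shows "integrable lborel (\<lambda>x. f (c *\<^sub>R x)) \<longleftrightarrow> integrable lborel f"
proof -
  have "integrable lborel f \<longleftrightarrow> integrable (density (distr lborel borel (\<lambda>x. c *\<^sub>R x)) (\<lambda>_. ennreal (c\<^sup>2))) f"
    by (simp only: lborel_scale[OF c, symmetric])
  also have "\<dots> \<longleftrightarrow> integrable (distr lborel borel (\<lambda>x. c *\<^sub>R x)) (\<lambda>x. c\<^sup>2 *\<^sub>R f x)"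
    by (rule integrable_density) auto
  also have "\<dots> \<longleftrightarrow> integrable lborel (\<lambda>x. c\<^sup>2 *\<^sub>R f (c *\<^sub>R x))"
    by (rule integrable_distr_eq) auto
  also have "\<dots> \<longleftrightarrow> integrable lborel (\<lambda>x. f (c *\<^sub>R x))"
  proof
    assume "integrable lborel (\<lambda>x. c\<^sup>2 *\<^sub>R f (c *\<^sub>R x))"
    then have "integrable lborel (\<lambda>x. (1 / c\<^sup>2) *\<^sub>R c\<^sup>2 *\<^sub>R f (c *\<^sub>R x))"
      by - (rule integrable_scaleR_right)
    then show "integrable lborel (\<lambda>x. f (c *\<^sub>R x))" using c by simp
  next
    assume "integrable lborel (\<lambda>x. f (c *\<^sub>R x))"
    then show "integrable lborel (\<lambda>x. c\<^sup>2 *\<^sub>R f (c *\<^sub>R x))"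
      by - (rule integrable_scaleR_right)
  qed
  finally show ?thesis by simp
qed

section \<open>Difference quotients, local integrability and integration by parts\<close>

lemma difference_quotient_tendsto:
  assumes f: "\<And>x. f differentiable (at x)" and t: "t \<longlonglongrightarrow> 0" "\<And>n. t n \<noteq> (0::real)"
  shows "(\<lambda>n. (f (x + t n *\<^sub>R axis i 1) - f x) / t n) \<longlonglongrightarrow> pd i f x"
proof -
  have "((\<lambda>t. f (x + t *\<^sub>R axis i 1)) has_real_derivative pd i f (x + 0 *\<^sub>R axis i 1)) (at 0)"
    by (rule line_derivative[OF f])
  then have "((\<lambda>h. (f (x + h *\<^sub>R axis i 1) - f x) / h) \<longlongrightarrow> pd i f x) (at 0)"
    by (simp add: has_field_derivative_iff)
  then show ?thesis
    using t by (auto simp: tendsto_at_iff_sequentially o_def)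
qed

text \<open>By the mean value theorem a quotient with step at most 1 is a value of the derivative at
  distance at most 1 from x. So one bounded, compactly supported majorant works for all steps, as
  dominated convergence requires.\<close>

lemma difference_quotient_bound:
  assumes f: "Ck 1 f" and b: "bsupp f"
  obtains M R where "\<And>t x. 0 < \<bar>t\<bar> \<Longrightarrow> \<bar>t\<bar> \<le> 1 \<Longrightarrow>
    \<bar>(f (x + t *\<^sub>R axis i 1) - f x) / t\<bar> \<le> M * indicator (cball 0 R) x"
proof -
  have df: "f differentiable (at x)" for x using f by simp
  obtain M R where M: "M \<ge> 0" "\<And>x. \<bar>pd i f x\<bar> \<le> M * indicator (cball 0 R) x"
    using continuous_bsupp_bound[of "pd i f"] f b bsupp_pd by auto
  have le: "\<bar>(f (x + t *\<^sub>R axis i 1) - f x) / t\<bar> \<le> M * indicator (cball 0 (R + 1)) x"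
    if t: "0 < \<bar>t\<bar>" "\<bar>t\<bar> \<le> 1" for t x
  proof -
    have *: "\<exists>s. \<bar>s\<bar> \<le> 1 \<and> (f (x + t *\<^sub>R axis i 1) - f x) / t = pd i f (x + s *\<^sub>R axis i 1)"
    proof (cases "t > 0")
      case True
      obtain s where "0 < s" "s < t" "f (x + t *\<^sub>R axis i 1) - f (x + 0 *\<^sub>R axis i 1) = (t - 0) * pd i f (x + s *\<^sub>R axis i 1)"
        using MVT2[OF True line_derivative[OF df, of x i]] by blast
      then show ?thesis using t by (intro exI[of _ s]) auto
    next
      case False
      then have "t < 0" using t by auto
      then obtain s where "t < s" "s < 0" "f (x + 0 *\<^sub>R axis i 1) - f (x + t *\<^sub>R axis i 1) = (0 - t) * pd i f (x + s *\<^sub>R axis i 1)"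
        using MVT2[OF \<open>t < 0\<close> line_derivative[OF df, of x i]] by blast
      then show ?thesis using t by (intro exI[of _ s]) (auto simp: field_simps)
    qed
    then obtain s where s: "\<bar>s\<bar> \<le> 1" "(f (x + t *\<^sub>R axis i 1) - f x) / t = pd i f (x + s *\<^sub>R axis i 1)"
      by blast
    have "norm x \<le> R + 1" if "norm (x + s *\<^sub>R axis i 1) \<le> R"
    proof -
      have "norm x \<le> norm (x + s *\<^sub>R axis i 1) + norm (s *\<^sub>R axis i (1::real) :: real^2)"
        using norm_triangle_ineq4[of "x + s *\<^sub>R axis i 1" "s *\<^sub>R axis i 1"] by simp
      then show ?thesis using s(1) that by (simp add: norm_axis_1)
    qed
    then have "indicator (cball 0 R) (x + s *\<^sub>R axis i 1) \<le> (indicator (cball 0 (R + 1)) x :: real)"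
      by (auto simp: indicator_def)
    then show ?thesis
      unfolding s(2) using M(2)[of "x + s *\<^sub>R axis i 1"] mult_left_mono[OF _ M(1)] by (meson order_trans)
  qed
  show ?thesis by (rule that[OF le])
qed

text \<open>Local integrability: a class wide enough for constants and for the quotient u / \<phi>,
  neither of which has to be square-integrable.\<close>

definition locint :: "(real^2 \<Rightarrow> real) \<Rightarrow> bool" where
  "locint v \<longleftrightarrow> v \<in> borel_measurable borel \<and> (\<forall>R. integrable lborel (\<lambda>x. indicator (cball 0 R) x * v x))"

lemma locint_measurable: "locint v \<Longrightarrow> v \<in> borel_measurable borel"
  by (simp add: locint_def)

lemma sqi_locint:
  assumes "sqi v" shows "locint v"
proof -
  have "sqi (indicator (cball 0 R))" for R
  proof -
    have "(\<lambda>x::real^2. (indicator (cball 0 R) x)\<^sup>2 :: real) = (\<lambda>x. 1 * indicator (cball 0 R) x)"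
      by (auto simp: indicator_def)
    then show ?thesis
      unfolding sqi_def using integrable_indicator_cball[of 1 R] by simp
  qed
  then show ?thesis
    unfolding locint_def using sqi_integrable_mult[OF _ assms] sqi_measurable[OF assms] by simp
qed

lemma locint_continuous_mult:
  assumes v: "locint v" and f: "continuous_on UNIV f"
  shows "locint (\<lambda>x. f x * v x)"
  unfolding locint_def
proof (intro conjI allI)
  note [measurable] = locint_measurable[OF v] continuous_borel[OF f]
  show "(\<lambda>x. f x * v x) \<in> borel_measurable borel" by measurable
  fix R
  have "bounded (f ` cball 0 R)"
    by (rule compact_imp_bounded[OF compact_continuous_image[OF continuous_on_subset[OF f subset_UNIV] compact_cball]])
  then obtain M where "\<forall>y\<in>f ` cball 0 R. norm y \<le> M"
    unfolding bounded_iff by (elim exE)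
  then have M: "\<And>x. x \<in> cball 0 R \<Longrightarrow> \<bar>f x\<bar> \<le> M"
    by simp
  have "integrable lborel (\<lambda>x. M * (indicator (cball 0 R) x * v x))"
    using v by (auto simp: locint_def)
  then show "integrable lborel (\<lambda>x. indicator (cball 0 R) x * (f x * v x))"
  proof (rule Bochner_Integration.integrable_bound)
    show "AE x in lborel. norm (indicator (cball 0 R) x * (f x * v x)) \<le> norm (M * (indicator (cball 0 R) x * v x))"
    proof (rule AE_I2)
      fix x
      show "norm (indicator (cball 0 R) x * (f x * v x)) \<le> norm (M * (indicator (cball 0 R) x * v x))"
      proof (cases "x \<in> cball 0 R")
        case True
        then show ?thesis
          using M[OF True] by (auto simp: abs_mult intro!: mult_right_mono)
      qed auto
    qed
    have "(\<lambda>x. f x * v x) \<in> borel_measurable lborel" by measurable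
    then show "(\<lambda>x. indicator (cball 0 R) x * (f x * v x)) \<in> borel_measurable lborel"
      by (intro borel_measurable_times borel_measurable_indicator) auto
  qed
qed

lemma locint_bounded_support_integrable:
  assumes v: "locint v" and f: "f \<in> borel_measurable borel" and b: "\<And>x. \<bar>f x\<bar> \<le> M * indicator (cball 0 R) x"
  shows "integrable lborel (\<lambda>x. v x * f x)"
proof (rule Bochner_Integration.integrable_bound)
  note [measurable] = locint_measurable[OF v] f
  show "integrable lborel (\<lambda>x. M * (indicator (cball 0 R) x * v x))"
    using v by (auto simp: locint_def)
  show "(\<lambda>x. v x * f x) \<in> borel_measurable lborel" by measurable
  show "AE x in lborel. norm (v x * f x) \<le> norm (M * (indicator (cball 0 R) x * v x))"
  proof (rule AE_I2)
    fix x
    have "\<bar>v x\<bar> * \<bar>f x\<bar> \<le> \<bar>v x\<bar> * (M * indicator (cball 0 R) x)"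
      by (rule mult_left_mono[OF b]) simp
    also have "\<dots> \<le> \<bar>v x\<bar> * \<bar>M * indicator (cball 0 R) x\<bar>"
      by (rule mult_left_mono) auto
    finally show "norm (v x * f x) \<le> norm (M * (indicator (cball 0 R) x * v x))"
      by (simp add: abs_mult mult_ac)
  qed
qed

lemma locint_bsupp_integrable:
  assumes "locint v" "continuous_on UNIV f" "bsupp f"
  shows "integrable lborel (\<lambda>x. v x * f x)"
proof -
  obtain M R where "M \<ge> 0" "\<And>x. \<bar>f x\<bar> \<le> M * indicator (cball 0 R) x"
    using continuous_bsupp_bound[OF assms(2,3)] by blast
  then show ?thesis
    by (intro locint_bounded_support_integrable[OF assms(1) continuous_borel[OF assms(2)], of M R]) simp
qed

text \<open>The quotients are formed on the differentiable factor, so the other factor may be merely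
  locally integrable.\<close>

lemma integral_difference_quotient_tendsto:
  assumes v: "locint v" and f: "Ck 1 f" "bsupp f"
    and t: "t \<longlonglongrightarrow> 0" "\<And>n. t n \<noteq> (0::real)" "\<And>n. \<bar>t n\<bar> \<le> 1"
  shows "(\<lambda>n. LINT x|lborel. v x * ((f (x + t n *\<^sub>R axis i 1) - f x) / t n))
    \<longlonglongrightarrow> (LINT x|lborel. v x * pd i f x)"
proof -
  have cf: "continuous_on UNIV f" and cp: "continuous_on UNIV (pd i f)"
    using f Ck_continuous[of 1 f] by auto
  note [measurable] = locint_measurable[OF v] continuous_borel[OF cf] continuous_borel[OF cp]
  obtain M R where M: "\<And>t x. 0 < \<bar>t\<bar> \<Longrightarrow> \<bar>t\<bar> \<le> 1 \<Longrightarrow>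
    \<bar>(f (x + t *\<^sub>R axis i 1) - f x) / t\<bar> \<le> M * indicator (cball 0 R) x"
    using difference_quotient_bound[OF f, of i] by metis
  show ?thesis
  proof (rule integral_dominated_convergence)
    show "(\<lambda>x. v x * pd i f x) \<in> borel_measurable lborel" by measurable
    show "(\<lambda>x. v x * ((f (x + t n *\<^sub>R axis i 1) - f x) / t n)) \<in> borel_measurable lborel" for n by measurable
    have "integrable lborel (\<lambda>x. M * (indicator (cball 0 R) x * v x))"
      using v by (auto simp: locint_def)
    then show "integrable lborel (\<lambda>x. \<bar>M * (indicator (cball 0 R) x * v x)\<bar>)"
      by (rule integrable_abs)
    show "AE x in lborel. (\<lambda>n. v x * ((f (x + t n *\<^sub>R axis i 1) - f x) / t n)) \<longlonglongrightarrow> v x * pd i f x"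
      by (intro AE_I2 tendsto_mult_left difference_quotient_tendsto t) (use f in simp)
    show "AE x in lborel. norm (v x * ((f (x + t n *\<^sub>R axis i 1) - f x) / t n)) \<le> \<bar>M * (indicator (cball 0 R) x * v x)\<bar>" for n
    proof (rule AE_I2)
      fix x
      have "\<bar>v x\<bar> * \<bar>(f (x + t n *\<^sub>R axis i 1) - f x) / t n\<bar> \<le> \<bar>v x\<bar> * (M * indicator (cball 0 R) x)"
        by (rule mult_left_mono[OF M]) (use t in auto)
      also have "\<dots> \<le> \<bar>v x\<bar> * \<bar>M * indicator (cball 0 R) x\<bar>"
        by (rule mult_left_mono) auto
      finally show "norm (v x * ((f (x + t n *\<^sub>R axis i 1) - f x) / t n)) \<le> \<bar>M * (indicator (cball 0 R) x * v x)\<bar>"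
        by (simp add: abs_mult mult_ac)
    qed
  qed
qed

lemma locint_1: "locint (\<lambda>x. 1)"
  using integrable_indicator_cball[of 1] by (simp add: locint_def)

text \<open>Translation invariance makes the integral of every difference quotient vanish, and
  dominated convergence passes to the derivative; no iterated integrals are involved.\<close>

lemma integral_pd_eq_0:
  assumes f: "Ck 1 f" "bsupp f"
  shows "(LINT x|lborel. pd i f x) = 0"
proof -
  define t where "t n = 1 / real (Suc n)" for n
  have t: "t \<longlonglongrightarrow> 0" "\<And>n. t n \<noteq> 0" "\<And>n. \<bar>t n\<bar> \<le> 1"
    unfolding t_def using LIMSEQ_Suc[OF lim_inverse_n'] by auto
  have cf: "continuous_on UNIV f" using Ck_continuous[OF f(1)] .
  have i: "integrable lborel f" by (rule continuous_bsupp_integrable[OF cf f(2)])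
  have Z: "(LINT x|lborel. 1 * ((f (x + t n *\<^sub>R axis i 1) - f x) / t n)) = 0" for n
    using i integrable_translate[OF continuous_borel[OF cf]] integral_translate[OF continuous_borel[OF cf]]
    by simp
  have "(\<lambda>n. 0) \<longlonglongrightarrow> (LINT x|lborel. 1 * pd i f x)"
    using integral_difference_quotient_tendsto[OF locint_1 f t, of i] by (simp only: Z)
  from LIMSEQ_unique[OF this tendsto_const] show ?thesis by simp
qed

lemma bsupp_mult: "bsupp f \<or> bsupp g \<Longrightarrow> bsupp (\<lambda>x. f x * g x)"
  by (elim disjE) (erule bsupp_mult_left, erule bsupp_mult_right)

text \<open>Bounded support of one factor suffices, so that the soliton may be the other
  one.\<close>

lemma integral_by_parts:
  assumes f: "Ck 1 f" and g: "Ck 1 g" and b: "bsupp f \<or> bsupp g"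
  shows "(LINT x|lborel. pd i f x * g x) = - (LINT x|lborel. f x * pd i g x)"
proof -
  have d: "f differentiable (at x)" "g differentiable (at x)" for x using f g by auto
  have c: "continuous_on UNIV f" "continuous_on UNIV g" "continuous_on UNIV (pd i f)" "continuous_on UNIV (pd i g)"
    using f g Ck_continuous[of 1] by auto
  have "bsupp (\<lambda>x. f x * g x)" by (rule bsupp_mult[OF b])
  then have "0 = (LINT x|lborel. pd i (\<lambda>x. f x * g x) x)"
    using integral_pd_eq_0[of "\<lambda>x. f x * g x" i] Ck_mult[OF f g] by simp
  also have "\<dots> = (LINT x|lborel. pd i f x * g x + f x * pd i g x)"
    by (simp add: pd_mult d)
  also have "\<dots> = (LINT x|lborel. pd i f x * g x) + (LINT x|lborel. f x * pd i g x)"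
  proof (rule Bochner_Integration.integral_add)
    have b': "bsupp (pd i f) \<or> bsupp g" "bsupp f \<or> bsupp (pd i g)" using b bsupp_pd by blast+
    show "integrable lborel (\<lambda>x. pd i f x * g x)" "integrable lborel (\<lambda>x. f x * pd i g x)"
      by (rule continuous_bsupp_integrable[OF continuous_on_mult[OF c(3,2)] bsupp_mult[OF b'(1)]],
          rule continuous_bsupp_integrable[OF continuous_on_mult[OF c(1,4)] bsupp_mult[OF b'(2)]])
  qed
  finally show ?thesis by simp
qed

lemma integral_laplacian_by_parts:
  assumes f: "Ck 2 f" and g: "Ck 2 g" and b: "bsupp f \<or> bsupp g"
  shows "(LINT x|lborel. f x * classical_laplacian g x) = (LINT x|lborel. classical_laplacian f x * g x)"
proof -
  have 2: "(2::nat) = Suc 1" by simp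
  have f': "Ck 1 f" "Ck 1 (pd i f)" and g': "Ck 1 g" "Ck 1 (pd i g)" for i
    by (rule Ck_SucD[OF f[unfolded 2]] Ck_Suc_pd[OF f[unfolded 2]] Ck_SucD[OF g[unfolded 2]] Ck_Suc_pd[OF g[unfolded 2]])+
  have b': "bsupp f \<or> bsupp (pd i g)" "bsupp (pd i f) \<or> bsupp g" for i using b bsupp_pd by blast+
  have b'': "bsupp f \<or> bsupp (pd i (pd i g))" "bsupp (pd i (pd i f)) \<or> bsupp g" for i
    using b' bsupp_pd by blast+
  have c: "continuous_on UNIV f" "continuous_on UNIV g" "continuous_on UNIV (pd i (pd i f))" "continuous_on UNIV (pd i (pd i g))" for i
    using Ck_continuous[OF f'(1)] Ck_continuous[OF g'(1)]
      Ck_1_pd_continuous[of 0 "pd i f"] Ck_1_pd_continuous[of 0 "pd i g"] f'(2) g'(2) by auto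
  have 1: "(LINT x|lborel. f x * pd i (pd i g) x) = (LINT x|lborel. pd i (pd i f) x * g x)" for i
    using integral_by_parts[OF f'(1) g'(2) b'(1), of i i] integral_by_parts[OF f'(2) g'(1) b'(2), of i i] by simp
  have "integrable lborel (\<lambda>x. f x * pd i (pd i g) x)" "integrable lborel (\<lambda>x. pd i (pd i f) x * g x)" for i
    by (rule continuous_bsupp_integrable[OF continuous_on_mult[OF c(1,4)] bsupp_mult[OF b''(1)]],
        rule continuous_bsupp_integrable[OF continuous_on_mult[OF c(3,2)] bsupp_mult[OF b''(2)]])
  then show ?thesis
    unfolding laplacian_UNIV_2 distrib_left distrib_right using 1 by simp
qed

section \<open>The fundamental lemma\<close>

lemma indicator_approx_tendsto:
  "(\<lambda>n. 1 - exp (- real n * box_fun a b x)) \<longlonglongrightarrow> indicator (box a b) x"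
proof (cases "x \<in> box a b")
  case True
  then have p: "box_fun a b x > 0" by (rule box_fun_pos)
  have "exp (- box_fun a b x) < 1" using p by simp
  then have "(\<lambda>n. exp (- box_fun a b x) ^ n) \<longlonglongrightarrow> 0"
    by (intro LIMSEQ_realpow_zero[OF exp_ge_zero])
  then have "(\<lambda>n. 1 - exp (- box_fun a b x) ^ n) \<longlonglongrightarrow> 1 - 0"
    by (rule tendsto_diff[OF tendsto_const])
  then show ?thesis
    using True by (simp add: exp_of_nat_mult[symmetric])
next
  case False
  then show ?thesis by (simp add: box_fun_eq_0)
qed

lemma integral_box_eq_0:
  assumes v: "locint v" and z: "\<And>\<psi>. test_function \<psi> \<Longrightarrow> (LINT x|lborel. v x * \<psi> x) = 0"
  shows "(LINT x|lborel. v x * indicator (box a b) x) = 0"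
proof -
  note [measurable] = locint_measurable[OF v]
  have [measurable]: "box_fun a b \<in> borel_measurable borel"
    by (intro continuous_borel Ck_continuous[OF smoothD[OF smooth_box_fun]])
  obtain R where R: "box a b \<subseteq> cball 0 R"
    by (rule bounded_in_cball_0[OF bounded_box])
  have "(\<lambda>n. LINT x|lborel. v x * (1 - exp (- real n * box_fun a b x))) \<longlonglongrightarrow> (LINT x|lborel. v x * indicator (box a b) x)"
  proof (rule integral_dominated_convergence)
    show "integrable lborel (\<lambda>x. \<bar>indicator (cball 0 R) x * v x\<bar>)"
      using v by (intro integrable_abs) (simp add: locint_def)
    show "AE x in lborel. (\<lambda>n. v x * (1 - exp (- real n * box_fun a b x))) \<longlonglongrightarrow> v x * indicator (box a b) x"
      by (intro AE_I2 tendsto_mult_left indicator_approx_tendsto)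
    show "AE x in lborel. norm (v x * (1 - exp (- real n * box_fun a b x))) \<le> \<bar>indicator (cball 0 R) x * v x\<bar>" for n
    proof (rule AE_I2)
      fix x
      show "norm (v x * (1 - exp (- real n * box_fun a b x))) \<le> \<bar>indicator (cball 0 R) x * v x\<bar>"
      proof (cases "x \<in> box a b")
        case True
        have "exp (- (real n * box_fun a b x)) \<le> 1" using box_fun_nonneg[of a b x] by simp
        then have "\<bar>1 - exp (- (real n * box_fun a b x))\<bar> \<le> 1" by (auto simp: abs_le_iff)
        then have "\<bar>v x\<bar> * \<bar>1 - exp (- (real n * box_fun a b x))\<bar> \<le> \<bar>v x\<bar> * 1"
          by (rule mult_left_mono) simp
        then show ?thesis using True R by (auto simp: abs_mult)
      next
        case False
        then show ?thesis by (simp add: box_fun_eq_0)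
      qed
    qed
  qed measurable
  then have "(\<lambda>n. 0) \<longlonglongrightarrow> (LINT x|lborel. v x * indicator (box a b) x)"
    by (simp only: z[OF test_function_indicator_approx])
  from LIMSEQ_unique[OF this tendsto_const] show ?thesis .
qed

text \<open>The vanishing of the integral passes from test functions to open boxes, from boxes to
  all Borel sets, and from there to the density.\<close>

lemma fundamental_lemma:
  assumes v: "locint v" and z: "\<And>\<psi>. test_function \<psi> \<Longrightarrow> (LINT x|lborel. v x * \<psi> x) = 0"
  shows "AE x in lborel. v x = 0"
proof -
  note [measurable] = locint_measurable[OF v]
  have box: "(LINT x|lborel. v x * indicator (box a b) x) = 0" for a b
    by (rule integral_box_eq_0[OF v z])
  let ?K = "\<lambda>N::nat. box (- (real N *\<^sub>R One)) (real N *\<^sub>R One) :: (real^2) set"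
  have "AE x in lborel. indicator (?K N) x * v x = 0" for N
  proof -
    \<comment> \<open>The cut-off makes the function integrable on the whole plane, so that its
      integrals over complements and countable unions exist.\<close>
    define w where "w x = indicator (?K N) x * v x" for x
    obtain R where R: "?K N \<subseteq> cball 0 R"
      by (rule bounded_in_cball_0[OF bounded_box])
    have [measurable]: "w \<in> borel_measurable borel"
      unfolding w_def by measurable
    have i: "integrable lborel w"
    proof (rule Bochner_Integration.integrable_bound)
      show "integrable lborel (\<lambda>x. indicator (cball 0 R) x * v x)"
        using v by (simp add: locint_def)
      show "AE x in lborel. norm (w x) \<le> norm (indicator (cball 0 R) x * v x)"
        by (rule AE_I2) (use R in \<open>auto simp: w_def indicator_def\<close>)
    qed simp
    have si: "set_integrable lborel A w" if "A \<in> sets borel" for A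
      unfolding set_integrable_def using that i by (intro integrable_mult_indicator) auto
    let ?E = "range (\<lambda>(a, b). box a b :: (real^2) set)"
    have E: "sets borel = sigma_sets UNIV ?E"
      by (simp add: borel_eq_box)
    \<comment> \<open>Boxes are stable under intersection and generate the Borel sets, so an
      induction over disjoint unions and complements reaches every Borel set.\<close>
    have "(LINT x:A|lborel. w x) = 0" if "A \<in> sigma_sets UNIV ?E" for A
      using _ _ that
    proof (rule sigma_sets_induct_disjoint)
      show "Int_stable ?E" by (auto simp: Int_stable_def box_Int_box)
      show "?E \<subseteq> Pow UNIV" by simp
      fix A assume "A \<in> ?E"
      then obtain a b where A: "A = box a b" by auto
      have "\<exists>c d. ?K N \<inter> box a b = box c d"
        by (intro exI) (rule box_Int_box)
      then obtain c d where cd: "?K N \<inter> box a b = box c d"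
        by (elim exE)
      have "indicator A x *\<^sub>R w x = v x * indicator (box c d) x" for x
        unfolding cd[symmetric] A w_def by (auto simp: indicator_def)
      then show "(LINT x:A|lborel. w x) = 0"
        unfolding set_lebesgue_integral_def using box by simp
    next
      show "(LINT x:{}|lborel. w x) = 0" by (simp add: set_lebesgue_integral_def)
    next
      fix A assume A: "A \<in> sigma_sets UNIV ?E" "(LINT x:A|lborel. w x) = 0"
      have "(LINT x:(UNIV - A) \<union> A|lborel. w x) = (LINT x:UNIV - A|lborel. w x) + (LINT x:A|lborel. w x)"
      proof (rule set_integral_Un)
        have "A \<in> sets borel" using A(1) E by simp
        then have "UNIV - A \<in> sets borel" by simp
        then show "set_integrable lborel (UNIV - A) w" by (rule si)
        show "set_integrable lborel A w" using \<open>A \<in> sets borel\<close> by (rule si)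
      qed auto
      moreover have "(LINT x:(UNIV - A) \<union> A|lborel. w x) = (LINT x|lborel. v x * indicator (?K N) x)"
        by (simp add: set_lebesgue_integral_def w_def mult.commute)
      ultimately show "(LINT x:UNIV - A|lborel. w x) = 0"
        using A(2) box by simp
    next
      fix A :: "nat \<Rightarrow> (real^2) set"
      assume A: "disjoint_family A" "range A \<subseteq> sigma_sets UNIV ?E" "\<And>i. (LINT x:A i|lborel. w x) = 0"
      have Ai: "A i \<in> sets borel" for i using A(2) E by auto
      have "(LINT x:(\<Union>i. A i)|lborel. w x) = (\<Sum>i. LINT x:A i|lborel. w x)"
        by (rule lebesgue_integral_countable_add)
          (use Ai A(1) in \<open>auto simp: disjoint_family_on_def intro!: si\<close>)
      then show "(LINT x:(\<Union>i. A i)|lborel. w x) = 0"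
        using A(3) by simp
    qed
    then have "AE x in lborel. w x = 0"
      using E i by (intro density_unique_real[of lborel w "\<lambda>_. 0"])
        (simp_all add: set_lebesgue_integral_def)
    then show ?thesis by (simp add: w_def)
  qed
  then have "AE x in lborel. \<forall>N. indicator (?K N) x * v x = 0"
    by (intro AE_all_countable[THEN iffD2] allI)
  then show ?thesis
  proof eventually_elim
    case (elim x)
    obtain N where "x \<in> ?K N"
      using UN_box_eq_UNIV by blast
    then show "v x = 0" using elim by (auto simp: indicator_def dest!: spec[of _ N])
  qed
qed

section \<open>The Helmholtz equation in L2\<close>

lemma bsupp_translate:
  assumes "bsupp f" shows "bsupp (\<lambda>x. f (x + a))"
proof -
  obtain R where R: "{x. f x \<noteq> 0} \<subseteq> cball 0 R" by (rule bounded_in_cball_0[OF assms])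
  have "norm x \<le> R + norm a" if "f (x + a) \<noteq> 0" for x
  proof -
    have "norm (x + a) \<le> R" using R that by auto
    then show ?thesis using norm_triangle_ineq4[of "x + a" a] by simp
  qed
  then have "{x. f (x + a) \<noteq> 0} \<subseteq> cball 0 (R + norm a)" by auto
  then show ?thesis by (rule bounded_subset[OF bounded_cball])
qed

lemma Ck_translate: "Ck k f \<Longrightarrow> Ck k (\<lambda>x. f (x + a))"
  using Ck_affine[of k f 1 a] by simp

lemma pd_translate: "(\<And>x. f differentiable (at x)) \<Longrightarrow> pd i (\<lambda>x. f (x + a)) = (\<lambda>x. pd i f (x + a))"
  using pd_affine[of f i 1 a] by simp

text \<open>A correlation with a smooth function is differentiable however rough \<open>v\<close>
  is, because the derivative falls on the smooth factor.\<close>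

lemma has_derivative_integral_translate:
  assumes v: "locint v" and f: "Ck 1 f" "bsupp f"
  shows "((\<lambda>s. LINT y|lborel. v y * f (y + (x + s *\<^sub>R axis i 1))) has_real_derivative
    (LINT y|lborel. v y * pd i f (y + (x + s *\<^sub>R axis i 1)))) (at s)"
proof -
  define G where "G s = (LINT y|lborel. v y * f (y + (x + s *\<^sub>R axis i 1)))" for s
  define f' where "f' y = f (y + (x + s *\<^sub>R axis i 1))" for y
  have f': "Ck 1 f'" "bsupp f'"
    unfolding f'_def by (rule Ck_translate[OF f(1)], rule bsupp_translate[OF f(2)])
  have df: "f differentiable (at x)" for x using f(1) by simp
  have int: "integrable lborel (\<lambda>y. v y * f (y + a))" for a
    by (rule locint_bsupp_integrable[OF v Ck_continuous[OF Ck_translate[OF f(1)]] bsupp_translate[OF f(2)]])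
  \<comment> \<open>The restriction to steps below 1 is the range of the uniform bound on difference
    quotients; as a neighbourhood of 0 it does not affect the limit.\<close>
  have "((\<lambda>h. (G (s + h) - G s) / h) \<longlongrightarrow> (LINT y|lborel. v y * pd i f' y)) (at 0 within {-1<..<1})"
    unfolding tendsto_at_iff_sequentially o_def
  proof (intro allI impI)
    fix t :: "nat \<Rightarrow> real" assume t: "\<forall>n. t n \<in> {-1<..<1} - {0}" "t \<longlonglongrightarrow> 0"
    have "(G (s + t n) - G s) / t n = (LINT y|lborel. v y * ((f' (y + t n *\<^sub>R axis i 1) - f' y) / t n))" for n
    proof -
      have "(LINT y|lborel. v y * ((f' (y + t n *\<^sub>R axis i 1) - f' y) / t n)) =
        (LINT y|lborel. (v y * f (y + (x + (s + t n) *\<^sub>R axis i 1)) - v y * f (y + (x + s *\<^sub>R axis i 1))) / t n)"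
        by (rule Bochner_Integration.integral_cong) (simp_all add: f'_def algebra_simps diff_divide_distrib)
      also have "\<dots> = (G (s + t n) - G s) / t n"
        unfolding G_def by (subst Bochner_Integration.integral_diff[OF int int, symmetric]) simp
      finally show ?thesis by (rule sym)
    qed
    moreover have "(\<lambda>n. LINT y|lborel. v y * ((f' (y + t n *\<^sub>R axis i 1) - f' y) / t n))
        \<longlonglongrightarrow> (LINT y|lborel. v y * pd i f' y)"
      by (rule integral_difference_quotient_tendsto[OF v f' t(2)]) (use t(1) in \<open>auto simp: abs_le_iff less_imp_le\<close>)
    ultimately show "(\<lambda>n. (G (s + t n) - G s) / t n) \<longlonglongrightarrow> (LINT y|lborel. v y * pd i f' y)"
      by (simp only:)
  qed
  then have "((\<lambda>h. (G (s + h) - G s) / h) \<longlongrightarrow> (LINT y|lborel. v y * pd i f' y)) (at 0)"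
    by (simp add: at_within_open[of 0 "{-1<..<1::real}"])
  moreover have "pd i f' = (\<lambda>y. pd i f (y + (x + s *\<^sub>R axis i 1)))"
    unfolding f'_def by (rule pd_translate[OF df])
  ultimately show ?thesis
    unfolding G_def[symmetric] DERIV_def by simp
qed

text \<open>The first derivative vanishes at the maximum; if it were increasing there, it would be
  positive just to the right and G would exceed its maximum.\<close>

lemma second_derivative_at_max:
  fixes G :: "real \<Rightarrow> real"
  assumes G: "\<And>s. (G has_real_derivative G' s) (at s)" and G': "(G' has_real_derivative c) (at 0)"
    and max: "\<And>s. G s \<le> G 0"
  shows "c \<le> 0"
proof (rule ccontr)
  assume "\<not> c \<le> 0"
  then obtain d where d: "d > 0" "\<And>h. 0 < h \<Longrightarrow> h < d \<Longrightarrow> G' 0 < G' (0 + h)"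
    using DERIV_pos_inc_right[OF G'] by (auto simp: not_le)
  have "G' 0 = 0"
    by (rule DERIV_local_max[OF G zero_less_one]) (simp add: max)
  obtain z where z: "0 < z" "z < d / 2" "G (d / 2) - G 0 = (d / 2 - 0) * G' z"
    using MVT2[of 0 "d / 2" G G'] G d(1) by auto
  have "G' z > 0" using d(2)[of z] z \<open>G' 0 = 0\<close> by simp
  then have "(d / 2 - 0) * G' z > 0" using d(1) by simp
  then have "G (d / 2) - G 0 > 0" unfolding z(3) .
  then show False using max[of "d / 2"] by simp
qed

lemma translated_integral_continuous:
  assumes v: "locint v" and f: "continuous_on UNIV f" "bsupp f"
  shows "continuous_on UNIV (\<lambda>x. LINT y|lborel. v y * f (y + x))"
proof -
  note [measurable] = locint_measurable[OF v] continuous_borel[OF f(1)]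
  obtain M R where M: "M \<ge> 0" "\<And>x. \<bar>f x\<bar> \<le> M * indicator (cball 0 R) x"
    using continuous_bsupp_bound[OF f] by metis
  have "(\<lambda>n. LINT y|lborel. v y * f (y + X n)) \<longlonglongrightarrow> (LINT y|lborel. v y * f (y + a))"
    if X: "X \<longlonglongrightarrow> a" for X a
  proof -
    obtain B where B: "\<And>n. norm (X n) \<le> B"
      using convergent_imp_Bseq[of X] X unfolding Bseq_def convergent_def by blast
    show ?thesis
    proof (rule integral_dominated_convergence)
      show "integrable lborel (\<lambda>y. \<bar>M * (indicator (cball 0 (R + B)) y * v y)\<bar>)"
        using v by (intro integrable_abs integrable_mult_right) (simp add: locint_def)
      show "AE y in lborel. (\<lambda>n. v y * f (y + X n)) \<longlonglongrightarrow> v y * f (y + a)"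
      proof (intro AE_I2 tendsto_mult_left)
        fix y
        have "(\<lambda>n. y + X n) \<longlonglongrightarrow> y + a" by (intro tendsto_intros X)
        then show "(\<lambda>n. f (y + X n)) \<longlonglongrightarrow> f (y + a)"
          by (rule continuous_on_tendsto_compose[OF f(1)]) auto
      qed
      show "AE y in lborel. norm (v y * f (y + X n)) \<le> \<bar>M * (indicator (cball 0 (R + B)) y * v y)\<bar>" for n
      proof (rule AE_I2)
        fix y
        have "norm y \<le> R + B" if "norm (y + X n) \<le> R"
          using norm_triangle_ineq4[of "y + X n" "X n"] B[of n] that by simp
        then have "indicator (cball 0 R) (y + X n) \<le> (indicator (cball 0 (R + B)) y :: real)"
          by (auto simp: indicator_def)
        then have "\<bar>f (y + X n)\<bar> \<le> M * indicator (cball 0 (R + B)) y"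
          using M(2)[of "y + X n"] mult_left_mono[OF _ M(1)] by (meson order_trans)
        then have "\<bar>v y\<bar> * \<bar>f (y + X n)\<bar> \<le> \<bar>v y\<bar> * (M * indicator (cball 0 (R + B)) y)"
          by (rule mult_left_mono) simp
        then show "norm (v y * f (y + X n)) \<le> \<bar>M * (indicator (cball 0 (R + B)) y * v y)\<bar>"
          using M(1) by (simp add: abs_mult mult_ac)
      qed
    qed measurable
  qed
  then show ?thesis
    by (intro continuous_at_imp_continuous_on ballI) (auto simp: continuous_at_sequentially o_def)
qed

text \<open>For large x the support of the translate lies where \<open>v\<close> has little mass. A
  weighted Young inequality, |v f| \<le> v^2/(2d) + d f^2/2, separates this mass from the
  translation-invariant integral of f^2.\<close>

lemma translated_integral_vanishes_at_infinity:
  assumes v: "sqi v" and f: "continuous_on UNIV f" "bsupp f" and e: "e > 0"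
  shows "\<exists>B. \<forall>x. norm x \<ge> B \<longrightarrow> \<bar>LINT y|lborel. v y * f (y + x)\<bar> \<le> e"
proof -
  note [measurable] = sqi_measurable[OF v] continuous_borel[OF f(1)]
  obtain M R where M: "M \<ge> 0" "\<And>x. \<bar>f x\<bar> \<le> M * indicator (cball 0 R) x"
    using continuous_bsupp_bound[OF f] by metis
  define C where "C = (LINT y|lborel. (f y)\<^sup>2)"
  have C: "C \<ge> 0" by (simp add: C_def)
  \<comment> \<open>This weight makes the f^2 term at most e/2; a tail of v^2 below e d makes the
    other term at most e/2 as well.\<close>
  define d where "d = e / (C + 1)"
  have d: "d > 0" using e C by (simp add: d_def)
  have i: "integrable lborel (\<lambda>y. (v y)\<^sup>2)" using v by (simp add: sqi_def)
  have "(\<lambda>n. LINT y|lborel. (v y)\<^sup>2 * indicator (- ball 0 (real n)) y) \<longlonglongrightarrow> (LINT y|(lborel :: (real^2) measure). 0)"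
  proof (rule integral_dominated_convergence)
    show "integrable lborel (\<lambda>y. (v y)\<^sup>2)" by (rule i)
    show "AE y in lborel. (\<lambda>n. (v y)\<^sup>2 * indicator (- ball 0 (real n)) y) \<longlonglongrightarrow> 0"
    proof (rule AE_I2)
      fix y :: "real^2"
      obtain N where "norm y < real N" using reals_Archimedean2 by blast
      then have "\<forall>n\<ge>N. (v y)\<^sup>2 * indicator (- ball 0 (real n)) y = 0" by (auto simp: indicator_def)
      then show "(\<lambda>n. (v y)\<^sup>2 * indicator (- ball 0 (real n)) y) \<longlonglongrightarrow> 0"
        by (intro tendsto_eventually) (auto simp: eventually_sequentially)
    qed
    show "AE y in lborel. norm ((v y)\<^sup>2 * indicator (- ball 0 (real n)) y) \<le> (v y)\<^sup>2" for n
      by (rule AE_I2) (auto simp: indicator_def)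
    show "(\<lambda>y. (v y)\<^sup>2 * indicator (- ball 0 (real n)) y) \<in> borel_measurable lborel" for n
      by (intro borel_measurable_times borel_measurable_power borel_measurable_indicator) auto
  qed simp
  moreover have "e * d > 0" using e d by simp
  ultimately have "\<forall>\<^sub>F n in sequentially. (LINT y|lborel. (v y)\<^sup>2 * indicator (- ball 0 (real n)) y) < e * d"
    using order_tendstoD(2) by fastforce
  then obtain N where N: "(LINT y|lborel. (v y)\<^sup>2 * indicator (- ball 0 (real N)) y) < e * d"
    unfolding eventually_sequentially by blast
  have ind: "integrable lborel (\<lambda>y. (v y)\<^sup>2 * indicator (- ball 0 (real N)) y)"
    by (rule Bochner_Integration.integrable_bound[OF i])
      (auto intro!: borel_measurable_times borel_measurable_power borel_measurable_indicator AE_I2 simp: indicator_def)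
  have "\<bar>LINT y|lborel. v y * f (y + x)\<bar> \<le> e" if x: "norm x \<ge> real N + R" for x
  proof -
    let ?g = "\<lambda>y. ((v y)\<^sup>2 * indicator (- ball 0 (real N)) y) / (2 * d) + d / 2 * (f (y + x))\<^sup>2"
    have fi: "integrable lborel (\<lambda>y. (f (y + x))\<^sup>2)"
      using continuous_bsupp_sqi[OF f] by (subst integrable_translate) (auto simp: sqi_def)
    have le: "\<bar>v y * f (y + x)\<bar> \<le> ?g y" for y
    proof (cases "f (y + x) = 0")
      case True
      then show ?thesis using d by (simp add: indicator_def)
    next
      case False
      then have "norm (y + x) \<le> R" using M(2)[of "y + x"] by (cases "norm (y + x) \<le> R") auto
      then have "norm y \<ge> real N"
        using x norm_triangle_ineq4[of "y + x" y] by simp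
      then have I: "indicator (- ball 0 (real N)) y = (1::real)" by (simp add: indicator_def)
      have "0 \<le> (\<bar>v y\<bar> - d * \<bar>f (y + x)\<bar>)\<^sup>2" by simp
      then have "2 * d * (\<bar>v y\<bar> * \<bar>f (y + x)\<bar>) \<le> (v y)\<^sup>2 + d\<^sup>2 * (f (y + x))\<^sup>2"
        by (simp add: power2_diff power_mult_distrib algebra_simps)
      then show ?thesis unfolding I using d by (simp add: abs_mult field_simps power2_eq_square)
    qed
    have gi: "integrable lborel ?g" using fi ind by auto
    have "\<bar>LINT y|lborel. v y * f (y + x)\<bar> \<le> (LINT y|lborel. \<bar>v y * f (y + x)\<bar>)"
      by (rule integral_abs_bound)
    also have "\<dots> \<le> (LINT y|lborel. ?g y)"
    proof (rule integral_mono[OF _ gi le])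
      show "integrable lborel (\<lambda>y. \<bar>v y * f (y + x)\<bar>)"
        by (intro integrable_abs locint_bsupp_integrable[OF sqi_locint[OF v]] bsupp_translate[OF f(2)]
            continuous_on_compose2[OF f(1)] continuous_intros) auto
    qed
    also have "\<dots> = (LINT y|lborel. (v y)\<^sup>2 * indicator (- ball 0 (real N)) y) / (2 * d) + d / 2 * (LINT y|lborel. (f (y + x))\<^sup>2)"
      using fi ind by (subst Bochner_Integration.integral_add) auto
    also have "(LINT y|lborel. (f (y + x))\<^sup>2) = C"
      unfolding C_def by (rule integral_translate[of "\<lambda>y. (f y)\<^sup>2"]) measurable
    also have "(LINT y|lborel. (v y)\<^sup>2 * indicator (- ball 0 (real N)) y) / (2 * d) + d / 2 * C \<le> e * d / (2 * d) + e / 2"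
    proof (rule add_mono)
      show "(LINT y|lborel. (v y)\<^sup>2 * indicator (- ball 0 (real N)) y) / (2 * d) \<le> e * d / (2 * d)"
        using N d by (intro divide_right_mono) auto
      have "d * C \<le> e" using C e by (simp add: d_def field_simps)
      then show "d / 2 * C \<le> e / 2" by simp
    qed
    also have "\<dots> = e" using d by simp
    finally show ?thesis .
  qed
  then show ?thesis by blast
qed

lemma classical_laplacian_translate:
  assumes "test_function \<eta>"
  shows "classical_laplacian (\<lambda>y. \<eta> (y + x)) y = classical_laplacian \<eta> (y + x)"
  unfolding laplacian_UNIV_2
  by (simp add: pd_translate test_function_differentiable assms test_function_pd)

lemma helmholtz_nonpos:
  assumes v: "sqi v"
    and z: "\<And>\<psi>. test_function \<psi> \<Longrightarrow> (LINT x|lborel. v x * (\<psi> x - classical_laplacian \<psi> x)) = 0"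
    and \<eta>: "test_function \<eta>"
  shows "(LINT y|lborel. v y * \<eta> y) \<le> 0"
proof (rule ccontr)
  define F where "F f x = (LINT y|lborel. v y * f (y + x))" for f x
  assume "\<not> (LINT y|lborel. v y * \<eta> y) \<le> 0"
  then have F0: "F \<eta> 0 > 0" by (simp add: F_def)
  note c = test_function_continuous and b = test_function_bsupp
  \<comment> \<open>Outside a ball the correlation is at most half its value at 0, so its maximum
    over the ball is a global one.\<close>
  obtain B where B: "\<And>x. norm x \<ge> B \<Longrightarrow> \<bar>F \<eta> x\<bar> \<le> F \<eta> 0 / 2"
    using translated_integral_vanishes_at_infinity[OF v c[OF \<eta>] b[OF \<eta>], of "F \<eta> 0 / 2"] F0
    unfolding F_def by auto
  have cont: "continuous_on (cball 0 \<bar>B\<bar>) (F \<eta>)"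
    using translated_integral_continuous[OF sqi_locint[OF v] c[OF \<eta>] b[OF \<eta>]]
    unfolding F_def[symmetric] by (rule continuous_on_subset) simp
  obtain x where x: "\<And>y. y \<in> cball 0 \<bar>B\<bar> \<Longrightarrow> F \<eta> y \<le> F \<eta> x"
    using continuous_attains_sup[OF compact_cball _ cont] by (metis abs_ge_zero cball_eq_empty not_less)
  have x0: "F \<eta> x \<ge> F \<eta> 0" by (rule x) simp
  have mx: "F \<eta> y \<le> F \<eta> x" for y
  proof (cases "norm y \<le> \<bar>B\<bar>")
    case True
    then show ?thesis by (intro x) simp
  next
    case False
    then have "\<bar>F \<eta> y\<bar> \<le> F \<eta> 0 / 2" by (intro B) simp
    then show ?thesis using x0 F0 by linarith
  qed
  have "F (pd i (pd i \<eta>)) x \<le> 0" for i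
  proof (rule second_derivative_at_max)
    show "((\<lambda>s. F \<eta> (x + s *\<^sub>R axis i 1)) has_real_derivative F (pd i \<eta>) (x + s *\<^sub>R axis i 1)) (at s)" for s
      unfolding F_def by (rule has_derivative_integral_translate[OF sqi_locint[OF v] test_function_Ck[OF \<eta>] b[OF \<eta>]])
    show "((\<lambda>s. F (pd i \<eta>) (x + s *\<^sub>R axis i 1)) has_real_derivative F (pd i (pd i \<eta>)) x) (at 0)"
      using has_derivative_integral_translate[OF sqi_locint[OF v] test_function_Ck[OF test_function_pd[OF \<eta>]]
          b[OF test_function_pd[OF \<eta>]], of i x i 0]
      unfolding F_def by simp
    show "F \<eta> (x + s *\<^sub>R axis i 1) \<le> F \<eta> (x + 0 *\<^sub>R axis i 1)" for s
      using mx by simp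
  qed
  \<comment> \<open>The hypothesis, applied to the translate of \<eta> by x, says that the
    correlation equals its own Laplacian at x. This contradicts a positive maximum.\<close>
  moreover have "F \<eta> x = F (pd 1 (pd 1 \<eta>)) x + F (pd 2 (pd 2 \<eta>)) x"
  proof -
    let ?\<psi> = "\<lambda>y. \<eta> (y + x)"
    have \<psi>: "test_function ?\<psi>" using test_function_affine[OF \<eta>, of 1 x] by simp
    have i: "integrable lborel (\<lambda>y. v y * g (y + x))" if "test_function g" for g
      using sqi_integrable_mult[OF v test_function_sqi[OF test_function_affine[OF that, of 1 x]]] by simp
    have "0 = (LINT y|lborel. v y * (?\<psi> y - classical_laplacian ?\<psi> y))"
      using z[OF \<psi>] by simp
    also have "\<dots> = (LINT y|lborel. v y * \<eta> (y + x) - (v y * pd 1 (pd 1 \<eta>) (y + x) + v y * pd 2 (pd 2 \<eta>) (y + x)))"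
      by (simp add: classical_laplacian_translate[OF \<eta>] laplacian_UNIV_2 algebra_simps)
    also have "\<dots> = F \<eta> x - (F (pd 1 (pd 1 \<eta>)) x + F (pd 2 (pd 2 \<eta>)) x)"
      unfolding F_def
      by (subst Bochner_Integration.integral_diff Bochner_Integration.integral_add;
          (intro Bochner_Integration.integrable_add i test_function_pd \<eta>)?)+ simp
    finally show ?thesis by simp
  qed
  ultimately show False using x0 F0 by (smt (verit))
qed

lemma helmholtz_unique:
  assumes v: "sqi v"
    and z: "\<And>\<psi>. test_function \<psi> \<Longrightarrow> (LINT x|lborel. v x * (\<psi> x - classical_laplacian \<psi> x)) = 0"
  shows "AE x in lborel. v x = 0"
proof (rule fundamental_lemma[OF sqi_locint[OF v]])
  fix \<eta> assume \<eta>: "test_function \<eta>"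
  have "(LINT y|lborel. v y * (-1 * \<eta> y)) \<le> 0"
    by (rule helmholtz_nonpos[OF v z test_function_cmult[OF \<eta>]])
  then show "(LINT x|lborel. v x * \<eta> x) = 0"
    using helmholtz_nonpos[OF v z \<eta>] by simp
qed

lemma cinner_to_L2c_to_L2:
  assumes "sqi a" "sqi b" "sqi g"
  shows "cinner (to_L2c a b) (to_L2 g) = Complex (LINT x|lborel. a x * g x) (LINT x|lborel. b x * g x)"
  unfolding to_L2c_def cinner_add_left cinner_cscale_left
  by (simp add: cinner_to_L2 assms complex_eq_iff)

lemma test_function_minus_laplacian:
  "test_function \<psi> \<Longrightarrow> test_function (\<lambda>x. \<psi> x - classical_laplacian \<psi> x)"
  by (rule test_function_diff[OF _ test_function_laplacian])

lemma L2_eq_0_if_orthogonal_to_test_functions: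
  assumes "\<And>\<psi>. test_function \<psi> \<Longrightarrow> cinner v (to_L2 \<psi>) = 0"
  shows "v = 0"
proof -
  obtain a b where ab: "sqi a" "sqi b" "v = to_L2c a b" by (rule L2_eq_to_L2c)
  have "(LINT x|lborel. a x * \<psi> x) = 0 \<and> (LINT x|lborel. b x * \<psi> x) = 0" if "test_function \<psi>" for \<psi>
    using assms[OF that] unfolding ab(3)
    by (simp add: cinner_to_L2c_to_L2[OF ab(1,2) test_function_sqi[OF that]] complex_eq_iff)
  then have "AE x in lborel. a x = 0" "AE x in lborel. b x = 0"
    using fundamental_lemma[OF sqi_locint] ab by auto
  then show ?thesis
    using to_L2_eq_0_iff[OF ab(1)] to_L2_eq_0_iff[OF ab(2)] by (simp add: ab(3) to_L2c_def)
qed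

lemma L2_eq_0_if_helmholtz:
  assumes "\<And>\<psi>. test_function \<psi> \<Longrightarrow> cinner v (to_L2 (\<lambda>x. \<psi> x - classical_laplacian \<psi> x)) = 0"
  shows "v = 0"
proof -
  obtain a b where ab: "sqi a" "sqi b" "v = to_L2c a b" by (rule L2_eq_to_L2c)
  have "(LINT x|lborel. a x * (\<psi> x - classical_laplacian \<psi> x)) = 0 \<and>
        (LINT x|lborel. b x * (\<psi> x - classical_laplacian \<psi> x)) = 0" if "test_function \<psi>" for \<psi>
    using assms[OF that] unfolding ab(3)
    by (simp add: cinner_to_L2c_to_L2[OF ab(1,2) test_function_sqi[OF test_function_minus_laplacian[OF that]]] complex_eq_iff)
  then have "AE x in lborel. a x = 0" "AE x in lborel. b x = 0"
    using helmholtz_unique[OF ab(1)] helmholtz_unique[OF ab(2)] by auto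
  then show ?thesis
    using to_L2_eq_0_iff[OF ab(1)] to_L2_eq_0_iff[OF ab(2)] by (simp add: ab(3) to_L2c_def)
qed

section \<open>Weak Laplacians and weak partial derivatives\<close>

text \<open>The distributional Laplacian of u is the square-integrable w. Nothing is said about
  single derivatives, so membership in \<open>sobolev 2\<close> is a regularity theorem.\<close>

definition weak_laplacian :: "L2 \<Rightarrow> L2 \<Rightarrow> bool" where
  "weak_laplacian u w \<longleftrightarrow>
     (\<forall>\<psi>. test_function \<psi> \<longrightarrow> cinner u (to_L2 (classical_laplacian \<psi>)) = cinner w (to_L2 \<psi>))"

lemma weak_laplacianD:
  "weak_laplacian u w \<Longrightarrow> test_function \<psi> \<Longrightarrow> cinner u (to_L2 (classical_laplacian \<psi>)) = cinner w (to_L2 \<psi>)"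
  by (simp add: weak_laplacian_def)

lemma weak_laplacian_add:
  "weak_laplacian u w \<Longrightarrow> weak_laplacian u' w' \<Longrightarrow> weak_laplacian (u + u') (w + w')"
  by (simp add: weak_laplacian_def cinner_add_left)

lemma weak_laplacian_cscale: "weak_laplacian u w \<Longrightarrow> weak_laplacian (cscale c u) (cscale c w)"
  by (simp add: weak_laplacian_def cinner_cscale_left)

lemma weak_laplacian_to_L2:
  assumes f: "Ck 2 f" "sqi f" "sqi (classical_laplacian f)"
  shows "weak_laplacian (to_L2 f) (to_L2 (classical_laplacian f))"
  unfolding weak_laplacian_def
proof (intro allI impI)
  fix \<psi> assume \<psi>: "test_function \<psi>"
  have "(LINT x|lborel. f x * classical_laplacian \<psi> x) = (LINT x|lborel. classical_laplacian f x * \<psi> x)"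
    by (rule integral_laplacian_by_parts[OF f(1) test_function_Ck[OF \<psi>]]) (use test_function_bsupp[OF \<psi>] in blast)
  then show "cinner (to_L2 f) (to_L2 (classical_laplacian \<psi>)) = cinner (to_L2 (classical_laplacian f)) (to_L2 \<psi>)"
    by (simp add: cinner_to_L2 f test_function_sqi \<psi> test_function_laplacian)
qed

lemma weak_laplacian_test:
  "test_function f \<Longrightarrow> weak_laplacian (to_L2 f) (to_L2 (classical_laplacian f))"
  by (intro weak_laplacian_to_L2 test_function_Ck test_function_sqi test_function_laplacian)

lemma has_weak_pd_iff:
  "has_weak_pd i u v \<longleftrightarrow>
    (\<forall>\<psi>. test_function \<psi> \<longrightarrow> cinner u (to_L2 (pd i \<psi>)) = - cinner v (to_L2 \<psi>))"
  unfolding has_weak_pd_def by (simp add: cinner_to_L2_right test_function_sqi test_function_pd)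

lemma has_weak_pd_unique:
  assumes "has_weak_pd i u v" "has_weak_pd i u v'"
  shows "v = v'"
proof -
  have "v - v' = 0"
    by (rule L2_eq_0_if_orthogonal_to_test_functions)
      (use assms in \<open>simp add: has_weak_pd_iff cinner_diff_left\<close>)
  then show ?thesis by simp
qed

lemma weak_pd_eq: "has_weak_pd i u v \<Longrightarrow> weak_pd i u = v"
  unfolding weak_pd_def by (rule the_equality) (auto intro: has_weak_pd_unique)

lemma has_weak_pd_add: "has_weak_pd i u v \<Longrightarrow> has_weak_pd i u' v' \<Longrightarrow> has_weak_pd i (u + u') (v + v')"
  by (simp add: has_weak_pd_iff cinner_add_left)

lemma has_weak_pd_cscale: "has_weak_pd i u v \<Longrightarrow> has_weak_pd i (cscale c u) (cscale c v)"
  by (simp add: has_weak_pd_iff cinner_cscale_left)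

lemma has_weak_pd_limit:
  assumes "\<And>n. has_weak_pd i (u n) (v n)" "u \<longlonglongrightarrow> U" "v \<longlonglongrightarrow> V"
  shows "has_weak_pd i U V"
  unfolding has_weak_pd_iff
proof (intro allI impI)
  fix \<psi> assume \<psi>: "test_function \<psi>"
  have "(\<lambda>n. cinner (u n) (to_L2 (pd i \<psi>))) \<longlonglongrightarrow> cinner U (to_L2 (pd i \<psi>))"
    by (intro tendsto_cinner assms(2) tendsto_const)
  moreover have "(\<lambda>n. - cinner (v n) (to_L2 \<psi>)) \<longlonglongrightarrow> - cinner V (to_L2 \<psi>)"
    by (intro tendsto_minus tendsto_cinner assms(3) tendsto_const)
  moreover have "cinner (u n) (to_L2 (pd i \<psi>)) = - cinner (v n) (to_L2 \<psi>)" for n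
    using assms(1) \<psi> by (simp add: has_weak_pd_iff)
  ultimately show "cinner U (to_L2 (pd i \<psi>)) = - cinner V (to_L2 \<psi>)"
    by (simp add: LIMSEQ_unique)
qed

lemma has_weak_pd_test:
  assumes f: "test_function f" shows "has_weak_pd i (to_L2 f) (to_L2 (pd i f))"
  unfolding has_weak_pd_iff
proof (intro allI impI)
  fix \<psi> assume \<psi>: "test_function \<psi>"
  have "(LINT x|lborel. pd i f x * \<psi> x) = - (LINT x|lborel. f x * pd i \<psi> x)"
    by (rule integral_by_parts[OF test_function_Ck[OF f] test_function_Ck[OF \<psi>]])
      (use test_function_bsupp[OF \<psi>] in blast)
  then show "cinner (to_L2 f) (to_L2 (pd i \<psi>)) = - cinner (to_L2 (pd i f)) (to_L2 \<psi>)"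
    by (simp add: cinner_to_L2 f test_function_sqi \<psi> test_function_pd)
qed

lemma has_weak_pd_testc:
  "test_function a \<Longrightarrow> test_function b \<Longrightarrow> has_weak_pd i (to_L2c a b) (to_L2c (pd i a) (pd i b))"
  unfolding to_L2c_def by (intro has_weak_pd_add has_weak_pd_cscale has_weak_pd_test)

lemma weak_laplacian_testc:
  "test_function a \<Longrightarrow> test_function b \<Longrightarrow>
    weak_laplacian (to_L2c a b) (to_L2c (classical_laplacian a) (classical_laplacian b))"
  unfolding to_L2c_def by (intro weak_laplacian_add weak_laplacian_cscale weak_laplacian_test)

lemma weak_laplacian_limit:
  assumes "\<And>n. weak_laplacian (u n) (v n)" "u \<longlonglongrightarrow> U" "v \<longlonglongrightarrow> V"
  shows "weak_laplacian U V"
  unfolding weak_laplacian_def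
proof (intro allI impI)
  fix \<psi> assume \<psi>: "test_function \<psi>"
  have "(\<lambda>n. cinner (u n) (to_L2 (classical_laplacian \<psi>))) \<longlonglongrightarrow> cinner U (to_L2 (classical_laplacian \<psi>))"
    by (intro tendsto_cinner assms(2) tendsto_const)
  moreover have "(\<lambda>n. cinner (v n) (to_L2 \<psi>)) \<longlonglongrightarrow> cinner V (to_L2 \<psi>)"
    by (intro tendsto_cinner assms(3) tendsto_const)
  moreover have "cinner (u n) (to_L2 (classical_laplacian \<psi>)) = cinner (v n) (to_L2 \<psi>)" for n
    using assms(1) \<psi> by (simp add: weak_laplacian_def)
  ultimately show "cinner U (to_L2 (classical_laplacian \<psi>)) = cinner V (to_L2 \<psi>)"
    by (simp add: LIMSEQ_unique)
qed

section \<open>A priori estimates for test functions\<close>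

lemma test_integrable_mult:
  "test_function f \<Longrightarrow> test_function g \<Longrightarrow> integrable lborel (\<lambda>x. f x * g x)"
  by (intro sqi_integrable_mult test_function_sqi)

lemma test_by_parts:
  assumes "test_function f" "test_function g"
  shows "(LINT x|lborel. pd i f x * g x) = - (LINT x|lborel. f x * pd i g x)"
  by (rule integral_by_parts[OF test_function_Ck[OF assms(1)] test_function_Ck[OF assms(2)]])
    (use test_function_bsupp[OF assms(1)] in blast)

lemma test_gradient_energy:
  assumes f: "test_function f"
  shows "(\<Sum>i\<in>UNIV. LINT x|lborel. pd i f x * pd i f x) = - (LINT x|lborel. classical_laplacian f x * f x)"
proof -
  have i: "integrable lborel (\<lambda>x. pd i (pd i f) x * f x)" for i
    by (intro test_integrable_mult test_function_pd f)
  have "(LINT x|lborel. classical_laplacian f x * f x) = (\<Sum>i\<in>UNIV. LINT x|lborel. pd i (pd i f) x * f x)"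
    unfolding sum_2 laplacian_UNIV_2 distrib_right by (rule Bochner_Integration.integral_add[OF i i])
  also have "\<dots> = (\<Sum>i\<in>UNIV. - (LINT x|lborel. pd i f x * pd i f x))"
    by (intro sum.cong refl test_by_parts test_function_pd f)
  finally show ?thesis by (simp add: sum_negf)
qed

text \<open>The gradient identity is applied to each partial derivative of f. Since partial
  derivatives commute with the Laplacian, one further integration by parts collects both factors
  into \<Delta>f.\<close>

lemma test_hessian_energy:
  assumes f: "test_function f"
  shows "(\<Sum>i\<in>UNIV. \<Sum>j\<in>UNIV. LINT x|lborel. pd j (pd i f) x * pd j (pd i f) x) =
    (LINT x|lborel. classical_laplacian f x * classical_laplacian f x)"
proof -
  note t = test_function_pd test_function_laplacian f
  have "pd j (pd j (pd i f)) x = pd i (pd j (pd j f)) x" for i j x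
    using pd_commute[OF test_function_Ck[OF test_function_pd[OF f]], of j i j]
      pd_commute[OF test_function_Ck[OF f], of j i] by simp
  then have c: "classical_laplacian (pd i f) x = pd i (classical_laplacian f) x" for i x
    unfolding laplacian_UNIV_2[abs_def]
    by (simp add: pd_add test_function_differentiable t)
  have "(\<Sum>i\<in>UNIV. \<Sum>j\<in>UNIV. LINT x|lborel. pd j (pd i f) x * pd j (pd i f) x) =
      (\<Sum>i\<in>UNIV. - (LINT x|lborel. classical_laplacian (pd i f) x * pd i f x))"
    by (intro sum.cong refl test_gradient_energy t)
  also have "\<dots> = (\<Sum>i\<in>UNIV. LINT x|lborel. classical_laplacian f x * pd i (pd i f) x)"
    unfolding c by (intro sum.cong refl) (simp add: test_by_parts t)
  also have "\<dots> = (LINT x|lborel. classical_laplacian f x * classical_laplacian f x)"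
    unfolding sum_2 laplacian_UNIV_2[of f] distrib_left[of _ "pd 1 (pd 1 f) _"]
    by (rule Bochner_Integration.integral_add[symmetric];
        intro sqi_integrable_mult sqi_add test_function_sqi t)
  finally show ?thesis .
qed

lemma norm_to_L2_mult: "sqi f \<Longrightarrow> (norm (to_L2 f))\<^sup>2 = (LINT x|lborel. f x * f x)"
  by (simp add: norm_to_L2) (simp add: power2_eq_square)

lemma norm_pd_pd_le:
  assumes f: "test_function f"
  shows "(norm (to_L2 (pd j (pd i f))))\<^sup>2 \<le> (norm (to_L2 (classical_laplacian f)))\<^sup>2"
proof -
  note t = test_function_sqi test_function_pd test_function_laplacian f
  have "(norm (to_L2 (pd j (pd i f))))\<^sup>2 \<le> (\<Sum>j\<in>UNIV. (norm (to_L2 (pd j (pd i f))))\<^sup>2)"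
    by (rule member_le_sum) auto
  also have "\<dots> \<le> (\<Sum>i\<in>UNIV. \<Sum>j\<in>UNIV. (norm (to_L2 (pd j (pd i f))))\<^sup>2)"
    by (rule member_le_sum[where f="\<lambda>i. \<Sum>j\<in>UNIV. (norm (to_L2 (pd j (pd i f))))\<^sup>2"]) (auto intro: sum_nonneg)
  also have "\<dots> = (norm (to_L2 (classical_laplacian f)))\<^sup>2"
    using test_hessian_energy[OF f] by (simp add: norm_to_L2_mult t)
  finally show ?thesis .
qed

text \<open>The cross term -2 <f, \<Delta>f> is twice the gradient energy, so no cancellation
  occurs: the norm of (1 - \<Delta>) f dominates f, its gradient, its Laplacian and, by the
  preceding lemma, its second derivatives.\<close>

lemma norm_helmholtz:
  assumes f: "test_function f"
  shows "(norm (to_L2 (\<lambda>x. f x - classical_laplacian f x)))\<^sup>2 =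
    (norm (to_L2 f))\<^sup>2 + 2 * (\<Sum>i\<in>UNIV. (norm (to_L2 (pd i f)))\<^sup>2) + (norm (to_L2 (classical_laplacian f)))\<^sup>2"
proof -
  note t = test_function_sqi test_function_pd test_function_laplacian f
  have g: "(\<Sum>i\<in>UNIV. (norm (to_L2 (pd i f)))\<^sup>2) = - inner (to_L2 f) (to_L2 (classical_laplacian f))"
    using test_gradient_energy[OF f] by (simp add: norm_to_L2_mult t inner_to_L2 mult.commute[of "f _"])
  have "to_L2 (\<lambda>x. f x - classical_laplacian f x) = to_L2 f - to_L2 (classical_laplacian f)"
    by (simp add: to_L2_diff t)
  moreover have "(norm (A - B))\<^sup>2 = (norm A)\<^sup>2 - 2 * inner A B + (norm B)\<^sup>2" for A B :: L2
    by (simp add: power2_norm_eq_inner inner_diff_left inner_diff_right inner_commute)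
  ultimately show ?thesis
    unfolding g by simp
qed

definition testc :: "(real^2 \<Rightarrow> real) \<Rightarrow> (real^2 \<Rightarrow> real) \<Rightarrow> bool" where
  "testc a b \<longleftrightarrow> test_function a \<and> test_function b"

text \<open>The image of the complex test function a + \<i> b under 1 - \<Delta>.\<close>

definition helm :: "(real^2 \<Rightarrow> real) \<Rightarrow> (real^2 \<Rightarrow> real) \<Rightarrow> L2" where
  "helm a b = to_L2c (\<lambda>x. a x - classical_laplacian a x) (\<lambda>x. b x - classical_laplacian b x)"

lemma norm_le_helm:
  assumes "testc a b"
  shows "norm (to_L2c a b) \<le> norm (helm a b)"
    "norm (to_L2c (pd i a) (pd i b)) \<le> norm (helm a b)"
    "norm (to_L2c (classical_laplacian a) (classical_laplacian b)) \<le> norm (helm a b)"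
    "norm (to_L2c (pd j (pd i a)) (pd j (pd i b))) \<le> norm (helm a b)"
proof -
  have t: "test_function a" "test_function b" using assms by (auto simp: testc_def)
  note s = test_function_sqi test_function_pd test_function_laplacian test_function_diff t
  have H: "(norm (helm a b))\<^sup>2 = (norm (to_L2 (\<lambda>x. a x - classical_laplacian a x)))\<^sup>2
      + (norm (to_L2 (\<lambda>x. b x - classical_laplacian b x)))\<^sup>2"
    unfolding helm_def by (rule norm_to_L2c; intro s)
  have nn: "0 \<le> (\<Sum>i\<in>UNIV. (norm (to_L2 (pd i f)))\<^sup>2)" for f by (intro sum_nonneg) auto
  have p: "(norm (to_L2 (pd i f)))\<^sup>2 \<le> (\<Sum>i\<in>UNIV. (norm (to_L2 (pd i f)))\<^sup>2)" for f
    by (rule member_le_sum) auto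
  have le: "(norm (to_L2c a' b'))\<^sup>2 \<le> (norm (helm a b))\<^sup>2 \<Longrightarrow> norm (to_L2c a' b') \<le> norm (helm a b)" for a' b'
    by (rule power2_le_imp_le) auto
  show "norm (to_L2c a b) \<le> norm (helm a b)"
  proof (rule le)
    have "(norm (to_L2c a b))\<^sup>2 = (norm (to_L2 a))\<^sup>2 + (norm (to_L2 b))\<^sup>2"
      by (rule norm_to_L2c; intro s)
    also have "\<dots> \<le> (norm (helm a b))\<^sup>2"
      unfolding H norm_helmholtz[OF t(1)] norm_helmholtz[OF t(2)] using nn[of a] nn[of b]
        zero_le_power2[of "norm (to_L2 (classical_laplacian a))"] zero_le_power2[of "norm (to_L2 (classical_laplacian b))"]
      by linarith
    finally show "(norm (to_L2c a b))\<^sup>2 \<le> (norm (helm a b))\<^sup>2" .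
  qed
  show "norm (to_L2c (pd i a) (pd i b)) \<le> norm (helm a b)"
  proof (rule le)
    have "(norm (to_L2c (pd i a) (pd i b)))\<^sup>2 = (norm (to_L2 (pd i a)))\<^sup>2 + (norm (to_L2 (pd i b)))\<^sup>2"
      by (rule norm_to_L2c; intro s)
    also have "\<dots> \<le> (norm (helm a b))\<^sup>2"
      unfolding H norm_helmholtz[OF t(1)] norm_helmholtz[OF t(2)] using p[of a] p[of b] nn[of a] nn[of b]
        zero_le_power2[of "norm (to_L2 a)"] zero_le_power2[of "norm (to_L2 b)"]
        zero_le_power2[of "norm (to_L2 (classical_laplacian a))"] zero_le_power2[of "norm (to_L2 (classical_laplacian b))"]
      by linarith
    finally show "(norm (to_L2c (pd i a) (pd i b)))\<^sup>2 \<le> (norm (helm a b))\<^sup>2" .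
  qed
  have l: "(norm (to_L2 (classical_laplacian a)))\<^sup>2 + (norm (to_L2 (classical_laplacian b)))\<^sup>2 \<le> (norm (helm a b))\<^sup>2"
    unfolding H norm_helmholtz[OF t(1)] norm_helmholtz[OF t(2)] using nn[of a] nn[of b]
        zero_le_power2[of "norm (to_L2 a)"] zero_le_power2[of "norm (to_L2 b)"] by linarith
  show "norm (to_L2c (classical_laplacian a) (classical_laplacian b)) \<le> norm (helm a b)"
  proof (rule le)
    have "(norm (to_L2c (classical_laplacian a) (classical_laplacian b)))\<^sup>2 =
        (norm (to_L2 (classical_laplacian a)))\<^sup>2 + (norm (to_L2 (classical_laplacian b)))\<^sup>2"
      by (rule norm_to_L2c; intro s)
    with l show "(norm (to_L2c (classical_laplacian a) (classical_laplacian b)))\<^sup>2 \<le> (norm (helm a b))\<^sup>2" by simp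
  qed
  show "norm (to_L2c (pd j (pd i a)) (pd j (pd i b))) \<le> norm (helm a b)"
  proof (rule le)
    have "(norm (to_L2c (pd j (pd i a)) (pd j (pd i b))))\<^sup>2 =
        (norm (to_L2 (pd j (pd i a))))\<^sup>2 + (norm (to_L2 (pd j (pd i b))))\<^sup>2"
      by (rule norm_to_L2c; intro s)
    with l norm_pd_pd_le[OF t(1), of j i] norm_pd_pd_le[OF t(2), of j i]
    show "(norm (to_L2c (pd j (pd i a)) (pd j (pd i b))))\<^sup>2 \<le> (norm (helm a b))\<^sup>2" by linarith
  qed
qed

lemma pd_diff_test:
  "test_function f \<Longrightarrow> test_function g \<Longrightarrow> pd i (\<lambda>x. f x - g x) = (\<lambda>x. pd i f x - pd i g x)"
  using pd_add[of f "\<lambda>x. (-1) * g x" i] pd_cmult[of g i "-1"]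
  by (simp add: test_function_differentiable)

lemma laplacian_diff_test:
  "test_function f \<Longrightarrow> test_function g \<Longrightarrow>
    classical_laplacian (\<lambda>x. f x - g x) = (\<lambda>x. classical_laplacian f x - classical_laplacian g x)"
  unfolding laplacian_UNIV_2[abs_def] by (simp add: pd_diff_test test_function_pd algebra_simps)

text \<open>A vector orthogonal to the range is a square-integrable weak solution of v = \<Delta>v,
  hence zero.\<close>

lemma closure_helm: "closure {helm a b |a b. testc a b} = UNIV"
proof (rule dense_if_orthogonal_trivial)
  note s = test_function_sqi test_function_minus_laplacian
  have 0: "test_function (\<lambda>x. 0)"
    by (simp add: test_function_iff smooth_def Ck_const)
  show "subspace {helm a b |a b. testc a b}"
    unfolding subspace_def
  proof (intro conjI ballI allI)
    have "helm (\<lambda>x. 0) (\<lambda>x. 0) = 0"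
      unfolding helm_def to_L2c_def laplacian_UNIV_2 by (simp add: pd_const to_L2_def zero_L2_def[symmetric])
    then show "0 \<in> {helm a b |a b. testc a b}"
      using 0 by (auto simp: testc_def intro!: exI[of _ "\<lambda>x. 0"] exI[of _ "\<lambda>x. 0::real"])
  next
    fix x y assume "x \<in> {helm a b |a b. testc a b}" "y \<in> {helm a b |a b. testc a b}"
    then obtain a b c d where xy: "x = helm a b" "y = helm c d" "testc a b" "testc c d" by blast
    then have t: "test_function a" "test_function b" "test_function c" "test_function d"
      by (auto simp: testc_def)
    have "x + y = helm (\<lambda>x. a x + c x) (\<lambda>x. b x + d x)"
      unfolding xy helm_def laplacian_add[OF test_function_Ck[OF t(1)] test_function_Ck[OF t(3)]]
        laplacian_add[OF test_function_Ck[OF t(2)] test_function_Ck[OF t(4)]]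
      by (subst to_L2c_add) (simp_all add: s t algebra_simps)
    then show "x + y \<in> {helm a b |a b. testc a b}"
      using t test_function_add by (auto simp: testc_def)
  next
    fix r :: real and x assume "x \<in> {helm a b |a b. testc a b}"
    then obtain a b where x: "x = helm a b" "testc a b" by blast
    then have t: "test_function a" "test_function b" by (auto simp: testc_def)
    have "r *\<^sub>R x = helm (\<lambda>x. r * a x) (\<lambda>x. r * b x)"
    proof -
      have "r *\<^sub>R cscale \<i> g = cscale \<i> (r *\<^sub>R g)" for g :: L2
        by (simp add: scaleR_eq_cscale mult.commute)
      then show ?thesis
        unfolding x helm_def laplacian_cmult[OF test_function_Ck[OF t(1)]]
          laplacian_cmult[OF test_function_Ck[OF t(2)]] to_L2c_def scaleR_right_distrib
        by (simp only: to_L2_scaleR[OF s(1)[OF s(2)[OF t(1)]]] to_L2_scaleR[OF s(1)[OF s(2)[OF t(2)]]] right_diff_distrib)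
    qed
    then show "r *\<^sub>R x \<in> {helm a b |a b. testc a b}"
      using t test_function_cmult by (auto simp: testc_def)
  qed
next
  fix v assume v: "\<And>s. s \<in> {helm a b |a b. testc a b} \<Longrightarrow> inner s v = 0"
  have 0: "test_function (\<lambda>x. 0)" "classical_laplacian (\<lambda>x. 0) = (\<lambda>x. 0)" "to_L2 (\<lambda>x. 0) = 0"
    by (simp_all add: test_function_iff smooth_def Ck_const laplacian_UNIV_2[abs_def] pd_const to_L2_def zero_L2_def[symmetric])
  show "v = 0"
  proof (rule L2_eq_0_if_helmholtz)
    fix \<psi> assume \<psi>: "test_function \<psi>"
    let ?g = "to_L2 (\<lambda>x. \<psi> x - classical_laplacian \<psi> x)"
    \<comment> \<open>A real and a purely imaginary test function yield the two real orthogonality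
      relations that make up the complex one.\<close>
    have "inner (helm \<psi> (\<lambda>x. 0)) v = 0" "inner (helm (\<lambda>x. 0) \<psi>) v = 0"
      by (rule v, rule CollectI, intro exI conjI, rule refl, simp add: testc_def \<psi> 0(1))+
    then have "inner ?g v = 0" "inner (cscale \<i> ?g) v = 0"
      by (simp_all add: helm_def to_L2c_def 0)
    then have "inner v ?g = 0" "inner v (cscale \<i> ?g) = 0"
      by (simp_all add: inner_commute)
    then show "cinner v ?g = 0" by (simp add: cinner_eq_Complex complex_eq_iff)
  qed
qed

section \<open>Regularity\<close>

lemma helm_eq:
  assumes "testc a b"
  shows "helm a b = to_L2c a b - to_L2c (classical_laplacian a) (classical_laplacian b)"
  unfolding helm_def
  by (subst to_L2c_diff) (use assms in \<open>simp_all add: testc_def test_function_sqi test_function_laplacian\<close>)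

lemma testc_diff: "testc a b \<Longrightarrow> testc c d \<Longrightarrow> testc (\<lambda>x. a x - c x) (\<lambda>x. b x - d x)"
  by (simp add: testc_def test_function_diff)

lemma helm_diff:
  assumes "testc a b" "testc c d"
  shows "helm a b - helm c d = helm (\<lambda>x. a x - c x) (\<lambda>x. b x - d x)"
proof -
  have t: "test_function a" "test_function b" "test_function c" "test_function d"
    using assms by (auto simp: testc_def)
  show ?thesis
    unfolding helm_def laplacian_diff_test[OF t(1,3)] laplacian_diff_test[OF t(2,4)]
    by (subst to_L2c_diff) (simp_all add: t test_function_sqi test_function_minus_laplacian algebra_simps)
qed

lemma Cauchy_dominated:
  fixes X :: "nat \<Rightarrow> 'a::real_normed_vector" and Y :: "nat \<Rightarrow> 'b::{real_normed_vector, complete_space}"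
  assumes "Cauchy X" "\<And>m n. norm (Y m - Y n) \<le> norm (X m - X n)"
  shows "\<exists>L. Y \<longlonglongrightarrow> L"
proof -
  have "Cauchy Y"
    using assms unfolding Cauchy_iff by (meson le_less_trans)
  then show ?thesis by (simp add: Cauchy_convergent_iff convergent_def)
qed

text \<open>Test functions are chosen so that their images under 1 - \<Delta> converge to u - w. The
  a priori estimates make all their derivatives up to order two Cauchy, and uniqueness for 1 -
  \<Delta> identifies the limit with u.\<close>

lemma H2_approx:
  assumes uw: "weak_laplacian u w"
  obtains a b p q where "\<And>n. testc (a n) (b n)"
    "(\<lambda>n. to_L2c (a n) (b n)) \<longlonglongrightarrow> u"
    "(\<lambda>n. to_L2c (classical_laplacian (a n)) (classical_laplacian (b n))) \<longlonglongrightarrow> w"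
    "\<And>i. (\<lambda>n. to_L2c (pd i (a n)) (pd i (b n))) \<longlonglongrightarrow> p i"
    "\<And>i j. (\<lambda>n. to_L2c (pd j (pd i (a n))) (pd j (pd i (b n)))) \<longlonglongrightarrow> q i j"
proof -
  define f where "f = u - w"
  have "f \<in> closure {helm a b |a b. testc a b}" by (simp add: closure_helm)
  then obtain F where F: "\<And>n. F n \<in> {helm a b |a b. testc a b}" "F \<longlonglongrightarrow> f"
    unfolding closure_sequential by auto
  have "\<exists>a b. testc a b \<and> F n = helm a b" for n using F(1)[of n] by auto
  then obtain a b where ab: "\<And>n. testc (a n) (b n)" "\<And>n. F n = helm (a n) (b n)" by metis
  have ta: "test_function (a n)" and tb: "test_function (b n)" for n
    using ab(1)[of n] by (auto simp: testc_def)
  note s = test_function_sqi test_function_pd test_function_laplacian ta tb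
  have C: "Cauchy F" using F(2) by (rule LIMSEQ_imp_Cauchy)
  have d: "testc (\<lambda>x. a m x - a n x) (\<lambda>x. b m x - b n x)" "F m - F n = helm (\<lambda>x. a m x - a n x) (\<lambda>x. b m x - b n x)" for m n
    using testc_diff[OF ab(1) ab(1)] helm_diff[OF ab(1) ab(1)] by (auto simp: ab(2))
  have "\<exists>L. (\<lambda>n. to_L2c (a n) (b n)) \<longlonglongrightarrow> L"
  proof (rule Cauchy_dominated[OF C])
    show "norm (to_L2c (a m) (b m) - to_L2c (a n) (b n)) \<le> norm (F m - F n)" for m n
      by (subst to_L2c_diff) (use norm_le_helm(1)[OF d(1)] in \<open>simp_all add: s d(2)\<close>)
  qed
  then obtain U where U: "(\<lambda>n. to_L2c (a n) (b n)) \<longlonglongrightarrow> U" by blast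
  have "\<exists>L. (\<lambda>n. to_L2c (pd i (a n)) (pd i (b n))) \<longlonglongrightarrow> L" for i
  proof (rule Cauchy_dominated[OF C])
    show "norm (to_L2c (pd i (a m)) (pd i (b m)) - to_L2c (pd i (a n)) (pd i (b n))) \<le> norm (F m - F n)" for m n
      by (subst to_L2c_diff) (use norm_le_helm(2)[OF d(1), of i] in \<open>simp_all add: s d(2) pd_diff_test\<close>)
  qed
  then obtain p where p: "\<And>i. (\<lambda>n. to_L2c (pd i (a n)) (pd i (b n))) \<longlonglongrightarrow> p i" by metis
  have "\<exists>L. (\<lambda>n. to_L2c (pd j (pd i (a n))) (pd j (pd i (b n)))) \<longlonglongrightarrow> L" for i j
  proof (rule Cauchy_dominated[OF C])
    show "norm (to_L2c (pd j (pd i (a m))) (pd j (pd i (b m))) - to_L2c (pd j (pd i (a n))) (pd j (pd i (b n)))) \<le> norm (F m - F n)" for m n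
      by (subst to_L2c_diff) (use norm_le_helm(4)[OF d(1), of j i] in \<open>simp_all add: s d(2) pd_diff_test\<close>)
  qed
  then have q: "(\<lambda>n. to_L2c (pd j (pd i (a n))) (pd j (pd i (b n))))
      \<longlonglongrightarrow> lim (\<lambda>n. to_L2c (pd j (pd i (a n))) (pd j (pd i (b n))))" for i j
    by (simp only: convergent_def[symmetric] convergent_LIMSEQ_iff)
  have lap: "to_L2c (classical_laplacian (a n)) (classical_laplacian (b n)) = to_L2c (a n) (b n) - F n" for n
    by (simp add: ab(2) helm_eq[OF ab(1)])
  have W: "(\<lambda>n. to_L2c (classical_laplacian (a n)) (classical_laplacian (b n))) \<longlonglongrightarrow> U - f"
    unfolding lap by (intro tendsto_diff U F(2))
  have "weak_laplacian U (U - f)"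
    by (rule weak_laplacian_limit[OF weak_laplacian_testc[OF ta tb] U W])
  \<comment> \<open>Both u and U are weak solutions of the Helmholtz equation with right-hand side
    f.\<close>
  have "u - U = 0"
  proof (rule L2_eq_0_if_helmholtz)
    fix \<psi> assume \<psi>: "test_function \<psi>"
    let ?l = "to_L2 (classical_laplacian \<psi>)"
    have e: "to_L2 (\<lambda>x. \<psi> x - classical_laplacian \<psi> x) = to_L2 \<psi> - ?l"
      by (simp add: to_L2_diff test_function_sqi test_function_laplacian \<psi>)
    have "cinner u ?l = cinner w (to_L2 \<psi>)" "cinner U ?l = cinner (U - f) (to_L2 \<psi>)"
      using weak_laplacianD[OF uw \<psi>] weak_laplacianD[OF \<open>weak_laplacian U (U - f)\<close> \<psi>] by auto
    then show "cinner (u - U) (to_L2 (\<lambda>x. \<psi> x - classical_laplacian \<psi> x)) = 0"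
      unfolding e f_def cinner_diff_left cinner_diff_right by simp
  qed
  then have e: "U = u" "U - f = w" by (simp_all add: f_def)
  show ?thesis by (rule that[OF ab(1) U[unfolded e(1)] W[unfolded e(2)] p q])
qed

lemma weak_laplacian_unique:
  assumes "weak_laplacian u w" "weak_laplacian u w'"
  shows "w = w'"
proof -
  have "w - w' = 0"
    by (rule L2_eq_0_if_orthogonal_to_test_functions)
      (use assms in \<open>simp add: weak_laplacian_def cinner_diff_left\<close>)
  then show ?thesis by simp
qed

lemma sobolev_2_iff: "u \<in> sobolev 2 \<longleftrightarrow>
    (\<exists>p q. (\<forall>i. has_weak_pd i u (p i)) \<and> (\<forall>i j. has_weak_pd j (p i) (q i j)))"
  by (simp add: numeral_2_eq_2) metis

text \<open>Weak derivatives are closed under limits in norm, and the approximating sequence has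
  limits for every first and second derivative.\<close>

lemma weak_laplacian_sobolev_2:
  assumes "weak_laplacian u w" shows "u \<in> sobolev 2"
proof -
  obtain a b p q where a: "\<And>n. testc (a n) (b n)"
    "(\<lambda>n. to_L2c (a n) (b n)) \<longlonglongrightarrow> u"
    "\<And>i. (\<lambda>n. to_L2c (pd i (a n)) (pd i (b n))) \<longlonglongrightarrow> p i"
    "\<And>i j. (\<lambda>n. to_L2c (pd j (pd i (a n))) (pd j (pd i (b n)))) \<longlonglongrightarrow> q i j"
    by (rule H2_approx[OF assms]) blast
  have t: "test_function (a n)" "test_function (b n)" for n using a(1)[of n] by (auto simp: testc_def)
  have "has_weak_pd i u (p i)" for i
    by (rule has_weak_pd_limit[OF has_weak_pd_testc[OF t] a(2,3)])
  moreover have "has_weak_pd j (p i) (q i j)" for i j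
    by (rule has_weak_pd_limit[OF has_weak_pd_testc[OF test_function_pd[OF t(1)] test_function_pd[OF t(2)]] a(3,4)])
  ultimately show ?thesis unfolding sobolev_2_iff by blast
qed

lemma sobolev_2_weak_laplacian:
  assumes "u \<in> sobolev 2" shows "weak_laplacian u (laplacian u)"
  unfolding weak_laplacian_def
proof (intro allI impI)
  fix \<psi> assume \<psi>: "test_function \<psi>"
  note s = test_function_sqi test_function_pd \<psi>
  obtain p q where pq: "\<And>i. has_weak_pd i u (p i)" "\<And>i j. has_weak_pd j (p i) (q i j)"
    using assms unfolding sobolev_2_iff by blast
  have e: "cinner u (to_L2 (pd i (pd i \<psi>))) = cinner (q i i) (to_L2 \<psi>)" for i
    using pq(1)[of i] pq(2)[of i i] \<psi> by (simp add: has_weak_pd_iff test_function_pd)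
  have "to_L2 (classical_laplacian \<psi>) = to_L2 (pd 1 (pd 1 \<psi>)) + to_L2 (pd 2 (pd 2 \<psi>))"
    by (subst to_L2_add) (simp_all add: s laplacian_UNIV_2[abs_def])
  then have "cinner u (to_L2 (classical_laplacian \<psi>)) = (\<Sum>i\<in>UNIV. cinner (q i i) (to_L2 \<psi>))"
    by (simp add: cinner_add_right e sum_2)
  also have "\<dots> = cinner (laplacian u) (to_L2 \<psi>)"
    by (simp add: laplacian_def weak_pd_eq[OF pq(1)] weak_pd_eq[OF pq(2)] cinner_sum_left)
  finally show "cinner u (to_L2 (classical_laplacian \<psi>)) = cinner (laplacian u) (to_L2 \<psi>)" .
qed

lemma laplacian_eq: "weak_laplacian u w \<Longrightarrow> laplacian u = w"
  using weak_laplacian_unique sobolev_2_weak_laplacian weak_laplacian_sobolev_2 by blast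

lemma weak_laplacian_sobolev_1:
  assumes "weak_laplacian u w" shows "u \<in> sobolev 1"
  using weak_laplacian_sobolev_2[OF assms] unfolding sobolev_2_iff by auto

text \<open>The definition of the weak Laplacian of v gives the identity for test functions in place
  of u; approximating u together with its Laplacian extends it.\<close>

lemma weak_laplacian_symmetric:
  assumes "weak_laplacian u w" "weak_laplacian v z"
  shows "cinner w v = cinner u z"
proof -
  obtain a b where a: "\<And>n. testc (a n) (b n)"
    "(\<lambda>n. to_L2c (a n) (b n)) \<longlonglongrightarrow> u"
    "(\<lambda>n. to_L2c (classical_laplacian (a n)) (classical_laplacian (b n))) \<longlonglongrightarrow> w"
    by (rule H2_approx[OF assms(1)]) blast
  have t: "test_function (a n)" "test_function (b n)" for n using a(1)[of n] by (auto simp: testc_def)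
  have c: "cinner (to_L2 (classical_laplacian \<psi>)) v = cinner (to_L2 \<psi>) z" if "test_function \<psi>" for \<psi>
    using weak_laplacianD[OF assms(2) that] by (metis cinner_commute)
  have "cinner (to_L2c (classical_laplacian (a n)) (classical_laplacian (b n))) v = cinner (to_L2c (a n) (b n)) z" for n
    unfolding to_L2c_def cinner_add_left cinner_cscale_left by (simp add: c t)
  moreover have "(\<lambda>n. cinner (to_L2c (classical_laplacian (a n)) (classical_laplacian (b n))) v) \<longlonglongrightarrow> cinner w v"
    by (intro tendsto_cinner a(3) tendsto_const)
  moreover have "(\<lambda>n. cinner (to_L2c (a n) (b n)) z) \<longlonglongrightarrow> cinner u z"
    by (intro tendsto_cinner a(2) tendsto_const)
  ultimately show ?thesis by (simp add: LIMSEQ_unique)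
qed

text \<open>Integration by parts holds for the approximating test functions and passes to the limit,
  since their gradients converge to the weak gradient of u.\<close>

lemma grad_norm_sq:
  assumes "weak_laplacian u w"
  shows "(grad_norm u)\<^sup>2 = - inner w u"
proof -
  obtain a b p where a: "\<And>n. testc (a n) (b n)"
    "(\<lambda>n. to_L2c (a n) (b n)) \<longlonglongrightarrow> u"
    "(\<lambda>n. to_L2c (classical_laplacian (a n)) (classical_laplacian (b n))) \<longlonglongrightarrow> w"
    "\<And>i. (\<lambda>n. to_L2c (pd i (a n)) (pd i (b n))) \<longlonglongrightarrow> p i"
    by (rule H2_approx[OF assms]) blast
  have t: "test_function (a n)" "test_function (b n)" for n using a(1)[of n] by (auto simp: testc_def)
  note s = test_function_sqi test_function_pd test_function_laplacian t
  have "has_weak_pd i u (p i)" for i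
    by (rule has_weak_pd_limit[OF has_weak_pd_testc[OF t] a(2,4)])
  then have "weak_pd i u = p i" for i by (rule weak_pd_eq)
  then have "(grad_norm u)\<^sup>2 = (\<Sum>i\<in>UNIV. (norm (p i))\<^sup>2)"
    by (simp add: grad_norm_def sum_nonneg)
  moreover have "(\<lambda>n. \<Sum>i\<in>UNIV. (norm (to_L2c (pd i (a n)) (pd i (b n))))\<^sup>2) \<longlonglongrightarrow> (\<Sum>i\<in>UNIV. (norm (p i))\<^sup>2)"
    by (intro tendsto_sum tendsto_power tendsto_norm a(4))
  moreover have "(\<Sum>i\<in>UNIV. (norm (to_L2c (pd i (a n)) (pd i (b n))))\<^sup>2) =
      - inner (to_L2c (classical_laplacian (a n)) (classical_laplacian (b n))) (to_L2c (a n) (b n))" for n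
    using test_gradient_energy[OF t(1)[of n]] test_gradient_energy[OF t(2)[of n]]
    by (simp add: norm_to_L2c norm_to_L2_mult inner_to_L2c s sum.distrib)
  moreover have "(\<lambda>n. - inner (to_L2c (classical_laplacian (a n)) (classical_laplacian (b n))) (to_L2c (a n) (b n)))
      \<longlonglongrightarrow> - inner w u"
    by (intro tendsto_minus tendsto_inner a(2,3))
  ultimately show ?thesis by (simp add: LIMSEQ_unique)
qed

section \<open>Schroedinger operators with bounded potential\<close>

definition bpot :: "(real^2 \<Rightarrow> real) \<Rightarrow> bool" where
  "bpot V \<longleftrightarrow> V \<in> borel_measurable borel \<and> bounded (range V)"

lemma bpot_bound:
  assumes "bpot V" shows "\<exists>M\<ge>0. \<forall>x. \<bar>V x\<bar> \<le> M"
proof -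
  obtain M where "\<forall>y\<in>range V. norm y \<le> M"
    using assms unfolding bpot_def bounded_iff by blast
  then have M: "\<And>x. \<bar>V x\<bar> \<le> M" by simp
  then have "M \<ge> 0" using abs_ge_zero order_trans by blast
  then show ?thesis using M by blast
qed

lemma sq_integrable_mult_bpot:
  assumes V: "bpot V" and f: "sq_integrable f"
  shows "sq_integrable (\<lambda>x. complex_of_real (V x) * f x)"
proof -
  note [measurable] = sq_integrable_measurable[OF f]
  have [measurable]: "V \<in> borel_measurable borel" using V by (simp add: bpot_def)
  obtain M where M: "M \<ge> 0" "\<And>x. \<bar>V x\<bar> \<le> M" using bpot_bound[OF V] by blast 
  have "integrable lborel (\<lambda>x. (cmod (V x * f x))\<^sup>2)"
  proof (rule Bochner_Integration.integrable_bound)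
    show "integrable lborel (\<lambda>x. M\<^sup>2 * (cmod (f x))\<^sup>2)"
      using f by (simp add: sq_integrable_def)
    show "AE x in lborel. norm ((cmod (V x * f x))\<^sup>2) \<le> norm (M\<^sup>2 * (cmod (f x))\<^sup>2)"
    proof (rule AE_I2)
      fix x
      have "(V x)\<^sup>2 \<le> M\<^sup>2" using M(2)[of x] M(1) by (simp add: abs_le_square_iff[symmetric])
      then show "norm ((cmod (V x * f x))\<^sup>2) \<le> norm (M\<^sup>2 * (cmod (f x))\<^sup>2)"
        by (simp add: norm_mult power_mult_distrib mult_right_mono)
    qed
  qed measurable
  then show ?thesis by (simp add: sq_integrable_def)
qed

lemma mult_op_abs:
  assumes V: "bpot V" and f: "sq_integrable f"
  shows "mult_op V (abs_L2 f) = abs_L2 (\<lambda>x. complex_of_real (V x) * f x)"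
  unfolding mult_op_def
  by (rule abs_L2_eqI[OF sq_integrable_mult_bpot[OF V sq_integrable_rep] sq_integrable_mult_bpot[OF V f]])
    (use rep_abs_L2[OF f] in eventually_elim, simp)

lemma mult_op_to_L2:
  assumes V: "bpot V" and f: "sqi f"
  shows "mult_op V (to_L2 f) = to_L2 (\<lambda>x. V x * f x)"
  unfolding to_L2_def using f by (subst mult_op_abs[OF V]) (simp_all add: sq_integrable_of_real)

lemma sqi_mult_bpot:
  assumes V: "bpot V" and f: "sqi f" shows "sqi (\<lambda>x. V x * f x)"
proof -
  obtain M where "\<And>x. \<bar>V x\<bar> \<le> M" using bpot_bound[OF V] by blast
  then show ?thesis using sqi_mult_bounded[OF f, of V M] V by (simp add: bpot_def)
qed

lemma mult_op_add:
  assumes V: "bpot V" shows "mult_op V (u + v) = mult_op V u + mult_op V v"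
proof -
  note m = sq_integrable_mult_bpot[OF V]
  have "u + v = abs_L2 (\<lambda>x. rep_L2 u x + rep_L2 v x)"
    using plus_abs[OF sq_integrable_rep sq_integrable_rep, of u v] by (simp add: abs_L2_rep)
  then have "mult_op V (u + v) = abs_L2 (\<lambda>x. complex_of_real (V x) * rep_L2 u x + complex_of_real (V x) * rep_L2 v x)"
    by (simp add: mult_op_abs[OF V] sq_integrable_add sq_integrable_rep distrib_left)
  also have "\<dots> = mult_op V u + mult_op V v"
    unfolding mult_op_def by (rule plus_abs[symmetric]; intro m sq_integrable_rep)
  finally show ?thesis .
qed

lemma mult_op_cscale:
  assumes V: "bpot V" shows "mult_op V (cscale c u) = cscale c (mult_op V u)"
proof -
  note m = sq_integrable_mult_bpot[OF V sq_integrable_rep]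
  have "cscale c u = abs_L2 (\<lambda>x. c * rep_L2 u x)"
    using cscale_abs[OF sq_integrable_rep, of c u] by (simp add: abs_L2_rep)
  then have "mult_op V (cscale c u) = abs_L2 (\<lambda>x. c * (complex_of_real (V x) * rep_L2 u x))"
    by (simp add: mult_op_abs[OF V] sq_integrable_scale sq_integrable_rep mult.left_commute)
  also have "\<dots> = cscale c (mult_op V u)"
    unfolding mult_op_def by (rule cscale_abs[symmetric, OF m])
  finally show ?thesis .
qed

lemma cinner_mult_op:
  assumes V: "bpot V" shows "cinner (mult_op V u) v = cinner u (mult_op V v)"
proof -
  note m = sq_integrable_mult_bpot[OF V sq_integrable_rep]
  have "cinner (mult_op V u) v = cinner (mult_op V u) (abs_L2 (rep_L2 v))"
    by (simp add: abs_L2_rep)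
  also have "\<dots> = (LINT x|lborel. complex_of_real (V x) * rep_L2 u x * cnj (rep_L2 v x))"
    unfolding mult_op_def by (rule cinner_abs[OF m sq_integrable_rep])
  also have "\<dots> = (LINT x|lborel. rep_L2 u x * cnj (complex_of_real (V x) * rep_L2 v x))"
    by (simp add: mult_ac)
  also have "\<dots> = cinner (abs_L2 (rep_L2 u)) (mult_op V v)"
    unfolding mult_op_def by (rule cinner_abs[symmetric, OF sq_integrable_rep m])
  finally show ?thesis by (simp add: abs_L2_rep)
qed

lemma norm_mult_op_le:
  assumes V: "bpot V" and M: "\<And>x. \<bar>V x\<bar> \<le> M"
  shows "norm (mult_op V u) \<le> M * norm u"
proof -
  have M0: "M \<ge> 0" using M[of 0] by linarith
  note m = sq_integrable_mult_bpot[OF V sq_integrable_rep[of u]]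
  have "(norm (mult_op V u))\<^sup>2 = (LINT x|lborel. (cmod (rep_L2 (mult_op V u) x))\<^sup>2)"
    by (rule norm_rep)
  also have "\<dots> \<le> (LINT x|lborel. M\<^sup>2 * (cmod (rep_L2 u x))\<^sup>2)"
  proof (rule integral_mono_AE)
    show "AE x in lborel. (cmod (rep_L2 (mult_op V u) x))\<^sup>2 \<le> M\<^sup>2 * (cmod (rep_L2 u x))\<^sup>2"
      using rep_abs_L2[OF m]
    proof eventually_elim
      case (elim x)
      have "(V x)\<^sup>2 \<le> M\<^sup>2" using M[of x] M0 by (simp add: abs_le_square_iff[symmetric])
      then show ?case
        unfolding mult_op_def elim by (simp add: norm_mult power_mult_distrib mult_right_mono)
    qed
  qed (use sq_integrable_rep in \<open>auto simp: sq_integrable_def\<close>)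
  also have "\<dots> = (M * norm u)\<^sup>2"
    by (simp add: power_mult_distrib norm_rep)
  finally show ?thesis
    by (rule power2_le_imp_le) (use M0 in simp)
qed

lemma mult_op_diff:
  assumes V: "bpot V" shows "mult_op V (u - v) = mult_op V u - mult_op V v"
  unfolding minus_eq_cscale[of u v] minus_eq_cscale[of "mult_op V u"] by (simp only: mult_op_add[OF V] mult_op_cscale[OF V])

lemma tendsto_mult_op:
  assumes V: "bpot V" and u: "u \<longlonglongrightarrow> a"
  shows "(\<lambda>n. mult_op V (u n)) \<longlonglongrightarrow> mult_op V a"
proof -
  obtain M where M: "M \<ge> 0" "\<And>x. \<bar>V x\<bar> \<le> M" using bpot_bound[OF V] by blast
  have "(\<lambda>n. norm (u n - a)) \<longlonglongrightarrow> 0"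
    using u by (simp add: LIM_zero tendsto_norm_zero)
  then have "(\<lambda>n. M * norm (u n - a)) \<longlonglongrightarrow> M * 0"
    by (rule tendsto_mult_left)
  then have z: "(\<lambda>n. M * norm (u n - a)) \<longlonglongrightarrow> 0" by simp
  have "(\<lambda>n. mult_op V (u n) - mult_op V a) \<longlonglongrightarrow> 0"
    by (rule Lim_null_comparison[OF always_eventually z])
      (simp add: mult_op_diff[OF V, symmetric] norm_mult_op_le[OF V] M)
  then show ?thesis by (simp add: LIM_zero_iff)
qed

lemma schrodinger_eq: "weak_laplacian u w \<Longrightarrow> schrodinger \<omega> V u = - w + \<omega> *\<^sub>R u - mult_op V u"
  by (simp add: schrodinger_def laplacian_eq)

lemma sobolev_2_subspace: "cL2.subspace (sobolev 2)"
proof (rule cL2.subspaceI)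
  have "weak_laplacian 0 0" by (simp add: weak_laplacian_def)
  then show "0 \<in> sobolev 2" by (rule weak_laplacian_sobolev_2)
  show "u + v \<in> sobolev 2" if "u \<in> sobolev 2" "v \<in> sobolev 2" for u v
    using weak_laplacian_sobolev_2[OF weak_laplacian_add] that sobolev_2_weak_laplacian by blast
  show "cscale c u \<in> sobolev 2" if "u \<in> sobolev 2" for c u
    using weak_laplacian_sobolev_2[OF weak_laplacian_cscale] that sobolev_2_weak_laplacian by blast
qed

lemma schrodinger_add:
  assumes V: "bpot V" and "u \<in> sobolev 2" "v \<in> sobolev 2"
  shows "schrodinger \<omega> V (u + v) = schrodinger \<omega> V u + schrodinger \<omega> V v"
proof -
  have "laplacian (u + v) = laplacian u + laplacian v"
    by (rule laplacian_eq[OF weak_laplacian_add]) (use assms sobolev_2_weak_laplacian in auto)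
  then show ?thesis
    by (simp add: schrodinger_def mult_op_add[OF V] scaleR_right_distrib)
qed

lemma schrodinger_cscale:
  assumes V: "bpot V" and "u \<in> sobolev 2"
  shows "schrodinger \<omega> V (cscale c u) = cscale c (schrodinger \<omega> V u)"
proof -
  have "laplacian (cscale c u) = cscale c (laplacian u)"
    by (rule laplacian_eq[OF weak_laplacian_cscale]) (use assms sobolev_2_weak_laplacian in auto)
  then show ?thesis
    by (simp add: schrodinger_def mult_op_cscale[OF V] cL2.scale_right_distrib cL2.scale_right_diff_distrib
        scaleR_eq_cscale mult.commute)
qed

lemma schrodinger_symmetric:
  assumes V: "bpot V" and u: "u \<in> sobolev 2" and v: "v \<in> sobolev 2"
  shows "cinner (schrodinger \<omega> V u) v = cinner u (schrodinger \<omega> V v)"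
  using weak_laplacian_symmetric[OF sobolev_2_weak_laplacian[OF u] sobolev_2_weak_laplacian[OF v]]
  unfolding schrodinger_def cinner_add_left cinner_add_right cinner_diff_left cinner_diff_right
    cinner_minus_left cinner_minus_right cinner_scaleR_left cinner_scaleR_right
  by (simp add: cinner_mult_op[OF V])

lemma test_in_sobolev_2: "test_function \<psi> \<Longrightarrow> to_L2 \<psi> \<in> sobolev 2"
  by (rule weak_laplacian_sobolev_2[OF weak_laplacian_test])

lemma closure_sobolev_2: "closure (sobolev 2) = UNIV"
proof (rule dense_if_orthogonal_trivial)
  show "subspace (sobolev 2)"
    using sobolev_2_subspace unfolding subspace_def cL2.subspace_def by (simp add: scaleR_eq_cscale)
  fix v assume v: "\<And>s. s \<in> sobolev 2 \<Longrightarrow> inner s v = 0"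
  show "v = 0"
  proof (rule L2_eq_0_if_orthogonal_to_test_functions)
    fix \<psi> assume "test_function \<psi>"
    then have \<psi>: "to_L2 \<psi> \<in> sobolev 2" by (rule test_in_sobolev_2)
    have "inner v (to_L2 \<psi>) = 0" "inner v (cscale \<i> (to_L2 \<psi>)) = 0"
      using v[OF \<psi>] v[OF cL2.subspace_scale[OF sobolev_2_subspace \<psi>]] by (simp_all add: inner_commute)
    then show "cinner v (to_L2 \<psi>) = 0" by (simp add: cinner_eq_Complex complex_eq_iff)
  qed
qed

text \<open>Testing the adjoint relation with test functions shows that an element of the adjoint
  domain has a square-integrable distributional Laplacian; regularity then places it in
  \<open>sobolev 2\<close>.\<close>

lemma self_adjoint_schrodinger:
  assumes V: "bpot V"
  shows "self_adjoint (sobolev 2) (schrodinger \<omega> V)"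
  unfolding self_adjoint_def
proof (intro conjI)
  show "linear_operator (sobolev 2) (schrodinger \<omega> V)"
    unfolding linear_operator_def
    using sobolev_2_subspace schrodinger_add[OF V] schrodinger_cscale[OF V] by blast
  show "closure (sobolev 2) = UNIV" by (rule closure_sobolev_2)
  show "{(v, w). \<forall>u\<in>sobolev 2. cinner (schrodinger \<omega> V u) v = cinner u w} =
      {(v, schrodinger \<omega> V v) |v. v \<in> sobolev 2}"
  proof (intro set_eqI iffI)
    fix p assume "p \<in> {(v, w). \<forall>u\<in>sobolev 2. cinner (schrodinger \<omega> V u) v = cinner u w}"
    then obtain v w where p: "p = (v, w)"
      and vw: "\<And>u. u \<in> sobolev 2 \<Longrightarrow> cinner (schrodinger \<omega> V u) v = cinner u w" by auto
    \<comment> \<open>The equation L v = w solved for \<Delta>v.\<close>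
    define z where "z = - w + \<omega> *\<^sub>R v - mult_op V v"
    have "weak_laplacian v z"
      unfolding weak_laplacian_def
    proof (intro allI impI)
      fix \<psi> assume \<psi>: "test_function \<psi>"
      let ?p = "to_L2 \<psi>" and ?l = "to_L2 (classical_laplacian \<psi>)"
      have "cinner (- ?l + \<omega> *\<^sub>R ?p - mult_op V ?p) v = cinner ?p w"
        using vw[OF test_in_sobolev_2[OF \<psi>]] schrodinger_eq[OF weak_laplacian_test[OF \<psi>]] by simp
      then have "cinner ?l v = cinner ?p z"
        unfolding z_def cinner_add_left cinner_add_right cinner_diff_left cinner_diff_right
          cinner_minus_left cinner_minus_right cinner_scaleR_left cinner_scaleR_right cinner_mult_op[OF V]
        by (simp add: algebra_simps)
      then show "cinner v ?l = cinner z ?p" by (metis cinner_commute)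
    qed
    then have "v \<in> sobolev 2" "schrodinger \<omega> V v = w"
      using weak_laplacian_sobolev_2 schrodinger_eq by (auto simp: z_def)
    then show "p \<in> {(v, schrodinger \<omega> V v) |v. v \<in> sobolev 2}" using p by blast
  next
    fix p assume "p \<in> {(v, schrodinger \<omega> V v) |v. v \<in> sobolev 2}"
    then show "p \<in> {(v, w). \<forall>u\<in>sobolev 2. cinner (schrodinger \<omega> V u) v = cinner u w}"
      using schrodinger_symmetric[OF V] by auto
  qed
qed

lemma bounded_below_schrodinger:
  assumes V: "bpot V"
  shows "bounded_below (sobolev 2) (schrodinger \<omega> V)"
proof -
  obtain M where M: "M \<ge> 0" "\<And>x. \<bar>V x\<bar> \<le> M" using bpot_bound[OF V] by blast
  have "(\<omega> - M) * (norm u)\<^sup>2 \<le> Re (cinner (schrodinger \<omega> V u) u)" if u: "u \<in> sobolev 2" for u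
  proof -
    have "- inner (laplacian u) u \<ge> 0"
      using grad_norm_sq[OF sobolev_2_weak_laplacian[OF u]] zero_le_power2[of "grad_norm u"] by simp
    moreover have "inner (mult_op V u) u \<le> M * (norm u)\<^sup>2"
    proof -
      have "inner (mult_op V u) u \<le> norm (mult_op V u) * norm u" by (rule norm_cauchy_schwarz)
      also have "\<dots> \<le> M * norm u * norm u" by (intro mult_right_mono norm_mult_op_le V M) auto
      finally show ?thesis by (simp add: power2_eq_square mult.assoc)
    qed
    ultimately show ?thesis
      unfolding Re_cinner schrodinger_def
      by (simp add: inner_diff_left inner_add_left power2_norm_eq_inner left_diff_distrib)
  qed
  then show ?thesis unfolding bounded_below_def by blast
qed

lemma schrodinger_approx:
  assumes V: "bpot V" and u: "u \<in> sobolev 2"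
  obtains a b where "\<And>n. testc (a n) (b n)"
    "(\<lambda>n. to_L2c (a n) (b n)) \<longlonglongrightarrow> u"
    "(\<lambda>n. schrodinger \<omega> V (to_L2c (a n) (b n))) \<longlonglongrightarrow> schrodinger \<omega> V u"
proof -
  have w: "weak_laplacian u (laplacian u)" by (rule sobolev_2_weak_laplacian[OF u])
  obtain a b where a: "\<And>n. testc (a n) (b n)"
    "(\<lambda>n. to_L2c (a n) (b n)) \<longlonglongrightarrow> u"
    "(\<lambda>n. to_L2c (classical_laplacian (a n)) (classical_laplacian (b n))) \<longlonglongrightarrow> laplacian u"
    by (rule H2_approx[OF w]) blast
  have t: "test_function (a n)" "test_function (b n)" for n using a(1)[of n] by (auto simp: testc_def)
  have "(\<lambda>n. schrodinger \<omega> V (to_L2c (a n) (b n))) \<longlonglongrightarrow> schrodinger \<omega> V u"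
    unfolding schrodinger_eq[OF weak_laplacian_testc[OF t]] schrodinger_eq[OF w]
    by (intro tendsto_intros a tendsto_mult_op V)
  then show ?thesis using that a by blast
qed

text \<open>The form of -\<Delta> + \<omega> - V in terms of the Laplacian, so that it applies
  directly to functions without compact support such as \<phi>.\<close>

definition qform :: "real \<Rightarrow> (real^2 \<Rightarrow> real) \<Rightarrow> (real^2 \<Rightarrow> real) \<Rightarrow> real" where
  "qform \<omega> V f = - (LINT x|lborel. f x * classical_laplacian f x) + (LINT x|lborel. (\<omega> - V x) * (f x)\<^sup>2)"

lemma inner_schrodinger_to_L2:
  assumes V: "bpot V" and f: "Ck 2 f" "sqi f" "sqi (classical_laplacian f)"
  shows "inner (schrodinger \<omega> V (to_L2 f)) (to_L2 f) = qform \<omega> V f"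
proof -
  have i: "integrable lborel (\<lambda>x. f x * f x)" "integrable lborel (\<lambda>x. V x * f x * f x)"
    by (intro sqi_integrable_mult sqi_mult_bpot V f)+
  have "(LINT x|lborel. (\<omega> - V x) * (f x)\<^sup>2) = (LINT x|lborel. \<omega> * (f x * f x) - V x * f x * f x)"
    by (simp add: algebra_simps power2_eq_square)
  also have "\<dots> = \<omega> * (LINT x|lborel. f x * f x) - (LINT x|lborel. V x * f x * f x)"
    using i by simp
  finally have q: "qform \<omega> V f = - (LINT x|lborel. f x * classical_laplacian f x) +
      (\<omega> * (LINT x|lborel. f x * f x) - (LINT x|lborel. V x * f x * f x))"
    by (simp only: qform_def)
  have "inner (to_L2 (classical_laplacian f)) (to_L2 f) = (LINT x|lborel. f x * classical_laplacian f x)"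
    by (subst inner_commute) (simp add: inner_to_L2 f)
  then show ?thesis
    unfolding schrodinger_eq[OF weak_laplacian_to_L2[OF f]] q mult_op_to_L2[OF V f(2)]
    by (simp add: inner_diff_left inner_add_left inner_to_L2 f sqi_mult_bpot[OF V f(2)])
qed


section \<open>Operators whose form is nonnegative on a hyperplane\<close>

lemma inner_cscale_both: "inner (cscale c u) (cscale c v) = (cmod c)\<^sup>2 * inner u v"
proof -
  have "cinner (cscale c u) (cscale c v) = c * cnj c * cinner u v"
    by (simp add: cinner_cscale_left cinner_cscale_right)
  also have "\<dots> = of_real ((cmod c)\<^sup>2) * cinner u v"
    by (simp only: complex_norm_square)
  finally show ?thesis by (simp flip: Re_cinner)
qed

lemma cinner_eqI:
  assumes "\<And>c. inner (cscale c x) z = inner (cscale c y) w"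
  shows "cinner x z = cinner y w"
proof (rule complex_eqI)
  show "Re (cinner x z) = Re (cinner y w)"
    using assms[of 1] by (simp add: Re_cinner)
  have "Re (cinner (cscale (- \<i>) x) z) = Re (cinner (cscale (- \<i>) y) w)"
    unfolding Re_cinner by (rule assms)
  then show "Im (cinner x z) = Im (cinner y w)"
    unfolding cinner_cscale_left by simp
qed

lemma inner_cscale_eq_0: "cinner u v = 0 \<Longrightarrow> inner u (cscale c v) = 0" "cinner u v = 0 \<Longrightarrow> inner (cscale c v) u = 0"
  using cinner_commute[of v u] by (simp_all add: cinner_cscale_left cinner_cscale_right flip: Re_cinner)

lemma discriminant_nonpos:
  fixes a b c :: real
  assumes "\<And>t. 0 \<le> a + 2 * t * b + t\<^sup>2 * c" and c: "c \<ge> 0"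
  shows "b\<^sup>2 \<le> a * c"
proof (cases "c = 0")
  case True
  have "b = 0"
  proof (rule ccontr)
    assume "b \<noteq> 0"
    then show False using assms(1)[of "- (a + 1) / (2 * b)"] True by (simp add: field_simps)
  qed
  then show ?thesis using True by simp
next
  case False
  then have "c > 0" using c by simp
  have "0 \<le> a + 2 * (- b / c) * b + (- b / c)\<^sup>2 * c" by (rule assms(1))
  also have "\<dots> = (a * c - b\<^sup>2) / c" using \<open>c > 0\<close> by (simp add: field_simps power2_eq_square)
  finally show ?thesis using \<open>c > 0\<close> by (simp add: zero_le_divide_iff)
qed

text \<open>A form that is nonnegative on a complex hyperplane has at most one negative direction,
  and \<phi> provides one. Here \<eta> is an arbitrary normal vector, not an eigenvector; replacing
  its hyperplane by the complement of an eigenvector is the purpose of this part.\<close>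

locale codim_one_operator =
  fixes D T and \<eta> \<phi> :: L2
  assumes sa: "self_adjoint D T" and bb: "bounded_below D T"
    and hyperplane: "\<And>u. u \<in> D \<Longrightarrow> cinner u \<eta> = 0 \<Longrightarrow> 0 \<le> inner (T u) u"
    and \<phi>: "\<phi> \<in> D" "inner (T \<phi>) \<phi> < 0"
begin

lemma sub: "cL2.subspace D"
  and T_add: "\<And>u v. u \<in> D \<Longrightarrow> v \<in> D \<Longrightarrow> T (u + v) = T u + T v"
  and T_cscale: "\<And>c u. u \<in> D \<Longrightarrow> T (cscale c u) = cscale c (T u)"
  using sa unfolding self_adjoint_def linear_operator_def by blast+

text \<open>Self-adjointness in the form in which it is used: a weak solution of
  \<open>T v = w\<close>, tested against the domain, lies in the domain.\<close>

lemma graph: "(\<forall>u\<in>D. cinner (T u) v = cinner u w) \<longleftrightarrow> v \<in> D \<and> w = T v"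
proof -
  have "(v, w) \<in> {(v, w). \<forall>u\<in>D. cinner (T u) v = cinner u w} \<longleftrightarrow> (v, w) \<in> {(v, T v) |v. v \<in> D}"
    using sa unfolding self_adjoint_def by simp
  then show ?thesis by auto
qed

lemma T_sym: "u \<in> D \<Longrightarrow> v \<in> D \<Longrightarrow> cinner (T u) v = cinner u (T v)"
  using graph[of v "T v"] by blast

lemma T_sym_inner: "u \<in> D \<Longrightarrow> v \<in> D \<Longrightarrow> inner (T u) v = inner (T v) u"
  using T_sym[of u v] by (metis Re_cinner inner_commute)

lemma D_add: "u \<in> D \<Longrightarrow> v \<in> D \<Longrightarrow> u + v \<in> D"
  and D_cscale: "u \<in> D \<Longrightarrow> cscale c u \<in> D"
  and D_diff: "u \<in> D \<Longrightarrow> v \<in> D \<Longrightarrow> u - v \<in> D"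
  and D_scaleR: "u \<in> D \<Longrightarrow> r *\<^sub>R u \<in> D"
  using cL2.subspace_add[OF sub] cL2.subspace_scale[OF sub] cL2.subspace_diff[OF sub]
  by (auto simp: scaleR_eq_cscale)

lemma T_diff: "u \<in> D \<Longrightarrow> v \<in> D \<Longrightarrow> T (u - v) = T u - T v"
  using T_add[of u "cscale (-1) v"] T_cscale[of v "-1"] D_cscale[of v "-1"]
  by (simp only: minus_eq_cscale)

lemma T_scaleR: "u \<in> D \<Longrightarrow> T (r *\<^sub>R u) = r *\<^sub>R T u"
  by (simp add: scaleR_eq_cscale T_cscale)

definition q where "q u = inner (T u) u"

text \<open>The infimum of the Rayleigh quotient, that is, the bottom of the spectrum.\<close>

definition low where "low = Inf {q u |u. u \<in> D \<and> norm u = 1}"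

lemma q_cscale: "u \<in> D \<Longrightarrow> q (cscale c u) = (cmod c)\<^sup>2 * q u"
  by (simp add: q_def T_cscale inner_cscale_both)

lemma q_scaleR: "u \<in> D \<Longrightarrow> q (r *\<^sub>R u) = r\<^sup>2 * q u"
  by (simp add: scaleR_eq_cscale q_cscale)

lemma unit:
  assumes "u \<in> D" "u \<noteq> 0"
  shows "(1 / norm u) *\<^sub>R u \<in> D" "norm ((1 / norm u) *\<^sub>R u) = 1" "q u = (norm u)\<^sup>2 * q ((1 / norm u) *\<^sub>R u)"
proof -
  show "(1 / norm u) *\<^sub>R u \<in> D" by (rule D_scaleR[OF assms(1)])
  show "norm ((1 / norm u) *\<^sub>R u) = 1" using assms(2) by simp
  show "q u = (norm u)\<^sup>2 * q ((1 / norm u) *\<^sub>R u)"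
    unfolding q_scaleR[OF assms(1)] using assms(2) by (simp add: power_divide)
qed

lemma \<phi>_nonzero: "\<phi> \<noteq> 0"
  using \<phi> by auto

lemma bdd: "bdd_below {q u |u. u \<in> D \<and> norm u = 1}"
proof -
  obtain c where "\<And>u. u \<in> D \<Longrightarrow> c * (norm u)\<^sup>2 \<le> Re (cinner (T u) u)"
    using bb unfolding bounded_below_def by blast
  then have c: "\<And>u. u \<in> D \<Longrightarrow> c * (norm u)\<^sup>2 \<le> q u"
    unfolding q_def Re_cinner .
  show ?thesis
  proof (rule bdd_belowI)
    fix y assume "y \<in> {q u |u. u \<in> D \<and> norm u = 1}"
    then obtain u where "y = q u" "u \<in> D" "norm u = 1" by blast
    then show "c \<le> y" using c[of u] by simp
  qed
qed

lemma low_le: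
  assumes "u \<in> D" shows "low * (norm u)\<^sup>2 \<le> q u"
proof (cases "u = 0")
  case True
  then show ?thesis by (simp add: q_def)
next
  case False
  have "low \<le> q ((1 / norm u) *\<^sub>R u)"
    unfolding low_def by (rule cInf_lower[OF _ bdd]) (use unit[OF assms False] in blast)
  then have "(norm u)\<^sup>2 * low \<le> (norm u)\<^sup>2 * q ((1 / norm u) *\<^sub>R u)"
    by (rule mult_left_mono) simp
  then show ?thesis using unit(3)[OF assms False] by (simp add: mult.commute)
qed

lemma low_neg: "low < 0"
proof (rule ccontr)
  assume "\<not> low < 0"
  then have "0 \<le> low * (norm \<phi>)\<^sup>2" by simp
  then show False using low_le[OF \<phi>(1)] \<phi>(2) by (simp add: q_def)
qed

text \<open>The form of T - \<open>low\<close>. It is nonnegative, so it satisfies a Cauchy-Schwarz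
  inequality, and minimizing the Rayleigh quotient means driving P to zero.\<close>

definition P where "P u = q u - low * (norm u)\<^sup>2"

lemma P_nonneg: "u \<in> D \<Longrightarrow> 0 \<le> P u"
  using low_le by (simp add: P_def)

lemma P_cscale: "u \<in> D \<Longrightarrow> P (cscale c u) = (cmod c)\<^sup>2 * P u"
  by (simp add: P_def q_cscale norm_cscale power_mult_distrib right_diff_distrib)

lemma P_expand:
  assumes "u \<in> D" "v \<in> D"
  shows "P (u + t *\<^sub>R v) = P u + 2 * t * (inner (T v) u - low * inner v u) + t\<^sup>2 * P v"
proof -
  have "inner (T (u + t *\<^sub>R v)) (u + t *\<^sub>R v) = inner (T u) u + 2 * t * inner (T v) u + t\<^sup>2 * inner (T v) v"
    using T_sym_inner[OF assms] assms
    by (simp add: T_add T_scaleR D_scaleR inner_add_left inner_add_right power2_eq_square algebra_simps)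
  moreover have "(norm (u + t *\<^sub>R v))\<^sup>2 = (norm u)\<^sup>2 + 2 * t * inner v u + t\<^sup>2 * (norm v)\<^sup>2"
    unfolding power2_norm_eq_inner
    by (simp add: inner_add_left inner_add_right inner_commute power2_eq_square algebra_simps)
  ultimately show ?thesis by (simp add: P_def q_def algebra_simps)
qed

lemma P_diff_le:
  assumes "u \<in> D" "v \<in> D" shows "P (u - v) \<le> 2 * P u + 2 * P v"
  using P_expand[OF assms, of 1] P_expand[OF assms, of "-1"] P_nonneg[OF D_add[OF assms]] by simp

lemma P_Cauchy_Schwarz:
  assumes "u \<in> D" "v \<in> D"
  shows "(inner (T v) u - low * inner v u)\<^sup>2 \<le> P u * P v"
proof (rule discriminant_nonpos)
  show "0 \<le> P u + 2 * t * (inner (T v) u - low * inner v u) + t\<^sup>2 * P v" for t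
    using P_nonneg[OF D_add[OF assms(1) D_scaleR[OF assms(2)]]] P_expand[OF assms] by simp
  show "0 \<le> P v" by (rule P_nonneg[OF assms(2)])
qed

text \<open>On the hyperplane q is nonnegative, and what remains of P is the positive multiple
  -\<open>low\<close> of the squared norm.\<close>

lemma P_coercive:
  assumes "u \<in> D" "cinner u \<eta> = 0" shows "- low * (norm u)\<^sup>2 \<le> P u"
  using hyperplane[OF assms] by (simp add: P_def q_def)

text \<open>A unit vector u with small P u stays away from the hyperplane, where P is coercive.
  Hence |<u, \<eta>>| is bounded below, and dividing by <u, \<eta>> keeps P small.\<close>

lemma normalized_minimizing:
  assumes e: "e > 0" shows "\<exists>z\<in>D. cinner z \<eta> = 1 \<and> P z < e"
proof -
  define d where "d = cinner \<phi> \<eta>"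
  have d: "d \<noteq> 0" using hyperplane[OF \<phi>(1)] \<phi>(2) by (auto simp: d_def)
  define f where "f = cscale (1 / d) \<phi>"
  have f: "f \<in> D" "cinner f \<eta> = 1" "norm f > 0"
    using d \<phi>_nonzero by (auto simp: f_def D_cscale \<phi> cinner_cscale_left d_def norm_cscale)
  define l where "l = - low"
  have l: "l > 0" using low_neg by (simp add: l_def)
  \<comment> \<open>The constant of the lower bound 1/2 \<le> |c|^2 M for c = <u, \<eta>>, obtained
    below by splitting u into c f and its hyperplane part h.\<close>
  define M where "M = 4 * P f / l + 2 * (norm f)\<^sup>2"
  have "2 * (norm f)\<^sup>2 > 0" using f(3) by simp
  moreover have "4 * P f / l \<ge> 0" using l P_nonneg[OF f(1)] by simp
  ultimately have M: "M > 0" unfolding M_def by linarith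
  \<comment> \<open>The bound l/8 lets the error 4 \<delta> absorb only half of l in the lower bound
    for |c|^2; the bound e/(4 M) gives P z \<le> 2 M \<delta> \<le> e/2.\<close>
  define \<delta> where "\<delta> = min (l / 8) (e / (4 * M))"
  have \<delta>: "\<delta> > 0" "\<delta> \<le> l / 8" "\<delta> \<le> e / (4 * M)" using l e M by (auto simp: \<delta>_def)
  have "{q u |u. u \<in> D \<and> norm u = 1} \<noteq> {}"
    using unit(1,2)[OF \<phi>(1) \<phi>_nonzero] by blast
  then obtain u where u: "u \<in> D" "norm u = 1" "q u < low + \<delta>"
    using cInf_lessD[of "{q u |u. u \<in> D \<and> norm u = 1}" "low + \<delta>"] \<delta>(1)
    unfolding low_def[symmetric] by auto
  have Pu: "P u < \<delta>" using u by (simp add: P_def)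
  define c where "c = cinner u \<eta>"
  define h where "h = u - cscale c f"
  have h: "h \<in> D" "cinner h \<eta> = 0"
    by (simp_all add: h_def D_diff D_cscale u f cinner_diff_left cinner_cscale_left c_def)
  have "l * (norm h)\<^sup>2 \<le> P h" using P_coercive[OF h] by (simp add: l_def)
  also have "\<dots> \<le> 2 * P u + 2 * P (cscale c f)"
    unfolding h_def by (rule P_diff_le[OF u(1) D_cscale[OF f(1)]])
  also have "\<dots> \<le> 2 * \<delta> + 2 * ((cmod c)\<^sup>2 * P f)"
    using Pu by (simp add: P_cscale f)
  finally have h1: "l * (norm h)\<^sup>2 \<le> 2 * \<delta> + 2 * ((cmod c)\<^sup>2 * P f)" .
  have "norm u \<le> norm h + norm (cscale c f)"
    using norm_triangle_ineq[of h "cscale c f"] by (simp add: h_def)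
  then have "1 \<le> (norm h + cmod c * norm f)\<^sup>2"
    using power_mono[of 1 "norm h + cmod c * norm f" 2] u(2) by (simp add: norm_cscale)
  also have "\<dots> \<le> 2 * (norm h)\<^sup>2 + 2 * ((cmod c)\<^sup>2 * (norm f)\<^sup>2)"
    using sum_squares_bound[of "norm h" "cmod c * norm f"] by (simp add: power2_sum power_mult_distrib algebra_simps)
  finally have "l * 1 \<le> l * (2 * (norm h)\<^sup>2 + 2 * ((cmod c)\<^sup>2 * (norm f)\<^sup>2))"
    using l by (intro mult_left_mono) auto
  also have "\<dots> = 2 * (l * (norm h)\<^sup>2) + l * (2 * ((cmod c)\<^sup>2 * (norm f)\<^sup>2))"
    by (simp add: algebra_simps)
  also have "\<dots> \<le> 4 * \<delta> + 4 * ((cmod c)\<^sup>2 * P f) + l * (2 * ((cmod c)\<^sup>2 * (norm f)\<^sup>2))"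
    using h1 by simp
  also have "\<dots> = 4 * \<delta> + l * ((cmod c)\<^sup>2 * M)"
    using l by (simp add: M_def field_simps)
  also have "\<dots> \<le> l / 2 + l * ((cmod c)\<^sup>2 * M)"
    using \<delta>(2) by simp
  finally have "l * (1 / 2) \<le> l * ((cmod c)\<^sup>2 * M)" by simp
  then have cM: "1 / 2 \<le> (cmod c)\<^sup>2 * M" using l by simp
  then have c: "c \<noteq> 0" by auto
  define z where "z = cscale (1 / c) u"
  have z: "z \<in> D" "cinner z \<eta> = 1"
    using c by (auto simp: z_def D_cscale u cinner_cscale_left c_def)
  have "P z = P u / (cmod c)\<^sup>2"
    by (simp add: z_def P_cscale u norm_divide power_divide)
  also have "\<dots> \<le> \<delta> / (cmod c)\<^sup>2"
    using Pu by (intro divide_right_mono) auto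
  also have "\<dots> \<le> 2 * M * \<delta>"
  proof -
    have "\<delta> * 1 \<le> \<delta> * (2 * ((cmod c)\<^sup>2 * M))"
      using cM \<delta>(1) by (intro mult_left_mono) auto
    then show ?thesis using c by (simp add: field_simps)
  qed
  also have "\<dots> \<le> 2 * M * (e / (4 * M))"
    using M \<delta>(3) by (intro mult_left_mono) auto
  also have "\<dots> < e" using M e by simp
  finally show ?thesis using z by blast
qed

text \<open>The normalisation puts the differences of the minimizing sequence into the hyperplane, where
  \<open>P\<close> is coercive; so the sequence is Cauchy and no compactness is needed.\<close>

lemma ground_state: "\<exists>z\<in>D. z \<noteq> 0 \<and> cinner z \<eta> = 1 \<and> T z = low *\<^sub>R z"
proof -
  have "\<exists>z\<in>D. cinner z \<eta> = 1 \<and> P z < 1 / Suc n" for n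
    by (rule normalized_minimizing) simp
  then obtain z where z: "\<And>n. z n \<in> D" "\<And>n. cinner (z n) \<eta> = 1" "\<And>n. P (z n) < 1 / Suc n"
    by metis
  define l where "l = - low"
  have l: "l > 0" using low_neg by (simp add: l_def)
  have d: "l * (norm (z n - z m))\<^sup>2 \<le> 2 * P (z n) + 2 * P (z m)" for n m
    using P_coercive[OF D_diff[OF z(1)[of n] z(1)[of m]]] P_diff_le[OF z(1)[of n] z(1)[of m]]
    by (simp add: cinner_diff_left z(2) l_def)
  have P0: "(\<lambda>n. P (z n)) \<longlonglongrightarrow> 0"
    by (rule tendsto_sandwich[OF _ _ tendsto_const LIMSEQ_Suc[OF lim_inverse_n']];
        intro always_eventually allI P_nonneg z(1) less_imp_le[OF z(3)])
  have "Cauchy z"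
  proof (rule CauchyI)
    fix e :: real assume e: "e > 0"
    have "l * e\<^sup>2 / 4 > 0" using l e by simp
    then have "\<forall>\<^sub>F n in sequentially. P (z n) < l * e\<^sup>2 / 4"
      by (rule order_tendstoD(2)[OF P0])
    then obtain N where N: "\<And>n. n \<ge> N \<Longrightarrow> P (z n) < l * e\<^sup>2 / 4"
      unfolding eventually_sequentially by blast
    have "norm (z m - z n) < e" if "m \<ge> N" "n \<ge> N" for m n
    proof -
      have "l * (norm (z m - z n))\<^sup>2 < l * e\<^sup>2"
        using d[of m n] N[OF that(1)] N[OF that(2)] by simp
      then have "(norm (z m - z n))\<^sup>2 < e\<^sup>2" using l by simp
      then show ?thesis using e by (simp add: power2_less_imp_less)
    qed
    then show "\<exists>M. \<forall>m\<ge>M. \<forall>n\<ge>M. norm (z m - z n) < e" by blast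
  qed
  then obtain Z where Z: "z \<longlonglongrightarrow> Z"
    using Cauchy_convergent convergent_def by blast
  have "(\<lambda>n. cinner (z n) \<eta>) \<longlonglongrightarrow> cinner Z \<eta>"
    by (intro tendsto_cinner Z tendsto_const)
  then have Z1: "cinner Z \<eta> = 1"
    unfolding z(2) using LIMSEQ_unique[OF tendsto_const] by metis
  \<comment> \<open>Cauchy-Schwarz for P turns P (z n) \<rightarrow> 0 into the eigenvalue equation
    tested against D. This passes to the limit because T acts on the test vector, and
    self-adjointness then puts Z into D.\<close>
  have e: "inner (T v) Z = inner v (low *\<^sub>R Z)" if v: "v \<in> D" for v
  proof -
    have "(\<lambda>n. inner (T v) (z n) - low * inner v (z n)) \<longlonglongrightarrow> inner (T v) Z - low * inner v Z"
      by (intro tendsto_intros Z)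
    then have "(\<lambda>n. (inner (T v) (z n) - low * inner v (z n))\<^sup>2) \<longlonglongrightarrow> (inner (T v) Z - low * inner v Z)\<^sup>2"
      by (rule tendsto_power)
    moreover have "(\<lambda>n. P (z n) * P v) \<longlonglongrightarrow> 0 * P v"
      by (intro tendsto_mult_right P0)
    ultimately have "(inner (T v) Z - low * inner v Z)\<^sup>2 \<le> 0 * P v"
      by (rule LIMSEQ_le) (use P_Cauchy_Schwarz[OF z(1) v] in blast)
    then show ?thesis by simp
  qed
  have "\<forall>v\<in>D. cinner (T v) Z = cinner v (low *\<^sub>R Z)"
  proof
    fix v assume v: "v \<in> D"
    show "cinner (T v) Z = cinner v (low *\<^sub>R Z)"
      by (rule cinner_eqI) (simp add: T_cscale[OF v, symmetric] e[OF D_cscale[OF v]])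
  qed
  then have "Z \<in> D" "T Z = low *\<^sub>R Z" using graph[of Z "low *\<^sub>R Z"] by auto
  moreover have "Z \<noteq> 0" using Z1 by auto
  ultimately show ?thesis using Z1 by blast
qed

text \<open>The form is nonnegative on the orthogonal complement of the ground state z, so every
  eigenvector with a negative eigenvalue is a multiple of z.\<close>

theorem has_morse_index_1: "has_morse_index D T 1"
proof -
  obtain z where z: "z \<in> D" "z \<noteq> 0" "cinner z \<eta> = 1" "T z = low *\<^sub>R z"
    using ground_state by blast
  \<comment> \<open>Subtracting c z with c = <u, \<eta>> moves u into the hyperplane of \<eta>. The
    cross terms vanish because u is orthogonal to z and T z is a multiple of z; the extra term is
    nonpositive, so q u itself is nonnegative.\<close>
  have qd: "0 \<le> q u + (cmod (cinner u \<eta>))\<^sup>2 * (low * (norm z)\<^sup>2)" if u: "u \<in> D" "cinner u z = 0" for u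
  proof -
    define c where "c = cinner u \<eta>"
    have "cinner (u - cscale c z) \<eta> = 0"
      by (simp add: cinner_diff_left cinner_cscale_left z c_def)
    then have "0 \<le> inner (T (u - cscale c z)) (u - cscale c z)"
      by (intro hyperplane D_diff D_cscale u z)
    also have "T (u - cscale c z) = T u - low *\<^sub>R cscale c z"
      by (simp add: T_diff T_cscale D_cscale u z scaleR_eq_cscale mult.commute)
    also have "cinner (T u) z = 0"
      using T_sym[OF u(1) z(1)] u(2) by (simp add: z cinner_scaleR_right)
    then have "inner (T u - low *\<^sub>R cscale c z) (u - cscale c z) = q u + (cmod c)\<^sup>2 * (low * (norm z)\<^sup>2)"
      using u(2) inner_cscale_eq_0
      by (simp add: inner_diff_left inner_diff_right q_def inner_cscale_both power2_norm_eq_inner)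
    finally show ?thesis by (simp add: c_def)
  qed
  have ez: "z \<in> eigenspace D T (of_real low)"
    using z by (simp add: eigenspace_def scaleR_eq_cscale)
  have sp: "u \<in> cL2.span {z}" if r: "r < 0" and u: "u \<in> eigenspace D T (of_real r)" for u r
  proof -
    have uD: "u \<in> D" "T u = r *\<^sub>R u" using u by (auto simp: eigenspace_def scaleR_eq_cscale)
    show ?thesis
    proof (cases "r = low")
      case True
      \<comment> \<open>Simplicity of \<open>low\<close>: this v is in the eigenspace of
        \<open>low\<close> and lies in the hyperplane, where a negative eigenvalue contradicts
        nonnegativity of the form unless v = 0.\<close>
      define v where "v = u - cscale (cinner u \<eta>) z"
      have v: "v \<in> D" "cinner v \<eta> = 0"
        by (simp_all add: v_def D_diff D_cscale uD z cinner_diff_left cinner_cscale_left)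
      have "T v = low *\<^sub>R v"
        by (simp add: v_def T_diff T_cscale D_cscale uD z True scaleR_eq_cscale cL2.scale_right_diff_distrib mult.commute)
      then have "0 \<le> low * (norm v)\<^sup>2" using hyperplane[OF v] by (simp add: power2_norm_eq_inner)
      then have "v = 0" using low_neg by (simp add: zero_le_mult_iff)
      then have "u = cscale (cinner u \<eta>) z" by (simp add: v_def)
      then show ?thesis by (metis cL2.span_base cL2.span_scale singletonI)
    next
      case False
      have "cinner u z = 0"
        using T_sym[OF uD(1) z(1)] False by (simp add: uD z cinner_scaleR_left cinner_scaleR_right)
      from qd[OF uD(1) this] have "0 \<le> r * (norm u)\<^sup>2 + (cmod (cinner u \<eta>))\<^sup>2 * (low * (norm z)\<^sup>2)"
        by (simp add: q_def uD power2_norm_eq_inner)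
      moreover have "(cmod (cinner u \<eta>))\<^sup>2 * (low * (norm z)\<^sup>2) \<le> 0"
        using low_neg by (intro mult_nonneg_nonpos mult_nonpos_nonneg) auto
      ultimately have "0 \<le> r * (norm u)\<^sup>2" by linarith
      then have "u = 0" using r by (simp add: zero_le_mult_iff)
      then show ?thesis by (simp add: cL2.span_zero)
    qed
  qed
  have X: "negative_eigenvectors_span D T = cL2.span {z}"
    unfolding negative_eigenvectors_span_def
  proof (rule cL2.span_eq[THEN iffD2], intro conjI)
    show "(\<Union>r\<in>{..<0::real}. eigenspace D T (of_real r)) \<subseteq> cL2.span {z}"
      using sp by auto
    have "z \<in> (\<Union>r\<in>{..<0::real}. eigenspace D T (of_real r))"
      using ez low_neg by blast
    then have "z \<in> cL2.span (\<Union>r\<in>{..<0::real}. eigenspace D T (of_real r))"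
      by (rule cL2.span_base)
    then show "{z} \<subseteq> cL2.span (\<Union>r\<in>{..<0::real}. eigenspace D T (of_real r))"
      by (simp only: insert_subset empty_subsetI simp_thms)
  qed
  have "cL2.independent {z}" using z(2) by (simp add: cL2.dependent_single)
  then have dim: "cL2.dim (cL2.span {z}) = 1"
    using cL2.dim_span_eq_card_independent[of "{z}"] by simp
  have pos: "0 \<le> Re (cinner (T u) u)" if u: "u \<in> D" "\<forall>v\<in>cL2.span {z}. cinner u v = 0" for u
  proof -
    have "cinner u z = 0" using u(2) cL2.span_base[of z "{z}"] by simp
    from qd[OF u(1) this] have "0 \<le> q u + (cmod (cinner u \<eta>))\<^sup>2 * (low * (norm z)\<^sup>2)" .
    moreover have "(cmod (cinner u \<eta>))\<^sup>2 * (low * (norm z)\<^sup>2) \<le> 0"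
      using low_neg by (intro mult_nonneg_nonpos mult_nonpos_nonneg) auto
    ultimately show ?thesis by (simp add: q_def Re_cinner)
  qed
  show ?thesis
    unfolding has_morse_index_def Let_def X
  proof (intro conjI ballI impI)
    show "\<exists>B. finite B \<and> cL2.span B = cL2.span {z}" by (intro exI[of _ "{z}"]) simp
  qed (use sa bb dim pos in simp_all)
qed

end

section \<open>The nonlinearity\<close>

text \<open>The potential of L-minus is f(u)/u; that of L-plus, \<open>V_plus\<close>, is the
  derivative of f.\<close>

definition V_minus :: "real \<Rightarrow> real \<Rightarrow> real" where
  "V_minus \<mu> u = exp (4 * pi * u\<^sup>2) - 1 - 4 * pi * \<mu> * u\<^sup>2"

definition V_plus :: "real \<Rightarrow> real \<Rightarrow> real" where
  "V_plus \<mu> u = exp (4 * pi * u\<^sup>2) * (8 * pi * u\<^sup>2 + 1) - 1 - 12 * \<mu> * pi * u\<^sup>2"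

definition V_plus' :: "real \<Rightarrow> real \<Rightarrow> real" where
  "V_plus' \<mu> u = exp (4 * pi * u\<^sup>2) * (8 * pi * u) * (8 * pi * u\<^sup>2 + 1) + exp (4 * pi * u\<^sup>2) * (16 * pi * u) - 24 * \<mu> * pi * u"

definition F_real :: "real \<Rightarrow> real \<Rightarrow> real" where
  "F_real \<mu> u = 1 / (8 * pi) * (exp (4 * pi * u\<^sup>2) - 1 - 4 * pi * u\<^sup>2 - 8 * pi\<^sup>2 * \<mu> * u ^ 4)"

lemma F_nl_of_real: "F_nl \<mu> (of_real u) = F_real \<mu> u"
  by (simp add: F_nl_def F_real_def)

lemma f_nl_eq: "f_nl \<mu> u = V_minus \<mu> u * u"
  by (simp add: f_nl_def V_minus_def)

lemma F_real_deriv: "(F_real \<mu> has_real_derivative f_nl \<mu> u) (at u)"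
  unfolding F_real_def[abs_def] f_nl_def
  by (auto intro!: derivative_eq_intros simp: field_simps power2_eq_square power3_eq_cube power4_eq_xxxx)

lemma f_nl_deriv: "(f_nl \<mu> has_real_derivative V_plus \<mu> u) (at u)"
proof -
  have "f_nl \<mu> = (\<lambda>u. (exp (4 * pi * u\<^sup>2) - 1 - 4 * pi * \<mu> * u\<^sup>2) * u)"
    by (simp add: f_nl_def fun_eq_iff)
  then show ?thesis
    unfolding V_plus_def
    by (auto intro!: derivative_eq_intros simp: field_simps power2_eq_square)
qed

lemma V_plus_deriv: "(V_plus \<mu> has_real_derivative V_plus' \<mu> u) (at u)"
  unfolding V_plus_def[abs_def] V_plus'_def
  by (auto intro!: derivative_eq_intros simp: field_simps power2_eq_square)

lemma continuous_V_minus: "continuous_on S (V_minus \<mu>)"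
  and continuous_V_plus: "continuous_on S (V_plus \<mu>)"
  and continuous_V_plus': "continuous_on S (V_plus' \<mu>)"
  and continuous_F_real: "continuous_on S (F_real \<mu>)"
  unfolding V_minus_def[abs_def] V_plus_def[abs_def] V_plus'_def[abs_def] F_real_def[abs_def]
  by (intro continuous_intros; simp)+

lemma V_minus_0: "V_minus \<mu> 0 = 0" and F_real_0: "F_real \<mu> 0 = 0"
  by (simp_all add: V_minus_def F_real_def)

text \<open>For \<mu> = 1 the linear term of the exponential cancels, so positivity has to come from
  the quadratic Taylor term.\<close>

lemma V_minus_pos:
  assumes \<mu>: "\<mu> \<in> {0, 1}" and u: "u \<noteq> 0" shows "V_minus \<mu> u > 0"
proof -
  have s: "4 * pi * u\<^sup>2 > 0" using u by simp
  then have "1 + 4 * pi * u\<^sup>2 + (4 * pi * u\<^sup>2)\<^sup>2 / 2 \<le> exp (4 * pi * u\<^sup>2)"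
    by (intro exp_lower_Taylor_quadratic) simp
  moreover have "(4 * pi * u\<^sup>2)\<^sup>2 / 2 > 0" using u by simp
  ultimately have "exp (4 * pi * u\<^sup>2) > 1 + 4 * pi * u\<^sup>2" by linarith
  then show ?thesis using \<mu> s by (auto simp: V_minus_def)
qed

lemma V_minus_nonneg: "\<mu> \<in> {0, 1} \<Longrightarrow> V_minus \<mu> u \<ge> 0"
  using V_minus_pos[of \<mu> u] V_minus_0[of \<mu>] by (cases "u = 0") auto

text \<open>Writing s = 4 pi u^2, the inequality 1 - s \<le> exp(-s) gives exp s - 1 \<le> s exp s.
  The factor u^2 makes f cubic and F quartic near zero.\<close>

lemma V_minus_le:
  assumes \<mu>: "\<mu> \<in> {0, 1}" and u: "\<bar>u\<bar> \<le> M"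
  shows "V_minus \<mu> u \<le> 4 * pi * exp (4 * pi * M\<^sup>2) * u\<^sup>2"
proof -
  let ?s = "4 * pi * u\<^sup>2"
  have "1 - ?s \<le> exp (- ?s)" using exp_ge_add_one_self[of "- ?s"] by simp
  then have "exp ?s * (1 - ?s) \<le> exp ?s * exp (- ?s)" by (intro mult_left_mono) auto
  then have "exp ?s - 1 \<le> ?s * exp ?s" by (simp add: exp_minus field_simps)
  also have "\<dots> \<le> ?s * exp (4 * pi * M\<^sup>2)"
    using u by (intro mult_left_mono) (auto simp: abs_le_square_iff[symmetric])
  finally have "exp ?s - 1 \<le> ?s * exp (4 * pi * M\<^sup>2)" .
  moreover have "V_minus \<mu> u \<le> exp ?s - 1" using \<mu> by (auto simp: V_minus_def)
  ultimately show ?thesis by (simp add: mult_ac)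
qed

lemma f_nl_bound:
  assumes \<mu>: "\<mu> \<in> {0, 1}" and u: "\<bar>u\<bar> \<le> M"
  shows "\<bar>f_nl \<mu> u\<bar> \<le> 4 * pi * exp (4 * pi * M\<^sup>2) * u\<^sup>2 * \<bar>u\<bar>"
  using V_minus_le[OF \<mu> u] V_minus_nonneg[OF \<mu>, of u]
  by (simp add: f_nl_eq abs_mult mult_right_mono)

text \<open>The difference is 8 pi u^2 (exp(4 pi u^2) - \<mu>).\<close>

lemma V_plus_gt_V_minus:
  assumes \<mu>: "\<mu> \<in> {0, 1}" and u: "u \<noteq> 0" shows "V_plus \<mu> u > V_minus \<mu> u"
proof -
  have s: "4 * pi * u\<^sup>2 > 0" using u by simp
  then have "exp (4 * pi * u\<^sup>2) > 1" by simp
  then have "exp (4 * pi * u\<^sup>2) - \<mu> > 0" using \<mu> by auto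
  then have "8 * pi * u\<^sup>2 * (exp (4 * pi * u\<^sup>2) - \<mu>) > 0" using u by (intro mult_pos_pos) auto
  then show ?thesis by (simp add: V_plus_def V_minus_def algebra_simps)
qed

text \<open>On [-r, r] the derivative f is at most of order r^3. Keeping this power of r is what
  later gives integrability of F(u) and its smallness under scaling of the amplitude.\<close>

lemma F_real_diff_bound:
  assumes \<mu>: "\<mu> \<in> {0, 1}" and ab: "\<bar>a\<bar> \<le> r" "\<bar>b\<bar> \<le> r" and r: "r \<le> M"
  shows "\<bar>F_real \<mu> b - F_real \<mu> a\<bar> \<le> 4 * pi * exp (4 * pi * M\<^sup>2) * r\<^sup>2 * r * \<bar>b - a\<bar>"
proof -
  have r0: "r \<ge> 0" using ab by linarith
  have bd: "\<bar>f_nl \<mu> c\<bar> \<le> 4 * pi * exp (4 * pi * M\<^sup>2) * r\<^sup>2 * r" if "\<bar>c\<bar> \<le> r" for c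
  proof -
    have "\<bar>f_nl \<mu> c\<bar> \<le> 4 * pi * exp (4 * pi * M\<^sup>2) * c\<^sup>2 * \<bar>c\<bar>"
      by (rule f_nl_bound[OF \<mu>]) (use that r in linarith)
    also have "\<dots> \<le> 4 * pi * exp (4 * pi * M\<^sup>2) * r\<^sup>2 * r"
      using that r0 by (intro mult_mono mult_left_mono) (auto simp: abs_le_square_iff[symmetric])
    finally show ?thesis .
  qed
  have "\<bar>F_real \<mu> b - F_real \<mu> a\<bar> \<le> 4 * pi * exp (4 * pi * M\<^sup>2) * r\<^sup>2 * r * \<bar>b - a\<bar>" if ab': "a < b" "\<bar>a\<bar> \<le> r" "\<bar>b\<bar> \<le> r" for a b
  proof -
    obtain z where z: "a < z" "z < b" "F_real \<mu> b - F_real \<mu> a = (b - a) * f_nl \<mu> z"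
      using MVT2[OF ab'(1), of "F_real \<mu>" "f_nl \<mu>"] F_real_deriv by blast
    have "\<bar>f_nl \<mu> z\<bar> \<le> 4 * pi * exp (4 * pi * M\<^sup>2) * r\<^sup>2 * r" by (rule bd) (use z ab' in linarith)
    then have "\<bar>b - a\<bar> * \<bar>f_nl \<mu> z\<bar> \<le> \<bar>b - a\<bar> * (4 * pi * exp (4 * pi * M\<^sup>2) * r\<^sup>2 * r)"
      by (rule mult_left_mono) simp
    then show ?thesis unfolding z(3) abs_mult by (simp add: mult_ac)
  qed
  from this[of a b] this[of b a] ab show ?thesis
    by (cases a b rule: linorder_cases) (simp_all add: abs_minus_commute)
qed

text \<open>The trial functions take values in a fixed interval [-M, M], on which the third
  derivative \<open>V_plus'\<close> of F is bounded by compactness.\<close>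

lemma F_real_Taylor:
  "\<exists>C\<ge>0. \<forall>a d. \<bar>a\<bar> \<le> M \<longrightarrow> \<bar>a + d\<bar> \<le> M \<longrightarrow>
    \<bar>F_real \<mu> (a + d) - F_real \<mu> a - f_nl \<mu> a * d - V_plus \<mu> a / 2 * d\<^sup>2\<bar> \<le> C * \<bar>d\<bar> ^ 3"
proof -
  have "bounded (V_plus' \<mu> ` {-M..M})"
    by (intro compact_imp_bounded compact_continuous_image continuous_V_plus') simp
  then obtain C where "\<forall>y\<in>V_plus' \<mu> ` {-M..M}. norm y \<le> C"
    unfolding bounded_iff by (elim exE)
  then have C: "\<bar>V_plus' \<mu> t\<bar> \<le> max C 0" if "\<bar>t\<bar> \<le> M" for t
  proof -
    have "t \<in> {-M..M}" using that by (simp add: abs_le_iff)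
    then have "\<bar>V_plus' \<mu> t\<bar> \<le> C"
      using \<open>\<forall>y\<in>V_plus' \<mu> ` {-M..M}. norm y \<le> C\<close> by simp
    then show ?thesis by simp
  qed
  have "\<bar>F_real \<mu> (a + d) - F_real \<mu> a - f_nl \<mu> a * d - V_plus \<mu> a / 2 * d\<^sup>2\<bar> \<le> max C 0 / 6 * \<bar>d\<bar> ^ 3"
    if a: "\<bar>a\<bar> \<le> M" "\<bar>a + d\<bar> \<le> M" for a d
  proof (cases "d = 0")
    case False
    define diff where "diff n = (if n = 0 then F_real \<mu> else if n = 1 then f_nl \<mu> else if n = 2 then V_plus \<mu> else V_plus' \<mu>)" for n :: nat
    have "\<forall>m t. m < 3 \<and> - M \<le> t \<and> t \<le> M \<longrightarrow> (diff m has_real_derivative diff (Suc m) t) (at t)"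
    proof (intro allI impI)
      fix m :: nat and t assume "m < 3 \<and> - M \<le> t \<and> t \<le> M"
      then consider "m = 0" | "m = 1" | "m = 2" by linarith
      then show "(diff m has_real_derivative diff (Suc m) t) (at t)"
        by cases (simp_all add: diff_def F_real_deriv f_nl_deriv V_plus_deriv)
    qed
    then have "\<exists>t. (if a + d < a then a + d < t \<and> t < a else a < t \<and> t < a + d) \<and>
        F_real \<mu> (a + d) = (\<Sum>m<3. diff m a / fact m * (a + d - a) ^ m) + diff 3 t / fact 3 * (a + d - a) ^ 3"
      using a False by (intro Taylor[of 3 diff "F_real \<mu>" "- M" M]) (auto simp: diff_def abs_le_iff)
    then obtain t where t: "(if a + d < a then a + d < t \<and> t < a else a < t \<and> t < a + d)"
      "F_real \<mu> (a + d) = (\<Sum>m<3. diff m a / fact m * d ^ m) + diff 3 t / fact 3 * d ^ 3"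
      by auto
    have "F_real \<mu> (a + d) - F_real \<mu> a - f_nl \<mu> a * d - V_plus \<mu> a / 2 * d\<^sup>2 = V_plus' \<mu> t / 6 * d ^ 3"
      unfolding t(2) by (simp add: numeral_3_eq_3 diff_def fact_numeral) (simp add: numeral_2_eq_2)
    moreover have "\<bar>V_plus' \<mu> t / 6 * d ^ 3\<bar> \<le> max C 0 / 6 * \<bar>d\<bar> ^ 3"
      unfolding abs_mult power_abs abs_divide
      by (intro mult_right_mono divide_right_mono) (use C[of t] t(1) a in \<open>auto split: if_splits\<close>)
    ultimately show ?thesis by (simp only:)
  qed auto
  then show ?thesis by (intro exI[of _ "max C 0 / 6"]) auto
qed

section \<open>Bell-shaped functions\<close>

lemma bell_shaped_nonneg: "bell_shaped u \<Longrightarrow> 0 \<le> u x"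
proof -
  assume u: "bell_shaped u"
  have "0 \<le> schwarz_rearrangement u x"
    unfolding schwarz_rearrangement_def set_lebesgue_integral_def by (intro Bochner_Integration.integral_nonneg) auto
  then show ?thesis using u by (simp add: bell_shaped_def)
qed

text \<open>Chebyshev's inequality. Finiteness matters because \<open>measure\<close> assigns 0 to
  sets of infinite area, which would destroy monotonicity in the level t.\<close>

lemma superlevel_finite:
  assumes u: "sqi u" and t: "t > 0"
  shows "{y. t < \<bar>u y\<bar>} \<in> fmeasurable lborel"
proof (rule fmeasurableI2)
  have [measurable]: "u \<in> borel_measurable borel" by (rule sqi_measurable[OF u])
  have "emeasure lborel {y \<in> space lborel. t\<^sup>2 \<le> (u y)\<^sup>2} \<le> ennreal (1 / t\<^sup>2 * (LINT y|lborel. (u y)\<^sup>2))"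
    by (rule integral_Markov_inequality) (use u t in \<open>auto simp: sqi_def\<close>)
  also have "\<dots> < \<infinity>" by (simp add: ennreal_less_top)
  finally show "{y. t\<^sup>2 \<le> (u y)\<^sup>2} \<in> fmeasurable lborel"
    by (intro fmeasurableI) auto
  show "{y. t < \<bar>u y\<bar>} \<in> sets lborel" by measurable
  show "{y. t < \<bar>u y\<bar>} \<subseteq> {y. t\<^sup>2 \<le> (u y)\<^sup>2}"
    using t by (auto simp: abs_le_square_iff[symmetric])
qed

text \<open>Such a set is a half-open interval if it has a greatest element, and open otherwise. It
  provides measurability of a set of levels described only through a monotone radius.\<close>

lemma down_closed_borel:
  fixes S :: "real set"
  assumes "\<And>s t. t \<in> S \<Longrightarrow> a < s \<Longrightarrow> s < t \<Longrightarrow> s \<in> S" "S \<subseteq> {a<..}"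
  shows "S \<in> sets borel"
proof (cases "\<exists>m\<in>S. \<forall>s\<in>S. s \<le> m")
  case True
  then obtain m where m: "m \<in> S" "\<And>s. s \<in> S \<Longrightarrow> s \<le> m" by blast
  have "S = {a<..m}"
  proof (intro set_eqI iffI)
    fix s assume "s \<in> {a<..m}"
    then show "s \<in> S" using assms(1)[OF m(1), of s] m(1) by (cases "s = m") auto
  qed (use m assms(2) in auto)
  then show ?thesis by simp
next
  case False
  have "S = (\<Union>t\<in>S. {a<..<t})"
  proof (intro set_eqI iffI)
    fix s assume s: "s \<in> S"
    then obtain t where "t \<in> S" "s < t" using False by (meson not_le)
    then show "s \<in> (\<Union>t\<in>S. {a<..<t})" using s assms(2) by auto
  qed (use assms(1) in auto)
  moreover have "open (\<Union>t\<in>S. {a<..<t})" by auto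
  ultimately show ?thesis by (metis borel_open)
qed

text \<open>The rearrangement at z is the length of the set of levels whose disc contains z, and
  this set shrinks as the norm of z grows. The bound on u keeps these lengths finite.\<close>

lemma bell_shaped_antimono:
  assumes bell: "bell_shaped u" and u: "sqi u" and b: "\<And>x. \<bar>u x\<bar> \<le> M" and xy: "norm x \<le> norm y"
  shows "u y \<le> u x"
proof -
  let ?r = "\<lambda>t. sqrt (measure lborel {y. t < \<bar>u y\<bar>} / pi)"
  let ?S = "\<lambda>z. {t. 0 < t \<and> norm z < ?r t}"
  have rt: "?r t = 0" if "t \<ge> M" for t
  proof -
    have "{y. t < \<bar>u y\<bar>} = {}" using b that by (auto simp: not_less intro: order_trans)
    then show ?thesis by simp
  qed
  have meas: "?S z \<in> sets borel" for z :: "real^2"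
  proof (rule down_closed_borel[where a = 0])
    fix s t assume t: "t \<in> ?S z" and s: "0 < s" "s < t"
    have "measure lborel {y. t < \<bar>u y\<bar>} \<le> measure lborel {y. s < \<bar>u y\<bar>}"
      by (rule measure_mono_fmeasurable[OF _ fmeasurableD[OF superlevel_finite[OF u]] superlevel_finite[OF u s(1)]])
        (use s t in auto)
    then have "?r t \<le> ?r s" by (intro real_sqrt_le_mono divide_right_mono) auto
    then have "norm z < ?r s" using t by (auto intro: order_less_le_trans)
    then show "s \<in> ?S z" using s(1) by (simp only: mem_Collect_eq simp_thms)
  qed auto
  have sub: "?S z \<subseteq> {0..M}" for z :: "real^2"
  proof
    fix t assume t: "t \<in> ?S z"
    then have "norm z < ?r t" by (simp only: mem_Collect_eq)
    then have r: "0 < ?r t" by (rule order_le_less_trans[OF norm_ge_zero])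
    have "\<not> t \<ge> M"
    proof
      assume "t \<ge> M"
      then show False using r unfolding rt[OF \<open>t \<ge> M\<close>] by (simp only: less_irrefl)
    qed
    then show "t \<in> {0..M}" using t by auto
  qed
  have e: "schwarz_rearrangement u z = (LINT t|lborel. indicator (?S z) t)" for z
    unfolding schwarz_rearrangement_def set_lebesgue_integral_def schwarz_set_def
    by (intro Bochner_Integration.integral_cong) (auto simp: indicator_def)
  have i: "integrable lborel (indicator (?S z) :: real \<Rightarrow> real)" for z :: "real^2"
  proof (rule Bochner_Integration.integrable_bound)
    show "integrable lborel (indicator {0..M} :: real \<Rightarrow> real)"
      by (rule integrable_real_indicator) (use emeasure_compact_finite[of "{0..M}"] in auto)
    show "AE t in lborel. norm (indicator (?S z) t :: real) \<le> norm (indicator {0..M} t :: real)"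
      by (rule AE_I2) (use sub[of z] in \<open>auto simp: indicator_def\<close>)
  qed (use meas[of z] in \<open>auto intro!: borel_measurable_indicator\<close>)
  have "schwarz_rearrangement u y \<le> schwarz_rearrangement u x"
    unfolding e by (rule integral_mono[OF i i]) (use xy in \<open>auto simp: indicator_def\<close>)
  then show ?thesis using bell by (simp add: bell_shaped_def)
qed

section \<open>Functions with vanishing weak gradient\<close>

lemma locint_translate:
  assumes G: "locint G" shows "locint (\<lambda>x. G (x + a))"
  unfolding locint_def
proof (intro conjI allI)
  note [measurable] = locint_measurable[OF G]
  show "(\<lambda>x. G (x + a)) \<in> borel_measurable borel" by measurable
  fix R
  have m: "(\<lambda>x. indicator (cball 0 R) (x - a) :: real) \<in> borel_measurable borel"
    by (rule measurable_compose[of "\<lambda>x. x - a" borel borel]) (auto intro!: borel_measurable_indicator)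
  have "norm x \<le> R + norm a" if "norm (x - a) \<le> R" for x
    using norm_triangle_ineq2[of x a] that by simp
  then have "integrable lborel (\<lambda>x. G x * indicator (cball 0 R) (x - a))"
    by (intro locint_bounded_support_integrable[OF G m, of 1 "R + norm a"]) (auto simp: indicator_def)
  then have "integrable lborel (\<lambda>x. G (x + a) * indicator (cball 0 R) (x + a - a))"
    by (subst integrable_translate[of "\<lambda>x. G x * indicator (cball 0 R) (x - a)"])
      (use m in \<open>auto intro!: borel_measurable_times\<close>)
  then show "integrable lborel (\<lambda>x. indicator (cball 0 R) x * G (x + a))"
    by (simp add: mult.commute)
qed

text \<open>The correlation of G with \<psi> has vanishing derivative along both axes, hence is
  constant along the two segments that lead from 0 to a.\<close>

lemma weak_gradient_zero_translate:
  assumes G: "locint G" and z: "\<And>i \<psi>. test_function \<psi> \<Longrightarrow> (LINT x|lborel. G x * pd i \<psi> x) = 0"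
    and \<psi>: "test_function \<psi>"
  shows "(LINT x|lborel. G x * \<psi> (x + a)) = (LINT x|lborel. G x * \<psi> x)"
proof -
  have c: "(LINT y|lborel. G y * \<psi> (y + (x + s *\<^sub>R axis i 1))) = (LINT y|lborel. G y * \<psi> (y + x))" for x s i
  proof -
    define g where "g s = (LINT y|lborel. G y * \<psi> (y + (x + s *\<^sub>R axis i 1)))" for s
    have "(g has_real_derivative 0) (at s)" for s
    proof -
      have t: "test_function (\<lambda>y. \<psi> (y + (x + s *\<^sub>R axis i 1)))"
        using test_function_affine[OF \<psi>, of 1] by simp
      have "(LINT y|lborel. G y * pd i \<psi> (y + (x + s *\<^sub>R axis i 1))) = 0"
        using z[OF t, of i] by (simp add: pd_translate test_function_differentiable[OF \<psi>])
      then show ?thesis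
        using has_derivative_integral_translate[OF G test_function_Ck[OF \<psi>] test_function_bsupp[OF \<psi>], of x i s]
        unfolding g_def by simp
    qed
    then have "g s = g 0" by (intro DERIV_isconst_all) blast
    then show ?thesis by (simp add: g_def)
  qed
  have "a = 0 + (a $ 1) *\<^sub>R axis 1 1 + (a $ 2) *\<^sub>R axis 2 1"
    by (simp add: vec_eq_iff forall_2 axis_def)
  then show ?thesis using c[of 0 "a $ 1" 1] c[of "0 + (a $ 1) *\<^sub>R axis 1 1" "a $ 2" 2] by simp
qed

lemma AE_lborel_translate:
  fixes a :: "real^2"
  assumes "{x. P x} \<in> sets borel" "AE x in lborel. P (a + x)"
  shows "AE x in lborel. P x"
proof -
  have "AE x in distr lborel borel ((+) a). P x"
    by (subst AE_distr_iff) (use assms in auto)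
  then show ?thesis unfolding lborel_distr_plus .
qed

text \<open>For each shift a the function is invariant up to a null set, which depends on a.
  Exchanging the quantifiers yields one point x whose value is taken almost everywhere.\<close>

lemma weak_gradient_zero_constant:
  assumes G: "locint G" and z: "\<And>i \<psi>. test_function \<psi> \<Longrightarrow> (LINT x|lborel. G x * pd i \<psi> x) = 0"
  shows "\<exists>c. AE x in lborel. G x = c"
proof -
  note [measurable] = locint_measurable[OF G]
  have inv: "AE x in lborel. G (x + a) = G x" for a
  proof -
    have "AE x in lborel. G (x + a) - G x = 0"
    proof (rule fundamental_lemma)
      have l: "locint (\<lambda>x. G (x + a))" by (rule locint_translate[OF G])
      show "locint (\<lambda>x. G (x + a) - G x)"
        using l G unfolding locint_def right_diff_distrib by auto
      fix \<psi> assume \<psi>: "test_function \<psi>"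
      have t: "test_function (\<lambda>x. \<psi> (x + - a))" using test_function_affine[OF \<psi>, of 1 "- a"] by simp
      note [measurable] = continuous_borel[OF test_function_continuous[OF \<psi>]]
      have "(LINT x|lborel. (G (x + a) - G x) * \<psi> x) = (LINT x|lborel. G (x + a) * \<psi> x) - (LINT x|lborel. G x * \<psi> x)"
        unfolding left_diff_distrib
        by (rule Bochner_Integration.integral_diff;
            intro locint_bsupp_integrable l G test_function_continuous test_function_bsupp \<psi>)
      also have "(LINT x|lborel. G (x + a) * \<psi> x) = (LINT x|lborel. G x * \<psi> (x + - a))"
        using integral_translate[of "\<lambda>x. G x * \<psi> (x + - a)" a] by simp
      also have "\<dots> = (LINT x|lborel. G x * \<psi> x)"
        by (rule weak_gradient_zero_translate[OF G z \<psi>])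
      finally show "(LINT x|lborel. (G (x + a) - G x) * \<psi> x) = 0" by simp
    qed
    then show ?thesis by simp
  qed
  \<comment> \<open>Fubini for null sets of the product measure.\<close>
  have "AE a in lborel. AE x in lborel. G (x + a) = G x" by (rule AE_I2) (rule inv)
  moreover have "{p \<in> space (lborel \<Otimes>\<^sub>M lborel). G (snd p + fst p) = G (snd p)} \<in> sets (lborel \<Otimes>\<^sub>M (lborel :: (real^2) measure))"
    by measurable
  ultimately have "AE x in lborel. AE a in lborel. G (x + a) = G x"
    using lborel_pair.AE_commute[of "\<lambda>a x. G (x + a) = G x"] by simp
  moreover have "ae_filter (lborel :: (real^2) measure) \<noteq> bot"
    by (simp add: ae_filter_eq_bot_iff)
  ultimately obtain x where "AE a in lborel. G (x + a) = G x"
    using eventually_happens' by blast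
  then have "AE y in lborel. G y = G x"
    by (intro AE_lborel_translate[of "\<lambda>y. G y = G x" x]) auto
  then show ?thesis ..
qed

section \<open>Basic properties of the soliton\<close>

lemma classical_laplacian_scale:
  assumes "Ck 2 f"
  shows "classical_laplacian (\<lambda>x. f (c *\<^sub>R x)) x = c\<^sup>2 * classical_laplacian f (c *\<^sub>R x)"
proof -
  have f: "f differentiable (at x)" "pd i f differentiable (at x)" for x i
    using assms by (auto simp: numeral_2_eq_2)
  have a: "pd i (\<lambda>x. f (c *\<^sub>R x)) = (\<lambda>x. c * pd i f (c *\<^sub>R x))" for i
    using pd_affine[of f i c 0] f by simp
  have b: "pd i (\<lambda>x. c * pd i f (c *\<^sub>R x)) = (\<lambda>x. c * (c * pd i (pd i f) (c *\<^sub>R x)))" for i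
  proof -
    have "(\<lambda>x. pd i f (c *\<^sub>R x + 0)) differentiable (at x)" for x
      by (rule differentiableI, rule has_derivative_compose[OF affine_has_derivative has_derivative_frechet[OF f(2)]])
    then show ?thesis
      using pd_cmult[of "\<lambda>x. pd i f (c *\<^sub>R x)" i c] pd_affine[of "pd i f" i c 0] f by simp
  qed
  show ?thesis unfolding laplacian_UNIV_2 a b by (simp add: power2_eq_square algebra_simps)
qed

lemma bpot_compose:
  fixes g :: "real \<Rightarrow> real" and f :: "real^2 \<Rightarrow> real"
  assumes g: "continuous_on UNIV g" and f: "continuous_on UNIV f" "bounded (range f)"
  shows "bpot (\<lambda>x. g (f x))"
  unfolding bpot_def
proof
  show "(\<lambda>x. g (f x)) \<in> borel_measurable borel"
    by (intro continuous_borel continuous_on_compose2[OF g f(1)]) auto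
  have "compact (closure (range f))" using f(2) by simp
  then have "bounded (g ` closure (range f))"
    by (intro compact_imp_bounded compact_continuous_image continuous_on_subset[OF g]) auto
  then show "bounded (range (\<lambda>x. g (f x)))"
    by (rule bounded_subset) (use closure_subset[of "range f"] in blast)
qed

lemma sqi_scale:
  assumes f: "sqi f" and c: "c \<noteq> 0" shows "sqi (\<lambda>x. f (c *\<^sub>R x))"
proof -
  have [measurable]: "f \<in> borel_measurable borel" by (rule sqi_measurable[OF f])
  have "integrable lborel (\<lambda>x. (f (c *\<^sub>R x))\<^sup>2)"
    using integrable_scale[of "\<lambda>x. (f x)\<^sup>2" c] f c by (simp add: sqi_def)
  then show ?thesis by (simp add: sqi_def)
qed

lemma Ck_inverse:
  assumes f: "Ck 1 f" and pos: "\<And>x. f x > 0"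
  shows "Ck 1 (\<lambda>x. inverse (f x))" "pd i (\<lambda>x. inverse (f x)) = (\<lambda>x. - (pd i f x / (f x)\<^sup>2))"
proof -
  have df: "f differentiable (at x)" for x using f by simp
  have d: "(inverse has_real_derivative - (1 / (f x)\<^sup>2)) (at (f x))" for x
  proof -
    have e: "- (inverse (f x) ^ Suc (Suc 0)) = - (1 / (f x)\<^sup>2)"
      by (simp add: power2_eq_square inverse_eq_divide)
    show ?thesis
      unfolding e[symmetric] by (rule DERIV_inverse) (use pos[of x] in simp)
  qed
  have p: "pd i (\<lambda>x. inverse (f x)) = (\<lambda>x. - (pd i f x / (f x)\<^sup>2))" for i
    using pd_compose[of f inverse "\<lambda>t. - (1 / t\<^sup>2)" i, OF df d] by simp
  then show "pd i (\<lambda>x. inverse (f x)) = (\<lambda>x. - (pd i f x / (f x)\<^sup>2))" .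
  have "(\<lambda>x. inverse (f x)) differentiable (at x)" for x
    by (rule differentiableI, rule has_derivative_compose[OF has_derivative_frechet[OF df] d[unfolded has_field_derivative_def]])
  moreover have "continuous_on UNIV (\<lambda>x. - (pd i f x / (f x)\<^sup>2))" for i
  proof -
    have "(f x)\<^sup>2 \<noteq> 0" for x using pos[of x] by simp
    moreover have "continuous_on UNIV (pd i f)" using f by simp
    ultimately show ?thesis
      by (intro continuous_on_minus continuous_on_divide continuous_on_power Ck_continuous[OF f]) auto
  qed
  ultimately show "Ck 1 (\<lambda>x. inverse (f x))" by (simp add: p)
qed

section \<open>Regular trial functions and the Dirichlet energy\<close>

text \<open>The trial functions of the variational argument: they include the test functions and the
  soliton and are closed under sums, multiples and dilations. Boundedness controls the exponential
  nonlinearity.\<close>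

definition reg :: "(real^2 \<Rightarrow> real) \<Rightarrow> bool" where
  "reg u \<longleftrightarrow> Ck 2 u \<and> bounded (range u) \<and> sqi u \<and> sqi (classical_laplacian u)"

lemma regD: "reg u \<Longrightarrow> Ck 2 u" "reg u \<Longrightarrow> bounded (range u)" "reg u \<Longrightarrow> sqi u"
    "reg u \<Longrightarrow> sqi (classical_laplacian u)"
  by (simp_all add: reg_def)

lemma reg_bound: "reg u \<Longrightarrow> \<exists>M\<ge>0. \<forall>x. \<bar>u x\<bar> \<le> M"
  by (rule bpot_bound) (simp add: bpot_def regD sqi_measurable)

lemma reg_add:
  assumes "reg u" "reg v" shows "reg (\<lambda>x. u x + v x)"
proof -
  obtain M where M: "\<And>x. \<bar>u x\<bar> \<le> M" using reg_bound[OF assms(1)] by blast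
  obtain N where N: "\<And>x. \<bar>v x\<bar> \<le> N" using reg_bound[OF assms(2)] by blast
  have "\<bar>u x + v x\<bar> \<le> M + N" for x
    using abs_triangle_ineq[of "u x" "v x"] M[of x] N[of x] by linarith
  then have "\<forall>y\<in>range (\<lambda>x. u x + v x). norm y \<le> M + N" by simp
  then have "bounded (range (\<lambda>x. u x + v x))" unfolding bounded_iff by blast
  then show ?thesis
    using assms by (simp add: reg_def Ck_add sqi_add laplacian_add)
qed

lemma reg_cmult:
  assumes "reg u" shows "reg (\<lambda>x. c * u x)"
proof -
  have "bounded (range (\<lambda>x. c * u x))"
    using bounded_scaling[OF regD(2)[OF assms], of c] by (simp add: image_image)
  then show ?thesis
    using assms by (simp add: reg_def Ck_cmult sqi_cmult laplacian_cmult)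
qed

lemma reg_test: "test_function \<psi> \<Longrightarrow> reg \<psi>"
proof -
  assume \<psi>: "test_function \<psi>"
  obtain M R where M: "M \<ge> 0" "\<And>x. \<bar>\<psi> x\<bar> \<le> M * indicator (cball 0 R) x"
    using continuous_bsupp_bound[OF test_function_continuous[OF \<psi>] test_function_bsupp[OF \<psi>]] by metis
  have "\<bar>\<psi> x\<bar> \<le> M" for x
    using M(2)[of x] M(1) by (cases "x \<in> cball 0 R") auto
  then have "bounded (range \<psi>)" unfolding bounded_iff by auto
  then show ?thesis
    by (simp add: reg_def test_function_Ck \<psi> test_function_sqi test_function_laplacian)
qed

lemma reg_scale:
  assumes u: "reg u" and c: "c \<noteq> 0" shows "reg (\<lambda>x. u (c *\<^sub>R x))"
proof -
  have "bounded (range (\<lambda>x. u (c *\<^sub>R x)))"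
    by (rule bounded_subset[OF regD(2)[OF u]]) auto
  moreover have "Ck 2 (\<lambda>x. u (c *\<^sub>R x))"
    using Ck_affine[OF regD(1)[OF u], of c 0] by simp
  ultimately show ?thesis
    unfolding reg_def classical_laplacian_scale[OF regD(1)[OF u], of c, abs_def]
    using sqi_scale[OF regD(3)[OF u] c] sqi_cmult[OF sqi_scale[OF regD(4)[OF u] c]] by simp
qed

lemma reg_weak_laplacian: "reg u \<Longrightarrow> weak_laplacian (to_L2 u) (to_L2 (classical_laplacian u))"
  by (intro weak_laplacian_to_L2 regD)

text \<open>The Dirichlet integral after one integration by parts, in which no gradient
  appears.\<close>

definition energy :: "(real^2 \<Rightarrow> real) \<Rightarrow> real" where
  "energy u = - (LINT x|lborel. u x * classical_laplacian u x)"

lemma energy_eq_grad_norm: "reg u \<Longrightarrow> energy u = (grad_norm (to_L2 u))\<^sup>2"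
  unfolding grad_norm_sq[OF reg_weak_laplacian] energy_def
  by (subst inner_commute) (simp add: inner_to_L2 regD)

lemma energy_cmult: "reg u \<Longrightarrow> energy (\<lambda>x. c * u x) = c\<^sup>2 * energy u"
proof -
  assume "reg u"
  then have "energy (\<lambda>x. c * u x) = - (LINT x|lborel. c\<^sup>2 * (u x * classical_laplacian u x))"
    unfolding energy_def laplacian_cmult[OF regD(1)[OF \<open>reg u\<close>]] by (simp add: power2_eq_square mult_ac)
  then show ?thesis by (simp add: energy_def)
qed

text \<open>In dimension two the factor c^2 from the Laplacian cancels the Jacobian. Minimality of Q
  therefore carries over to \<phi> without a change of the energy.\<close>

lemma energy_scale:
  assumes u: "reg u" and c: "c \<noteq> 0" shows "energy (\<lambda>x. u (c *\<^sub>R x)) = energy u"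
proof -
  note [measurable] = sqi_measurable[OF regD(3)[OF u]] sqi_measurable[OF regD(4)[OF u]]
  have "energy (\<lambda>x. u (c *\<^sub>R x)) = - (LINT x|lborel. c\<^sup>2 * (u (c *\<^sub>R x) * classical_laplacian u (c *\<^sub>R x)))"
    unfolding energy_def classical_laplacian_scale[OF regD(1)[OF u]] by (simp add: mult_ac)
  also have "\<dots> = energy u"
    using integral_scale[of "\<lambda>x. u x * classical_laplacian u x" c] c by (simp add: energy_def)
  finally show ?thesis .
qed

lemma energy_add:
  assumes u: "reg u" and v: "reg v"
  shows "energy (\<lambda>x. u x + v x) = energy u - 2 * (LINT x|lborel. v x * classical_laplacian u x) + energy v"
proof -
  have s: "(LINT x|lborel. u x * classical_laplacian v x) = (LINT x|lborel. v x * classical_laplacian u x)"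
    using weak_laplacian_symmetric[OF reg_weak_laplacian[OF v] reg_weak_laplacian[OF u]]
    by (simp add: cinner_to_L2 regD u v mult.commute)
  have i: "integrable lborel (\<lambda>x. a x * b x)" if "sqi a" "sqi b" for a b
    using sqi_integrable_mult[OF that] .
  have "energy (\<lambda>x. u x + v x) = - (LINT x|lborel. (u x * classical_laplacian u x + v x * classical_laplacian u x)
      + (u x * classical_laplacian v x + v x * classical_laplacian v x))"
    unfolding energy_def laplacian_add[OF regD(1)[OF u] regD(1)[OF v]] by (simp add: algebra_simps)
  also have "\<dots> = - ((LINT x|lborel. u x * classical_laplacian u x) + (LINT x|lborel. v x * classical_laplacian u x)
      + ((LINT x|lborel. u x * classical_laplacian v x) + (LINT x|lborel. v x * classical_laplacian v x)))"
    using i regD(3,4)[OF u] regD(3,4)[OF v] by simp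
  finally show ?thesis unfolding s by (simp add: energy_def)
qed

lemma inner_schrodinger_to_L2c:
  assumes V: "bpot V" and a: "reg a" and b: "reg b"
  shows "inner (schrodinger \<omega> V (to_L2c a b)) (to_L2c a b) = qform \<omega> V a + qform \<omega> V b"
proof -
  have e: "schrodinger \<omega> V (to_L2 f) = to_L2 (\<lambda>x. \<omega> * f x - classical_laplacian f x - V x * f x)" if "reg f" for f
    unfolding schrodinger_eq[OF reg_weak_laplacian[OF that]] using regD(3,4)[OF that]
    by (simp add: mult_op_to_L2[OF V] to_L2_scaleR to_L2_minus to_L2_add to_L2_diff sqi_minus sqi_add sqi_diff sqi_cmult sqi_mult_bpot[OF V])
  have sq: "sqi (\<lambda>x. \<omega> * f x - classical_laplacian f x - V x * f x)" if "reg f" for f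
    by (intro sqi_diff sqi_cmult sqi_mult_bpot[OF V] regD that)
  have sob: "to_L2 f \<in> sobolev 2" if "reg f" for f
    by (rule weak_laplacian_sobolev_2[OF reg_weak_laplacian[OF that]])
  have "schrodinger \<omega> V (to_L2c a b) = schrodinger \<omega> V (to_L2 a) + cscale \<i> (schrodinger \<omega> V (to_L2 b))"
    unfolding to_L2c_def
    by (simp add: schrodinger_add[OF V] schrodinger_cscale[OF V] sob a b
        cL2.subspace_scale[OF sobolev_2_subspace])
  then have "inner (schrodinger \<omega> V (to_L2c a b)) (to_L2c a b) =
      inner (schrodinger \<omega> V (to_L2 a)) (to_L2 a) + inner (schrodinger \<omega> V (to_L2 b)) (to_L2 b)"
    unfolding to_L2c_def e[OF a] e[OF b]
    by (simp add: inner_add_left inner_add_right inner_to_L2_i inner_cscale_i sq regD a b)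
  then show ?thesis
    by (simp add: inner_schrodinger_to_L2[OF V] regD a b)
qed

section \<open>Positivity, regularity and equation of the soliton\<close>

locale soliton =
  fixes \<omega> \<mu> :: real and Q \<phi> :: "real^2 \<Rightarrow> real"
  assumes \<omega>: "\<omega> > 0" and \<mu>: "\<mu> \<in> {0, 1}" and profile: "ruf_sani_profile \<omega> \<mu> Q"
    and \<phi>_eq: "\<phi> = (\<lambda>x. Q (sqrt \<omega> *\<^sub>R x))"
begin

lemma Q_C2: "Ck 2 Q" and Q_bounded: "bounded (range Q)" and Q_bell: "bell_shaped Q"
  and Q_sqi: "sqi Q" and Q_admissible: "admissible \<omega> \<mu> (to_L2 Q)"
  and Q_minimal: "\<And>u. admissible \<omega> \<mu> u \<Longrightarrow> grad_norm (to_L2 Q) \<le> grad_norm u"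
  and Q_pde: "\<And>x. - classical_laplacian Q x + Q x = 1 / \<omega> * f_nl \<mu> (Q x)"
  and Q_grad: "0 < grad_norm (to_L2 Q)"
  using profile unfolding ruf_sani_profile_def sq_integrable_of_real by blast+

lemma Q_bound: "\<exists>M. \<forall>x. \<bar>Q x\<bar> \<le> M"
  using Q_bounded unfolding bounded_iff by auto

lemma Q_continuous: "continuous_on UNIV Q"
  by (rule Ck_continuous[OF Q_C2])

lemma Q_laplacian: "classical_laplacian Q x = Q x - V_minus \<mu> (Q x) * Q x / \<omega>"
  using Q_pde[of x] \<omega> by (simp add: f_nl_eq field_simps)

lemma Q_nonzero: "to_L2 Q \<noteq> 0"
  using Q_admissible by (simp add: admissible_def)

text \<open>If \<open>Q\<close> vanished somewhere, monotonicity would give it compact support; testing the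
  equation with \<open>e = exp(x1)\<close>, which satisfies \<open>e = \<Delta> e\<close>, then forces \<open>f(Q) = 0\<close>.\<close>

lemma Q_pos: "Q x > 0"
proof (rule ccontr)
  assume n: "\<not> Q x > 0"
  have Q0: "0 \<le> Q y" for y by (rule bell_shaped_nonneg[OF Q_bell])
  obtain M where M: "\<And>y. \<bar>Q y\<bar> \<le> M" using Q_bound by blast
  have out: "Q y = 0" if "norm x \<le> norm y" for y
    using bell_shaped_antimono[OF Q_bell Q_sqi M that] n Q0[of y] by simp
  have "{y. Q y \<noteq> 0} \<subseteq> cball 0 (norm x)"
  proof
    fix y assume "y \<in> {y. Q y \<noteq> 0}"
    then show "y \<in> cball 0 (norm x)" using out[of y] by (cases "norm x \<le> norm y") auto
  qed
  then have b: "bsupp Q" by (rule bounded_subset[OF bounded_cball])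
  define e where "e y = exp (y $ 1)" for y :: "real^2"
  have e_smooth: "Ck k e" for k
    unfolding e_def[abs_def] by (intro Ck_exp Ck_nth)
  have dn: "(\<lambda>y::real^2. y $ j) differentiable (at y)" for j y
    by (rule differentiableI[OF has_derivative_nth])
  have pe: "pd i e = (\<lambda>y. e y * (if i = 1 then 1 else 0))" for i
    unfolding e_def[abs_def] using pd_compose[of "\<lambda>y. y $ 1" exp exp i] dn by (simp add: pd_nth)
  have de: "e differentiable (at y)" for y using e_smooth[of 1] by simp
  have le: "classical_laplacian e y = e y" for y
    unfolding laplacian_UNIV_2 pe by (simp add: pe pd_const)
  have c: "continuous_on UNIV (\<lambda>y. V_minus \<mu> (Q y) * Q y)"
    by (intro continuous_on_mult continuous_on_compose2[OF continuous_V_minus[of UNIV] Q_continuous] Q_continuous) auto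
  have ce: "continuous_on UNIV e" by (rule Ck_continuous[OF e_smooth])
  have bf: "bsupp (\<lambda>y. V_minus \<mu> (Q y) * Q y)" by (rule bsupp_mult_right[OF b])
  have i1: "integrable lborel (\<lambda>y. Q y * e y)"
    by (rule continuous_bsupp_integrable[OF continuous_on_mult[OF Q_continuous ce] bsupp_mult_left[OF b]])
  have i2: "integrable lborel (\<lambda>y. V_minus \<mu> (Q y) * Q y * e y)"
    by (rule continuous_bsupp_integrable[OF continuous_on_mult[OF c ce] bsupp_mult_left[OF bf]])
  have "(LINT y|lborel. Q y * e y) = (LINT y|lborel. classical_laplacian Q y * e y)"
    using integral_laplacian_by_parts[OF Q_C2 e_smooth] b unfolding le by blast
  also have "\<dots> = (LINT y|lborel. Q y * e y - V_minus \<mu> (Q y) * Q y * e y / \<omega>)"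
    by (simp add: Q_laplacian algebra_simps)
  also have "\<dots> = (LINT y|lborel. Q y * e y) - (LINT y|lborel. V_minus \<mu> (Q y) * Q y * e y) / \<omega>"
    using i1 i2 by simp
  finally have "(LINT y|lborel. V_minus \<mu> (Q y) * Q y * e y) = 0" using \<omega> by simp
  moreover have "0 \<le> V_minus \<mu> (Q y) * Q y * e y" for y
    unfolding e_def by (intro mult_nonneg_nonneg V_minus_nonneg[OF \<mu>] Q0) simp
  ultimately have "AE y in lborel. V_minus \<mu> (Q y) * Q y * e y = 0"
    using integral_nonneg_eq_0_iff_AE[OF i2] by simp
  then have "AE y in lborel. Q y = 0"
  proof eventually_elim
    case (elim y)
    then have "V_minus \<mu> (Q y) * Q y = 0" by (simp add: e_def)
    then show ?case using V_minus_pos[OF \<mu>, of "Q y"] by (cases "Q y = 0") simp_all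
  qed
  then show False using Q_nonzero to_L2_eq_0_iff[OF Q_sqi] by simp
qed

lemma \<phi>_pos: "\<phi> x > 0"
  by (simp add: \<phi>_eq Q_pos)

lemma \<phi>_C2: "Ck 2 \<phi>"
  using Ck_affine[OF Q_C2, of "sqrt \<omega>" 0] by (simp add: \<phi>_eq)

lemma \<phi>_C1: "Ck 1 \<phi>"
  using Ck_mono[OF \<phi>_C2, of 1] by simp

lemma \<phi>_continuous: "continuous_on UNIV \<phi>"
  by (rule Ck_continuous[OF \<phi>_C2])

lemma \<phi>_bounded: "bounded (range \<phi>)"
  by (rule bounded_subset[OF Q_bounded]) (auto simp: \<phi>_eq)

lemma \<phi>_sqi: "sqi \<phi>"
  using sqi_scale[OF Q_sqi, of "sqrt \<omega>"] \<omega> by (simp add: \<phi>_eq)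

lemma \<phi>_laplacian: "classical_laplacian \<phi> = (\<lambda>x. (\<omega> - V_minus \<mu> (\<phi> x)) * \<phi> x)"
proof
  fix x
  have "classical_laplacian \<phi> x = \<omega> * classical_laplacian Q (sqrt \<omega> *\<^sub>R x)"
    using classical_laplacian_scale[OF Q_C2, of "sqrt \<omega>" x] \<omega> by (simp add: \<phi>_eq)
  also have "\<dots> = (\<omega> - V_minus \<mu> (\<phi> x)) * \<phi> x"
    unfolding Q_laplacian \<phi>_eq using \<omega> by (simp add: field_simps)
  finally show "classical_laplacian \<phi> x = (\<omega> - V_minus \<mu> (\<phi> x)) * \<phi> x" .
qed

lemma bpot_minus: "bpot (\<lambda>x. V_minus \<mu> (\<phi> x))"
  by (rule bpot_compose[OF continuous_V_minus \<phi>_continuous \<phi>_bounded])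

lemma bpot_plus: "bpot (\<lambda>x. V_plus \<mu> (\<phi> x))"
  by (rule bpot_compose[OF continuous_V_plus \<phi>_continuous \<phi>_bounded])

lemma L_minus_eq: "L_minus \<omega> \<mu> \<phi> = schrodinger \<omega> (\<lambda>x. V_minus \<mu> (\<phi> x))"
  by (simp add: L_minus_def V_minus_def)

lemma L_plus_eq: "L_plus \<omega> \<mu> \<phi> = schrodinger \<omega> (\<lambda>x. V_plus \<mu> (\<phi> x))"
  by (simp add: L_plus_def V_plus_def)

lemma \<phi>_laplacian_sqi: "sqi (classical_laplacian \<phi>)"
proof -
  have "sqi (\<lambda>x. \<omega> * \<phi> x - V_minus \<mu> (\<phi> x) * \<phi> x)"
    by (intro sqi_diff sqi_cmult sqi_mult_bpot[OF bpot_minus] \<phi>_sqi)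
  then show ?thesis by (simp add: \<phi>_laplacian left_diff_distrib)
qed

lemma \<phi>_weak_laplacian: "weak_laplacian (to_L2 \<phi>) (to_L2 (classical_laplacian \<phi>))"
  by (rule weak_laplacian_to_L2[OF \<phi>_C2 \<phi>_sqi \<phi>_laplacian_sqi])

lemma \<phi>_sobolev: "to_L2 \<phi> \<in> sobolev 2"
  by (rule weak_laplacian_sobolev_2[OF \<phi>_weak_laplacian])

lemma \<phi>_nonzero: "to_L2 \<phi> \<noteq> 0"
proof
  assume "to_L2 \<phi> = 0"
  then have "AE x in lborel. \<phi> x = 0" using to_L2_eq_0_iff[OF \<phi>_sqi] by simp
  then have "AE x in (lborel :: (real^2) measure). False"
    by eventually_elim (metis \<phi>_pos less_irrefl)
  then show False
    using ae_filter_eq_bot_iff[of "lborel :: (real^2) measure"] by (simp add: trivial_limit_def)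
qed

section \<open>The operator L-minus\<close>

definition gs :: "2 \<Rightarrow> (real^2 \<Rightarrow> real) \<Rightarrow> real^2 \<Rightarrow> real" where
  "gs i u x = pd i u x - u x * pd i \<phi> x / \<phi> x"

lemma pd_\<phi>_C1: "Ck 1 (pd i \<phi>)"
  using \<phi>_C2 by (simp add: numeral_2_eq_2)

lemma \<phi>_neq: "\<phi> x \<noteq> 0"
  using \<phi>_pos[of x] by simp

lemma gs_continuous:
  assumes "test_function u" shows "continuous_on UNIV (gs i u)"
  unfolding gs_def[abs_def]
  by (intro continuous_on_diff continuous_on_divide continuous_on_mult test_function_continuous[OF assms]
      test_function_continuous[OF test_function_pd[OF assms]] Ck_continuous[OF pd_\<phi>_C1] \<phi>_continuous ballI \<phi>_neq)

lemma gs_bsupp: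
  assumes "test_function u" shows "bsupp (gs i u)"
proof -
  have "{x. gs i u x \<noteq> 0} \<subseteq> {x. pd i u x \<noteq> 0} \<union> {x. u x \<noteq> 0}"
    by (auto simp: gs_def)
  moreover have "bounded ({x. pd i u x \<noteq> 0} \<union> {x. u x \<noteq> 0})"
    unfolding bounded_Un using test_function_bsupp[OF test_function_pd[OF assms]] test_function_bsupp[OF assms] ..
  ultimately show ?thesis by (rule bounded_subset[rotated])
qed

lemma gs_sqi: "test_function u \<Longrightarrow> sqi (gs i u)"
  by (rule continuous_bsupp_sqi[OF gs_continuous gs_bsupp])

text \<open>Picone's identity: the square equals (\<partial>u)^2 - \<partial>\<phi> \<partial>(u^2 /
  \<phi>) pointwise, and the last product is integrated by parts. Since u has compact support and
  \<phi> is positive, u^2 / \<phi> is harmless.\<close>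

lemma gs_square:
  assumes u: "test_function u"
  shows "(LINT x|lborel. (gs i u x)\<^sup>2) =
    (LINT x|lborel. pd i u x * pd i u x) + (LINT x|lborel. pd i (pd i \<phi>) x * ((u x)\<^sup>2 * inverse (\<phi> x)))"
proof -
  let ?w = "\<lambda>x. (u x * u x) * inverse (\<phi> x)"
  have du: "u differentiable (at x)" for x by (rule test_function_differentiable[OF u])
  have u1: "Ck 1 u" by (rule test_function_Ck[OF u])
  have w: "Ck 1 ?w" by (intro Ck_mult u1 Ck_inverse(1)[OF \<phi>_C1 \<phi>_pos])
  have bw: "bsupp ?w" by (intro bsupp_mult_left test_function_bsupp u)
  have dinv: "(\<lambda>x. inverse (\<phi> x)) differentiable (at x)" for x
    using Ck_inverse(1)[OF \<phi>_C1 \<phi>_pos] by simp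
  have pw: "pd i ?w = (\<lambda>x. 2 * u x * pd i u x * inverse (\<phi> x) - (u x)\<^sup>2 * (pd i \<phi> x / (\<phi> x)\<^sup>2))"
  proof -
    have "pd i ?w = (\<lambda>x. pd i (\<lambda>x. u x * u x) x * inverse (\<phi> x) + (u x * u x) * pd i (\<lambda>x. inverse (\<phi> x)) x)"
      by (rule pd_mult) (auto intro: differentiable_mult du dinv)
    then show ?thesis
      by (simp add: pd_mult[OF du du] Ck_inverse(2)[OF \<phi>_C1 \<phi>_pos] power2_eq_square algebra_simps)
  qed
  have ibp: "(LINT x|lborel. pd i (pd i \<phi>) x * ?w x) = - (LINT x|lborel. pd i \<phi> x * pd i ?w x)"
    by (rule integral_by_parts[OF pd_\<phi>_C1 w]) (use bw in blast)
  have i1: "integrable lborel (\<lambda>x. pd i u x * pd i u x)"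
    by (intro test_integrable_mult test_function_pd u)
  have i2: "integrable lborel (\<lambda>x. pd i \<phi> x * pd i ?w x)"
    by (rule continuous_bsupp_integrable[OF continuous_on_mult[OF Ck_continuous[OF pd_\<phi>_C1]] bsupp_mult_right[OF bsupp_pd[OF bw]]])
      (use w in simp)
  have "(gs i u x)\<^sup>2 = pd i u x * pd i u x - pd i \<phi> x * pd i ?w x" for x
    unfolding pw gs_def using \<phi>_neq[of x] by (simp add: power2_eq_square field_simps)
  then have "(LINT x|lborel. (gs i u x)\<^sup>2) = (LINT x|lborel. pd i u x * pd i u x - pd i \<phi> x * pd i ?w x)"
    by (simp only:)
  also have "\<dots> = (LINT x|lborel. pd i u x * pd i u x) + (LINT x|lborel. pd i (pd i \<phi>) x * ?w x)"
    unfolding ibp using i1 i2 by simp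
  finally show ?thesis by (simp add: power2_eq_square)
qed

text \<open>By the equation of \<phi>, (\<omega> - V) u^2 equals \<Delta>\<phi> u^2 / \<phi>, which
  is the sum of the second-order terms left over by Picone's identity.\<close>

lemma qform_minus:
  assumes u: "test_function u"
  shows "qform \<omega> (\<lambda>x. V_minus \<mu> (\<phi> x)) u = (\<Sum>i\<in>UNIV. LINT x|lborel. (gs i u x)\<^sup>2)"
proof -
  have c: "continuous_on UNIV (\<lambda>x. (u x)\<^sup>2 * inverse (\<phi> x))"
    by (intro continuous_on_mult continuous_on_power continuous_on_inverse test_function_continuous[OF u] \<phi>_continuous ballI \<phi>_neq)
  have b: "bsupp (\<lambda>x. (u x)\<^sup>2 * inverse (\<phi> x))"
    by (rule bounded_subset[OF test_function_bsupp[OF u]]) auto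
  have i: "integrable lborel (\<lambda>x. pd i (pd i \<phi>) x * ((u x)\<^sup>2 * inverse (\<phi> x)))" for i
    by (rule continuous_bsupp_integrable[OF continuous_on_mult[OF Ck_1_pd_continuous[of 0] c] bsupp_mult_right[OF b]])
      (use pd_\<phi>_C1 in simp)
  have "(LINT x|lborel. (\<omega> - V_minus \<mu> (\<phi> x)) * (u x)\<^sup>2) =
      (LINT x|lborel. classical_laplacian \<phi> x * ((u x)\<^sup>2 * inverse (\<phi> x)))"
    by (rule Bochner_Integration.integral_cong[OF refl])
      (use \<phi>_neq in \<open>simp add: \<phi>_laplacian field_simps\<close>)
  also have "\<dots> = (\<Sum>i\<in>UNIV. LINT x|lborel. pd i (pd i \<phi>) x * ((u x)\<^sup>2 * inverse (\<phi> x)))"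
    unfolding sum_2 laplacian_UNIV_2 distrib_right by (rule Bochner_Integration.integral_add[OF i i])
  finally show ?thesis
    unfolding qform_def gs_square[OF u] sum.distrib
    using test_gradient_energy[OF u] by (simp add: mult.commute)
qed

lemma qform_minus_nonneg: "test_function u \<Longrightarrow> 0 \<le> qform \<omega> (\<lambda>x. V_minus \<mu> (\<phi> x)) u"
  unfolding qform_minus by (intro sum_nonneg Bochner_Integration.integral_nonneg) auto

lemma L_minus_form_nonneg:
  assumes u: "u \<in> sobolev 2"
  shows "0 \<le> inner (L_minus \<omega> \<mu> \<phi> u) u"
proof -
  obtain a b where ab: "\<And>n. testc (a n) (b n)" "(\<lambda>n. to_L2c (a n) (b n)) \<longlonglongrightarrow> u"
    "(\<lambda>n. L_minus \<omega> \<mu> \<phi> (to_L2c (a n) (b n))) \<longlonglongrightarrow> L_minus \<omega> \<mu> \<phi> u"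
    unfolding L_minus_eq using schrodinger_approx[OF bpot_minus u, of \<omega>] by blast
  have "(\<lambda>n. inner (L_minus \<omega> \<mu> \<phi> (to_L2c (a n) (b n))) (to_L2c (a n) (b n))) \<longlonglongrightarrow> inner (L_minus \<omega> \<mu> \<phi> u) u"
    by (intro tendsto_inner ab)
  moreover have "0 \<le> inner (L_minus \<omega> \<mu> \<phi> (to_L2c (a n) (b n))) (to_L2c (a n) (b n))" for n
    using ab(1)[of n] inner_schrodinger_to_L2c[OF bpot_minus reg_test reg_test] qform_minus_nonneg
    unfolding L_minus_eq testc_def by simp
  ultimately show ?thesis by (intro LIMSEQ_le_const) auto
qed

lemma nonneg_L_minus: "nonneg_operator (sobolev 2) (L_minus \<omega> \<mu> \<phi>)"
  unfolding nonneg_operator_def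
proof (intro ballI conjI)
  fix u assume u: "u \<in> sobolev 2"
  have "cinner (L_minus \<omega> \<mu> \<phi> u) u = cnj (cinner (L_minus \<omega> \<mu> \<phi> u) u)"
    using schrodinger_symmetric[OF bpot_minus u u, of \<omega>] cinner_commute[of u "L_minus \<omega> \<mu> \<phi> u"]
    unfolding L_minus_eq by simp
  then show "cinner (L_minus \<omega> \<mu> \<phi> u) u \<in> \<real>" by (metis Reals_cnj_iff)
  show "0 \<le> Re (cinner (L_minus \<omega> \<mu> \<phi> u) u)"
    unfolding Re_cinner by (rule L_minus_form_nonneg[OF u])
qed

lemma \<phi>_in_kernel: "L_minus \<omega> \<mu> \<phi> (to_L2 \<phi>) = 0"
proof -
  have "L_minus \<omega> \<mu> \<phi> (to_L2 \<phi>) = - to_L2 (classical_laplacian \<phi>) + \<omega> *\<^sub>R to_L2 \<phi> - to_L2 (\<lambda>x. V_minus \<mu> (\<phi> x) * \<phi> x)"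
    unfolding L_minus_eq schrodinger_eq[OF \<phi>_weak_laplacian] mult_op_to_L2[OF bpot_minus \<phi>_sqi] ..
  also have "to_L2 (classical_laplacian \<phi>) = \<omega> *\<^sub>R to_L2 \<phi> - to_L2 (\<lambda>x. V_minus \<mu> (\<phi> x) * \<phi> x)"
    unfolding \<phi>_laplacian left_diff_distrib
    by (simp add: to_L2_scaleR to_L2_diff \<phi>_sqi sqi_cmult sqi_mult_bpot[OF bpot_minus])
  finally show ?thesis by simp
qed

text \<open>Since \<open>gs i u\<close> / \<phi> is the derivative of u / \<phi>, this is
  integration by parts for u / \<phi> against \<psi>.\<close>

lemma gs_by_parts:
  assumes u: "test_function u" and \<psi>: "test_function \<psi>"
  shows "(LINT x|lborel. u x * (pd i \<psi> x / \<phi> x)) = - (LINT x|lborel. gs i u x * (\<psi> x / \<phi> x))"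
proof -
  let ?w = "\<lambda>x. \<psi> x * inverse (\<phi> x)"
  have d\<psi>: "\<psi> differentiable (at x)" for x by (rule test_function_differentiable[OF \<psi>])
  have dinv: "(\<lambda>x. inverse (\<phi> x)) differentiable (at x)" for x
    using Ck_inverse(1)[OF \<phi>_C1 \<phi>_pos] by simp
  have w: "Ck 1 ?w" by (intro Ck_mult test_function_Ck \<psi> Ck_inverse(1)[OF \<phi>_C1 \<phi>_pos])
  have pw: "pd i ?w = (\<lambda>x. pd i \<psi> x / \<phi> x - \<psi> x * pd i \<phi> x / (\<phi> x)\<^sup>2)"
    by (simp add: pd_mult[OF d\<psi> dinv] Ck_inverse(2)[OF \<phi>_C1 \<phi>_pos] divide_inverse mult.assoc)
  have c: "continuous_on UNIV (\<lambda>x. u x * (pd i \<psi> x / \<phi> x))" "continuous_on UNIV (\<lambda>x. gs i u x * (\<psi> x / \<phi> x))"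
    by (intro continuous_on_mult continuous_on_divide gs_continuous[OF u] test_function_continuous[OF u] test_function_continuous[OF \<psi>]
        test_function_continuous[OF test_function_pd[OF \<psi>]] \<phi>_continuous ballI \<phi>_neq)+
  have i: "integrable lborel (\<lambda>x. u x * (pd i \<psi> x / \<phi> x))" "integrable lborel (\<lambda>x. gs i u x * (\<psi> x / \<phi> x))"
    by (rule continuous_bsupp_integrable[OF c(1) bsupp_mult_left[OF test_function_bsupp[OF u]]],
        rule continuous_bsupp_integrable[OF c(2) bsupp_mult_left[OF gs_bsupp[OF u]]])
  have cu: "continuous_on UNIV (\<lambda>x. pd i u x * ?w x)"
    by (rule continuous_on_mult[OF test_function_continuous[OF test_function_pd[OF u]] Ck_continuous[OF w]])
  have "(LINT x|lborel. pd i u x * ?w x) = - (LINT x|lborel. u x * pd i ?w x)"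
    by (rule integral_by_parts[OF test_function_Ck[OF u] w]) (use test_function_bsupp[OF u] in blast)
  moreover have i1: "integrable lborel (\<lambda>x. pd i u x * ?w x)"
    by (rule continuous_bsupp_integrable[OF cu bsupp_mult_left[OF test_function_bsupp[OF test_function_pd[OF u]]]])
  moreover have i2: "integrable lborel (\<lambda>x. u x * pd i ?w x)"
    by (rule continuous_bsupp_integrable[OF continuous_on_mult[OF test_function_continuous[OF u]] bsupp_mult_left[OF test_function_bsupp[OF u]]])
      (use w in simp)
  ultimately have "(LINT x|lborel. pd i u x * ?w x + u x * pd i ?w x) = 0" by simp
  moreover have "pd i u x * ?w x + u x * pd i ?w x = u x * (pd i \<psi> x / \<phi> x) + gs i u x * (\<psi> x / \<phi> x)" for x
    unfolding pw gs_def using \<phi>_neq[of x] by (simp add: field_simps power2_eq_square)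
  ultimately have "(LINT x|lborel. u x * (pd i \<psi> x / \<phi> x) + gs i u x * (\<psi> x / \<phi> x)) = 0"
    by simp
  then show ?thesis using i by simp
qed

text \<open>Along approximating test functions the form tends to <L u, u> = 0, so \<open>gs\<close>
  tends to zero in norm. Paired with the fixed square-integrable function \<psi> / \<phi>, this
  shows that u / \<phi> has vanishing weak derivatives.\<close>

lemma kernel_L_minus_weak_gradient:
  assumes u: "u \<in> sobolev 2" "L_minus \<omega> \<mu> \<phi> u = 0" and \<psi>: "test_function \<psi>"
  shows "cinner u (to_L2 (\<lambda>x. pd i \<psi> x / \<phi> x)) = 0"
proof -
  have t: "sqi (\<lambda>x. f x / \<phi> x)" if "test_function f" for f
  proof (rule continuous_bsupp_sqi)
    show "continuous_on UNIV (\<lambda>x. f x / \<phi> x)"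
      by (intro continuous_on_divide test_function_continuous[OF that] \<phi>_continuous ballI \<phi>_neq)
    show "bsupp (\<lambda>x. f x / \<phi> x)"
      by (rule bounded_subset[OF test_function_bsupp[OF that]]) auto
  qed
  obtain a b where ab: "\<And>n. testc (a n) (b n)" "(\<lambda>n. to_L2c (a n) (b n)) \<longlonglongrightarrow> u"
    "(\<lambda>n. L_minus \<omega> \<mu> \<phi> (to_L2c (a n) (b n))) \<longlonglongrightarrow> L_minus \<omega> \<mu> \<phi> u"
    unfolding L_minus_eq using schrodinger_approx[OF bpot_minus u(1), of \<omega>] by blast
  have ta: "test_function (a n)" "test_function (b n)" for n using ab(1)[of n] by (auto simp: testc_def)
  let ?q = "qform \<omega> (\<lambda>x. V_minus \<mu> (\<phi> x))"
  have "(\<lambda>n. inner (L_minus \<omega> \<mu> \<phi> (to_L2c (a n) (b n))) (to_L2c (a n) (b n))) \<longlonglongrightarrow> inner 0 u"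
    using ab(3) u(2) by (intro tendsto_inner ab(2)) simp
  then have q0: "(\<lambda>n. ?q (a n) + ?q (b n)) \<longlonglongrightarrow> 0"
    unfolding L_minus_eq inner_schrodinger_to_L2c[OF bpot_minus reg_test[OF ta(1)] reg_test[OF ta(2)]] by simp
  \<comment> \<open>Stated for any sequence whose form is dominated by the total, so that it serves
    the real and the imaginary parts alike: both forms are nonnegative, hence each is at most their
    sum.\<close>
  have lim: "(\<lambda>n. LINT x|lborel. f n x * (pd i \<psi> x / \<phi> x)) \<longlonglongrightarrow> 0"
    if f: "\<And>n. test_function (f n)" "\<And>n. ?q (f n) \<le> ?q (a n) + ?q (b n)" for f
  proof -
    have n0: "(\<lambda>n. (norm (to_L2 (gs i (f n))))\<^sup>2) \<longlonglongrightarrow> 0"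
    proof (rule tendsto_sandwich[OF _ _ tendsto_const q0]; intro always_eventually allI)
      fix n
      show "0 \<le> (norm (to_L2 (gs i (f n))))\<^sup>2" by simp
      have "(norm (to_L2 (gs i (f n))))\<^sup>2 = (LINT x|lborel. (gs i (f n) x)\<^sup>2)"
        by (rule norm_to_L2[OF gs_sqi[OF f(1)]])
      also have "\<dots> \<le> (\<Sum>i\<in>UNIV. LINT x|lborel. (gs i (f n) x)\<^sup>2)"
        by (rule member_le_sum) (auto intro: Bochner_Integration.integral_nonneg)
      also have "\<dots> \<le> ?q (a n) + ?q (b n)" using f(2)[of n] by (simp only: qform_minus[OF f(1)])
      finally show "(norm (to_L2 (gs i (f n))))\<^sup>2 \<le> ?q (a n) + ?q (b n)" .
    qed
    then have "(\<lambda>n. sqrt ((norm (to_L2 (gs i (f n))))\<^sup>2)) \<longlonglongrightarrow> sqrt 0" by (rule tendsto_real_sqrt)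
    then have "(\<lambda>n. to_L2 (gs i (f n))) \<longlonglongrightarrow> 0" by (simp add: tendsto_norm_zero_iff)
    then have "(\<lambda>n. - inner (to_L2 (gs i (f n))) (to_L2 (\<lambda>x. \<psi> x / \<phi> x))) \<longlonglongrightarrow> - inner 0 (to_L2 (\<lambda>x. \<psi> x / \<phi> x))"
      by (intro tendsto_minus tendsto_inner tendsto_const)
    moreover have "(LINT x|lborel. f n x * (pd i \<psi> x / \<phi> x)) =
        - inner (to_L2 (gs i (f n))) (to_L2 (\<lambda>x. \<psi> x / \<phi> x))" for n
      by (simp only: inner_to_L2[OF gs_sqi[OF f(1)] t[OF \<psi>]] gs_by_parts[OF f(1) \<psi>])
    ultimately show ?thesis by simp
  qed
  have "(\<lambda>n. cinner (to_L2c (a n) (b n)) (to_L2 (\<lambda>x. pd i \<psi> x / \<phi> x))) \<longlonglongrightarrow> cinner u (to_L2 (\<lambda>x. pd i \<psi> x / \<phi> x))"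
    by (intro tendsto_cinner ab(2) tendsto_const)
  moreover have "(\<lambda>n. cinner (to_L2c (a n) (b n)) (to_L2 (\<lambda>x. pd i \<psi> x / \<phi> x))) \<longlonglongrightarrow> Complex 0 0"
    unfolding cinner_to_L2c_to_L2[OF test_function_sqi[OF ta(1)] test_function_sqi[OF ta(2)] t[OF test_function_pd[OF \<psi>]]]
    by (intro tendsto_Complex lim ta) (use qform_minus_nonneg ta in simp_all)
  ultimately have "cinner u (to_L2 (\<lambda>x. pd i \<psi> x / \<phi> x)) = Complex 0 0"
    by (rule LIMSEQ_unique)
  then show ?thesis by (simp add: complex_eq_iff)
qed

lemma kernel_L_minus:
  assumes u: "u \<in> sobolev 2" "L_minus \<omega> \<mu> \<phi> u = 0"
  shows "\<exists>c. u = cscale c (to_L2 \<phi>)"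
proof -
  obtain a b where ab: "sqi a" "sqi b" "u = to_L2c a b" by (rule L2_eq_to_L2c)
  have t: "sqi (\<lambda>x. pd i \<psi> x / \<phi> x)" if "test_function \<psi>" for i \<psi>
  proof (rule continuous_bsupp_sqi)
    show "continuous_on UNIV (\<lambda>x. pd i \<psi> x / \<phi> x)"
      by (intro continuous_on_divide test_function_continuous[OF test_function_pd[OF that]] \<phi>_continuous ballI \<phi>_neq)
    show "bsupp (\<lambda>x. pd i \<psi> x / \<phi> x)"
      by (rule bounded_subset[OF test_function_bsupp[OF test_function_pd[OF that]], of _ i]) auto
  qed
  have 0: "(LINT x|lborel. a x * (pd i \<psi> x / \<phi> x)) = 0 \<and> (LINT x|lborel. b x * (pd i \<psi> x / \<phi> x)) = 0"
    if "test_function \<psi>" for i \<psi>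
    using kernel_L_minus_weak_gradient[OF u that, of i]
    unfolding ab(3) cinner_to_L2c_to_L2[OF ab(1,2) t[OF that]] by (simp add: complex_eq_iff)
  have c: "\<exists>c. to_L2 f = c *\<^sub>R to_L2 \<phi>"
    if f: "sqi f" and z: "\<And>i \<psi>. test_function \<psi> \<Longrightarrow> (LINT x|lborel. f x * (pd i \<psi> x / \<phi> x)) = 0" for f
  proof -
    have ci: "continuous_on UNIV (\<lambda>x. inverse (\<phi> x))"
      by (intro continuous_on_inverse \<phi>_continuous ballI \<phi>_neq)
    \<comment> \<open>Near infinity 1 / \<phi> is not controlled, so the quotient is treated as a
      locally integrable function.\<close>
    have "\<exists>c. AE x in lborel. inverse (\<phi> x) * f x = c"
      by (rule weak_gradient_zero_constant[OF locint_continuous_mult[OF sqi_locint[OF f] ci]])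
        (use z in \<open>simp add: divide_inverse mult_ac\<close>)
    then obtain c where c: "AE x in lborel. inverse (\<phi> x) * f x = c" by blast
    have "AE x in lborel. f x = c * \<phi> x"
      using c by eventually_elim (use \<phi>_neq in \<open>simp add: field_simps\<close>)
    then have "to_L2 f = to_L2 (\<lambda>x. c * \<phi> x)"
      by (subst to_L2_eq_iff) (simp_all add: f sqi_cmult \<phi>_sqi)
    then show ?thesis by (metis to_L2_scaleR[OF \<phi>_sqi])
  qed
  obtain c d where cd: "to_L2 a = c *\<^sub>R to_L2 \<phi>" "to_L2 b = d *\<^sub>R to_L2 \<phi>"
    using c[OF ab(1)] c[OF ab(2)] 0 by blast
  have "u = cscale (of_real c + \<i> * of_real d) (to_L2 \<phi>)"
    unfolding ab(3) to_L2c_def cd scaleR_eq_cscale by (simp add: cL2.scale_left_distrib)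
  then show ?thesis by blast
qed

lemma op_kernel_L_minus: "op_kernel (sobolev 2) (L_minus \<omega> \<mu> \<phi>) = cL2.span {to_L2 \<phi>}"
proof (intro set_eqI iffI)
  fix u assume "u \<in> op_kernel (sobolev 2) (L_minus \<omega> \<mu> \<phi>)"
  then obtain c where "u = cscale c (to_L2 \<phi>)"
    using kernel_L_minus unfolding op_kernel_def by blast
  then show "u \<in> cL2.span {to_L2 \<phi>}"
    by (simp add: cL2.span_scale cL2.span_base)
next
  fix u assume "u \<in> cL2.span {to_L2 \<phi>}"
  then obtain c where u: "u = cscale c (to_L2 \<phi>)"
    unfolding cL2.span_singleton by blast
  have "L_minus \<omega> \<mu> \<phi> u = cscale c (L_minus \<omega> \<mu> \<phi> (to_L2 \<phi>))"
    unfolding u L_minus_eq by (rule schrodinger_cscale[OF bpot_minus \<phi>_sobolev])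
  then show "u \<in> op_kernel (sobolev 2) (L_minus \<omega> \<mu> \<phi>)"
    using cL2.subspace_scale[OF sobolev_2_subspace \<phi>_sobolev, of c]
    by (simp add: op_kernel_def u \<phi>_in_kernel)
qed

lemma simple_eigenvalue_L_minus: "simple_eigenvalue (sobolev 2) (L_minus \<omega> \<mu> \<phi>) 0"
proof -
  have "eigenspace (sobolev 2) (L_minus \<omega> \<mu> \<phi>) 0 = cL2.span {to_L2 \<phi>}"
    unfolding op_kernel_L_minus[symmetric] by (simp add: eigenspace_def op_kernel_def)
  moreover have "cL2.independent {to_L2 \<phi>}"
    using \<phi>_nonzero by (simp add: cL2.dependent_single)
  ultimately show ?thesis
    using cL2.dim_span_eq_card_independent[of "{to_L2 \<phi>}"] by (simp add: simple_eigenvalue_def)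
qed

section \<open>The variational characterisation\<close>

lemma \<phi>_reg: "reg \<phi>"
  by (simp add: reg_def \<phi>_C2 \<phi>_bounded \<phi>_sqi \<phi>_laplacian_sqi)

text \<open>The constraint in the variable of \<phi>. Its derivative at \<phi> is the functional h
  \<mapsto> \<integral> \<Delta>\<phi> h.\<close>

definition G :: "(real^2 \<Rightarrow> real) \<Rightarrow> real" where
  "G u = \<omega> / 2 * (LINT x|lborel. (u x)\<^sup>2) - (LINT x|lborel. F_real \<mu> (u x))"

lemma F_real_measurable: "u \<in> borel_measurable borel \<Longrightarrow> (\<lambda>x. F_real \<mu> (u x)) \<in> borel_measurable borel"
  using measurable_compose[OF _ borel_measurable_continuous_onI[OF continuous_F_real[of UNIV \<mu>]]] by blast

text \<open>The dilation multiplies both integrals by \<omega>, which turns the coefficients 1/2 and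
  1/\<omega> of the constraint for Q into those of \<open>G\<close>.\<close>

lemma constraint_scale:
  assumes u: "sqi u"
  shows "1 / 2 * (norm (to_L2 (\<lambda>x. u ((1 / sqrt \<omega>) *\<^sub>R x))))\<^sup>2 -
    1 / \<omega> * (LINT x|lborel. F_nl \<mu> (rep_L2 (to_L2 (\<lambda>x. u ((1 / sqrt \<omega>) *\<^sub>R x))) x)) = G u"
proof -
  define c where "c = 1 / sqrt \<omega>"
  have c: "c \<noteq> 0" "c\<^sup>2 = 1 / \<omega>" using \<omega> by (auto simp: c_def power_divide)
  note um [measurable] = sqi_measurable[OF u] F_real_measurable[OF sqi_measurable[OF u]]
  let ?u = "\<lambda>x. u (c *\<^sub>R x)"
  have s: "sqi ?u" by (rule sqi_scale[OF u c(1)])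
  have "(LINT x|lborel. F_nl \<mu> (rep_L2 (to_L2 ?u) x)) = (LINT x|lborel. F_real \<mu> (?u x))"
  proof (rule integral_cong_AE)
    show "AE x in lborel. F_nl \<mu> (rep_L2 (to_L2 ?u) x) = F_real \<mu> (?u x)"
      using rep_to_L2[OF s] by eventually_elim (simp add: F_nl_of_real)
    have "(\<lambda>x. F_nl \<mu> (rep_L2 (to_L2 ?u) x)) \<in> borel_measurable borel"
      unfolding F_nl_def by measurable
    then show "(\<lambda>x. F_nl \<mu> (rep_L2 (to_L2 ?u) x)) \<in> borel_measurable lborel" by simp
    show "(\<lambda>x. F_real \<mu> (?u x)) \<in> borel_measurable lborel" by measurable
  qed
  also have "\<dots> = \<omega> * (LINT x|lborel. F_real \<mu> (u x))"
    using integral_scale[of "\<lambda>x. F_real \<mu> (u x)" c] c \<omega> by simp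
  finally have F: "(LINT x|lborel. F_nl \<mu> (rep_L2 (to_L2 ?u) x)) = \<omega> * (LINT x|lborel. F_real \<mu> (u x))" .
  have "(norm (to_L2 ?u))\<^sup>2 = \<omega> * (LINT x|lborel. (u x)\<^sup>2)"
    using integral_scale[of "\<lambda>x. (u x)\<^sup>2" c] c \<omega> by (simp add: norm_to_L2[OF s])
  then show ?thesis
    unfolding c_def[symmetric] F G_def using \<omega> by simp
qed

lemma Q_eq: "Q = (\<lambda>x. \<phi> ((1 / sqrt \<omega>) *\<^sub>R x))"
  using \<omega> by (simp add: \<phi>_eq)

lemma G_\<phi>: "G \<phi> = 0"
  using Q_admissible constraint_scale[OF \<phi>_sqi] unfolding admissible_def Q_eq[symmetric] by simp

lemma sqrt_\<omega>: "1 / sqrt \<omega> \<noteq> 0"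
  using \<omega> by simp

lemma energy_\<phi>: "energy \<phi> = (grad_norm (to_L2 Q))\<^sup>2"
  using energy_eq_grad_norm[OF reg_scale[OF \<phi>_reg sqrt_\<omega>]] energy_scale[OF \<phi>_reg sqrt_\<omega>]
  unfolding Q_eq[symmetric] by simp

lemma energy_\<phi>_pos: "energy \<phi> > 0"
  unfolding energy_\<phi> using Q_grad by simp

lemma energy_minimal_on_constraint:
  assumes u: "reg u" and G: "G u = 0" and nz: "(LINT x|lborel. (u x)\<^sup>2) \<noteq> 0"
  shows "energy \<phi> \<le> energy u"
proof -
  let ?u = "\<lambda>x. u ((1 / sqrt \<omega>) *\<^sub>R x)"
  have r: "reg ?u" by (rule reg_scale[OF u sqrt_\<omega>])
  have "to_L2 ?u \<noteq> 0"
  proof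
    assume "to_L2 ?u = 0"
    then have "(LINT x|lborel. (?u x)\<^sup>2) = 0" using norm_to_L2[OF regD(3)[OF r]] by simp
    moreover have "(LINT x|lborel. (u x)\<^sup>2) = (1 / sqrt \<omega>)\<^sup>2 *\<^sub>R (LINT x|lborel. (?u x)\<^sup>2)"
      by (rule integral_scale[of "\<lambda>x. (u x)\<^sup>2", OF _ sqrt_\<omega>]) (use sqi_measurable[OF regD(3)[OF u]] in simp)
    ultimately show False using nz by simp
  qed
  moreover have "to_L2 ?u \<in> sobolev 1"
    by (rule weak_laplacian_sobolev_1[OF reg_weak_laplacian[OF r]])
  ultimately have "admissible \<omega> \<mu> (to_L2 ?u)"
    unfolding admissible_def constraint_scale[OF regD(3)[OF u]] using G by blast
  then have "grad_norm (to_L2 Q) \<le> grad_norm (to_L2 ?u)" by (rule Q_minimal)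
  then have "(grad_norm (to_L2 Q))\<^sup>2 \<le> (grad_norm (to_L2 ?u))\<^sup>2"
    using Q_grad by (intro power_mono) auto
  then show ?thesis
    using energy_eq_grad_norm[OF r] energy_scale[OF u sqrt_\<omega>] energy_\<phi> by simp
qed

text \<open>F is of fourth order in the amplitude c, while the quadratic part of G is of second
  order; so G becomes positive for small amplitudes.\<close>

lemma F_real_cmult_bound:
  assumes b: "\<bar>y\<bar> \<le> M" and c: "0 \<le> c" "c \<le> 1"
  shows "\<bar>F_real \<mu> (c * y)\<bar> \<le> 4 * pi * exp (4 * pi * M\<^sup>2) * M\<^sup>2 * c ^ 4 * y\<^sup>2"
proof -
  let ?K = "4 * pi * exp (4 * pi * M\<^sup>2)"
  have "\<bar>c * y\<bar> \<le> \<bar>y\<bar>" using c by (simp add: abs_mult mult_left_le_one_le)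
  then have "\<bar>c * y\<bar> \<le> M" using b by linarith
  then have "\<bar>F_real \<mu> (c * y) - F_real \<mu> 0\<bar> \<le> ?K * \<bar>c * y\<bar>\<^sup>2 * \<bar>c * y\<bar> * \<bar>c * y - 0\<bar>"
    by (intro F_real_diff_bound[OF \<mu>]) auto
  also have "\<dots> = ?K * c ^ 4 * y\<^sup>2 * y\<^sup>2"
    using c by (simp add: abs_mult power_mult_distrib power2_eq_square power4_eq_xxxx mult_ac)
  also have "\<dots> \<le> ?K * c ^ 4 * y\<^sup>2 * M\<^sup>2"
    using b by (intro mult_left_mono) (auto simp: abs_le_square_iff[symmetric])
  finally show ?thesis by (simp add: F_real_0 mult_ac)
qed

lemma F_real_integrable:
  assumes u: "reg u" shows "integrable lborel (\<lambda>x. F_real \<mu> (u x))"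
proof -
  obtain M where M: "\<And>x. \<bar>u x\<bar> \<le> M" using reg_bound[OF u] by blast
  have "integrable lborel (\<lambda>x. 4 * pi * exp (4 * pi * M\<^sup>2) * M\<^sup>2 * (u x)\<^sup>2)"
    using regD(3)[OF u] by (simp add: sqi_def)
  then show ?thesis
  proof (rule Bochner_Integration.integrable_bound)
    show "(\<lambda>x. F_real \<mu> (u x)) \<in> borel_measurable lborel"
      using F_real_measurable[OF sqi_measurable[OF regD(3)[OF u]]] by simp
    show "AE x in lborel. norm (F_real \<mu> (u x)) \<le> norm (4 * pi * exp (4 * pi * M\<^sup>2) * M\<^sup>2 * (u x)\<^sup>2)"
      using F_real_cmult_bound[OF M, of 1] by (intro AE_I2) simp
  qed
qed

text \<open>Lowering the amplitude leads from \<open>G u < 0\<close> back to the constraint \<open>G = 0\<close> and only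
  decreases the energy; the Lagrangian argument below therefore needs no implicit function theorem.\<close>

lemma energy_minimal:
  assumes u: "reg u" and G: "G u < 0"
  shows "energy \<phi> \<le> energy u"
proof -
  obtain M where M: "M \<ge> 0" "\<And>x. \<bar>u x\<bar> \<le> M" using reg_bound[OF u] by blast
  define K where "K = 4 * pi * exp (4 * pi * M\<^sup>2) * M\<^sup>2"
  have K: "K \<ge> 0" by (simp add: K_def)
  define N where "N = (LINT x|lborel. (u x)\<^sup>2)"
  have iu: "integrable lborel (\<lambda>x. (u x)\<^sup>2)" using regD(3)[OF u] by (simp add: sqi_def)
  have N0: "N \<ge> 0" unfolding N_def by (rule Bochner_Integration.integral_nonneg) simp
  have Fb: "\<bar>LINT x|lborel. F_real \<mu> (c * u x)\<bar> \<le> K * c ^ 4 * N" if c: "0 \<le> c" "c \<le> 1" for c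
  proof -
    have "\<bar>LINT x|lborel. F_real \<mu> (c * u x)\<bar> \<le> (LINT x|lborel. \<bar>F_real \<mu> (c * u x)\<bar>)"
      by (rule integral_abs_bound)
    also have "\<dots> \<le> (LINT x|lborel. K * c ^ 4 * (u x)\<^sup>2)"
      using F_real_cmult_bound[OF M(2) c] iu
      by (intro integral_mono integrable_abs F_real_integrable reg_cmult u) (auto simp: K_def)
    finally show ?thesis by (simp add: N_def)
  qed
  have N: "N > 0"
  proof (rule ccontr)
    assume "\<not> N > 0"
    then have "N = 0" using N0 by simp
    then show False using Fb[of 1] G by (simp add: G_def N_def)
  qed
  have Gc: "G (\<lambda>x. c * u x) = \<omega> / 2 * c\<^sup>2 * N - (LINT x|lborel. F_real \<mu> (c * u x))" for c
    by (simp add: G_def N_def power_mult_distrib)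
  \<comment> \<open>Small enough that K c0^2 < \<omega>/2: then the quartic bound on F stays below
    the quadratic term, and G is positive at amplitude c0.\<close>
  define c0 where "c0 = min 1 (sqrt (\<omega> / (4 * (K + 1))))"
  have c0: "0 < c0" "c0 \<le> 1" using \<omega> K by (auto simp: c0_def)
  have "c0\<^sup>2 \<le> (sqrt (\<omega> / (4 * (K + 1))))\<^sup>2"
    using c0 by (intro power_mono) (auto simp: c0_def)
  also have "\<dots> = \<omega> / (4 * (K + 1))" using \<omega> K by simp
  finally have "c0\<^sup>2 * (4 * (K + 1)) \<le> \<omega>" using K by (simp add: field_simps)
  moreover have "0 < c0\<^sup>2" using c0 by simp
  moreover have "0 \<le> K * c0\<^sup>2" using K by simp
  moreover have "c0\<^sup>2 * (4 * (K + 1)) = 4 * (K * c0\<^sup>2) + 4 * c0\<^sup>2" by (simp add: algebra_simps)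
  ultimately have "K * c0\<^sup>2 < \<omega> / 2" by linarith
  then have "(K * c0\<^sup>2) * (c0\<^sup>2 * N) < \<omega> / 2 * (c0\<^sup>2 * N)"
    using c0 N by (intro mult_strict_right_mono) auto
  then have "K * c0 ^ 4 * N < \<omega> / 2 * c0\<^sup>2 * N"
    by (simp add: power2_eq_square power4_eq_xxxx mult_ac)
  then have g0: "0 < G (\<lambda>x. c0 * u x)"
    unfolding Gc using Fb[of c0] c0 by linarith
  have "continuous_on {c0..1} (\<lambda>c. LINT x|lborel. F_real \<mu> (c * u x))"
  proof (rule lipschitz_on_continuous_on, rule lipschitz_onI[where L = "K * N"])
    fix c d assume c: "c \<in> {c0..1}" and d: "d \<in> {c0..1}"
    have "\<bar>F_real \<mu> (c * u x) - F_real \<mu> (d * u x)\<bar> \<le> K * \<bar>c - d\<bar> * (u x)\<^sup>2" for x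
    proof -
      have "\<bar>F_real \<mu> (c * u x) - F_real \<mu> (d * u x)\<bar> \<le>
          4 * pi * exp (4 * pi * M\<^sup>2) * \<bar>u x\<bar>\<^sup>2 * \<bar>u x\<bar> * \<bar>c * u x - d * u x\<bar>"
        using c d c0 M(2)[of x] by (intro F_real_diff_bound[OF \<mu>]) (auto simp: abs_mult mult_left_le_one_le)
      also have "\<dots> = 4 * pi * exp (4 * pi * M\<^sup>2) * \<bar>c - d\<bar> * (u x)\<^sup>2 * (u x)\<^sup>2"
        by (simp add: left_diff_distrib[symmetric] abs_mult power2_eq_square mult_ac)
      also have "\<dots> \<le> 4 * pi * exp (4 * pi * M\<^sup>2) * \<bar>c - d\<bar> * (u x)\<^sup>2 * M\<^sup>2"
        using M(2)[of x] M(1) by (intro mult_left_mono) (auto simp: abs_le_square_iff[symmetric])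
      finally show ?thesis by (simp add: K_def mult_ac)
    qed
    note b = this
    have i: "integrable lborel (\<lambda>x. F_real \<mu> (c * u x))" for c by (intro F_real_integrable reg_cmult u)
    have "dist (LINT x|lborel. F_real \<mu> (c * u x)) (LINT x|lborel. F_real \<mu> (d * u x)) =
        \<bar>LINT x|lborel. F_real \<mu> (c * u x) - F_real \<mu> (d * u x)\<bar>"
      using i by (simp add: dist_real_def)
    also have "\<dots> \<le> (LINT x|lborel. \<bar>F_real \<mu> (c * u x) - F_real \<mu> (d * u x)\<bar>)"
      by (rule integral_abs_bound)
    also have "\<dots> \<le> (LINT x|lborel. K * \<bar>c - d\<bar> * (u x)\<^sup>2)"
      using b i iu by (intro integral_mono integrable_abs Bochner_Integration.integrable_diff) auto
    also have "\<dots> = K * N * dist c d" by (simp add: N_def dist_real_def mult_ac)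
    finally show "dist (LINT x|lborel. F_real \<mu> (c * u x)) (LINT x|lborel. F_real \<mu> (d * u x)) \<le> K * N * dist c d" .
  qed (use K N in simp)
  then have "continuous_on {c0..1} (\<lambda>c. G (\<lambda>x. c * u x))"
    unfolding Gc by (intro continuous_intros)
  \<comment> \<open>Intermediate value between amplitude c0, where G is positive, and amplitude 1,
    where it is negative.\<close>
  then obtain c where c: "c0 \<le> c" "c \<le> 1" "G (\<lambda>x. c * u x) = 0"
    using IVT2'[of "\<lambda>c. G (\<lambda>x. c * u x)" 1 0 c0] g0 G c0 by auto
  have "(LINT x|lborel. (c * u x)\<^sup>2) \<noteq> 0"
    using N c c0 by (simp add: power_mult_distrib N_def)
  then have "energy \<phi> \<le> energy (\<lambda>x. c * u x)"
    by (rule energy_minimal_on_constraint[OF reg_cmult[OF u] c(3)])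
  then have e: "energy \<phi> \<le> c\<^sup>2 * energy u" by (simp add: energy_cmult u)
  then have "0 < c\<^sup>2 * energy u" using energy_\<phi>_pos by linarith
  then have "0 < energy u" by (simp add: zero_less_mult_iff)
  moreover have "c\<^sup>2 \<le> 1" using c c0 by (simp add: power_le_one)
  ultimately have "c\<^sup>2 * energy u \<le> energy u" by (simp add: mult_left_le_one_le)
  then show ?thesis using e by simp
qed

lemma f_nl_\<phi>: "f_nl \<mu> (\<phi> x) = \<omega> * \<phi> x - classical_laplacian \<phi> x"
  by (simp add: \<phi>_laplacian f_nl_eq algebra_simps)

text \<open>The linear term of G at \<phi> is the pairing with \<Delta>\<phi>: it annihilates h and
  takes the value -E(\<phi>) at \<phi>, which explains the coefficient -K E(\<phi>). For t \<le> 1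
  all remaining contributions are of order t^3; an upper bound is enough to recognise G < 0.\<close>

lemma second_order_expansion:
  assumes h: "reg h" and orth: "(LINT x|lborel. h x * classical_laplacian \<phi> x) = 0"
  shows "\<exists>D. \<forall>t. 0 < t \<longrightarrow> t \<le> 1 \<longrightarrow>
    G (\<lambda>x. \<phi> x + (K * t\<^sup>2 * \<phi> x + t * h x)) \<le>
      t\<^sup>2 * (- K * energy \<phi> + (LINT x|lborel. (\<omega> - V_plus \<mu> (\<phi> x)) * (h x)\<^sup>2) / 2) + t ^ 3 * D"
proof -
  obtain M1 where M1: "M1 \<ge> 0" "\<And>x. \<bar>\<phi> x\<bar> \<le> M1" using reg_bound[OF \<phi>_reg] by blast
  obtain M2 where M2: "M2 \<ge> 0" "\<And>x. \<bar>h x\<bar> \<le> M2" using reg_bound[OF h] by blast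
  \<comment> \<open>A majorant independent of t: for 0 < t \<le> 1 the perturbation is at most t k,
    because t^2 \<le> t.\<close>
  define k where "k x = \<bar>K\<bar> * \<bar>\<phi> x\<bar> + \<bar>h x\<bar>" for x
  define M where "M = M1 + (\<bar>K\<bar> * M1 + M2)"
  obtain C where C: "C \<ge> 0" "\<And>a d. \<bar>a\<bar> \<le> M \<Longrightarrow> \<bar>a + d\<bar> \<le> M \<Longrightarrow>
    \<bar>F_real \<mu> (a + d) - F_real \<mu> a - f_nl \<mu> a * d - V_plus \<mu> a / 2 * d\<^sup>2\<bar> \<le> C * \<bar>d\<bar> ^ 3"
    using F_real_Taylor[of M \<mu>] by blast
  have kb: "0 \<le> k x" "k x \<le> \<bar>K\<bar> * M1 + M2" for x
    unfolding k_def by (auto intro!: add_mono mult_left_mono M1 M2)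
  have sq_abs: "sqi (\<lambda>x. \<bar>f x\<bar>)" if "sqi f" for f
    by (rule sqi_bound[OF that]) (use sqi_measurable[OF that] in auto)
  have k_sqi: "sqi k"
    unfolding k_def[abs_def] by (intro sqi_add sqi_cmult sq_abs \<phi>_sqi regD(3)[OF h])
  let ?W = "\<lambda>x. \<omega> - V_plus \<mu> (\<phi> x)"
  have W: "bpot ?W"
    by (rule bpot_compose[OF _ \<phi>_continuous \<phi>_bounded, of "\<lambda>y. \<omega> - V_plus \<mu> y"])
      (intro continuous_on_diff continuous_on_const continuous_V_plus)
  have iW: "integrable lborel (\<lambda>x. ?W x * f x * g x)" if "sqi f" "sqi g" for f g
    by (rule sqi_integrable_mult[OF sqi_mult_bpot[OF W that(1)] that(2)])
  have k3: "integrable lborel (\<lambda>x. k x ^ 3)"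
  proof -
    have "bpot k"
      unfolding bpot_def bounded_iff using sqi_measurable[OF k_sqi] kb
      by (auto intro!: exI[of _ "\<bar>K\<bar> * M1 + M2"] simp: abs_of_nonneg)
    then have "integrable lborel (\<lambda>x. k x * k x * k x)"
      by (intro sqi_integrable_mult sqi_mult_bpot k_sqi)
    then show ?thesis by (simp add: power3_eq_cube)
  qed
  define B where "B = (LINT x|lborel. ?W x * (h x)\<^sup>2)"
  define B1 where "B1 = (LINT x|lborel. ?W x * h x * \<phi> x)"
  define B2 where "B2 = (LINT x|lborel. ?W x * \<phi> x * \<phi> x)"
  define D where "D = \<bar>K\<bar> * \<bar>B1\<bar> + K\<^sup>2 / 2 * \<bar>B2\<bar> + C * (LINT x|lborel. k x ^ 3)"
  have "G (\<lambda>x. \<phi> x + (K * t\<^sup>2 * \<phi> x + t * h x)) \<le> t\<^sup>2 * (- K * energy \<phi> + B / 2) + t ^ 3 * D"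
    if t: "0 < t" "t \<le> 1" for t
  proof -
    define d where "d x = K * t\<^sup>2 * \<phi> x + t * h x" for x
    have d_sqi: "sqi d" unfolding d_def[abs_def] by (intro sqi_add sqi_cmult \<phi>_sqi regD(3)[OF h])
    have t2: "t\<^sup>2 \<le> t" using t by (simp add: power2_eq_square mult_left_le)
    have dk: "\<bar>d x\<bar> \<le> t * k x" for x
    proof -
      have "\<bar>d x\<bar> \<le> \<bar>K\<bar> * t\<^sup>2 * \<bar>\<phi> x\<bar> + t * \<bar>h x\<bar>"
        unfolding d_def using t abs_triangle_ineq[of "K * t\<^sup>2 * \<phi> x" "t * h x"] by (simp add: abs_mult)
      also have "\<bar>K\<bar> * t\<^sup>2 * \<bar>\<phi> x\<bar> \<le> \<bar>K\<bar> * t * \<bar>\<phi> x\<bar>"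
        by (intro mult_right_mono mult_left_mono t2) auto
      finally show ?thesis by (simp add: k_def algebra_simps)
    qed
    have dk1: "\<bar>d x\<bar> \<le> k x" for x
      using dk[of x] mult_left_le_one_le[OF kb(1)[of x]] t by (meson less_imp_le order_trans)
    have ineq: "\<omega> / 2 * (\<phi> x + d x)\<^sup>2 - F_real \<mu> (\<phi> x + d x) \<le>
        (\<omega> / 2 * (\<phi> x)\<^sup>2 - F_real \<mu> (\<phi> x)) + classical_laplacian \<phi> x * d x + 1 / 2 * (?W x * d x * d x) + C * t ^ 3 * k x ^ 3" for x
    proof -
      have "\<bar>\<phi> x\<bar> \<le> M" using M1(2)[of x] M2(1) M1(1) unfolding M_def by (simp add: add_increasing2)
      moreover have "\<bar>\<phi> x + d x\<bar> \<le> M"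
        using M1(2)[of x] dk1[of x] kb(2)[of x] abs_triangle_ineq[of "\<phi> x" "d x"] unfolding M_def by linarith
      ultimately have "F_real \<mu> (\<phi> x + d x) \<ge> F_real \<mu> (\<phi> x) + f_nl \<mu> (\<phi> x) * d x + V_plus \<mu> (\<phi> x) / 2 * (d x)\<^sup>2 - C * \<bar>d x\<bar> ^ 3"
        using C(2)[of "\<phi> x" "d x"] by (simp add: abs_le_iff)
      moreover have "C * \<bar>d x\<bar> ^ 3 \<le> C * (t ^ 3 * k x ^ 3)"
        unfolding power_mult_distrib[symmetric] by (intro mult_left_mono power_mono dk C) auto
      ultimately show ?thesis
        by (simp add: f_nl_\<phi> power2_eq_square algebra_simps)
    qed
    have r: "reg (\<lambda>x. \<phi> x + d x)"
      unfolding d_def by (intro reg_add reg_cmult \<phi>_reg h)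
    have i0: "integrable lborel (\<lambda>x. \<omega> / 2 * (f x)\<^sup>2 - F_real \<mu> (f x))" if "reg f" for f
      using F_real_integrable[OF that] regD(3)[OF that] by (auto simp: sqi_def)
    have i1: "integrable lborel (\<lambda>x. classical_laplacian \<phi> x * d x)"
      by (rule sqi_integrable_mult[OF \<phi>_laplacian_sqi d_sqi])
    have Gi: "G f = (LINT x|lborel. \<omega> / 2 * (f x)\<^sup>2 - F_real \<mu> (f x))" if "reg f" for f
      using F_real_integrable[OF that] regD(3)[OF that] by (simp add: G_def sqi_def)
    have "G (\<lambda>x. \<phi> x + d x) = (LINT x|lborel. \<omega> / 2 * (\<phi> x + d x)\<^sup>2 - F_real \<mu> (\<phi> x + d x))"
      by (rule Gi[OF r])
    also have "\<dots> \<le> (LINT x|lborel. (\<omega> / 2 * (\<phi> x)\<^sup>2 - F_real \<mu> (\<phi> x)) + classical_laplacian \<phi> x * d x + 1 / 2 * (?W x * d x * d x) + C * t ^ 3 * k x ^ 3)"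
      by (rule integral_mono[OF i0[OF r] _ ineq])
        (intro Bochner_Integration.integrable_add i0 \<phi>_reg i1 integrable_mult_right iW d_sqi k3)
    also have "\<dots> = G \<phi> + (LINT x|lborel. classical_laplacian \<phi> x * d x) + 1 / 2 * (LINT x|lborel. ?W x * d x * d x) + C * t ^ 3 * (LINT x|lborel. k x ^ 3)"
      unfolding Gi[OF \<phi>_reg] using i0[OF \<phi>_reg] i1 iW[OF d_sqi d_sqi] k3
      by (simp add: Bochner_Integration.integral_add)
    also have "(LINT x|lborel. classical_laplacian \<phi> x * d x) = - K * t\<^sup>2 * energy \<phi>"
    proof -
      have "(LINT x|lborel. classical_laplacian \<phi> x * d x) =
          (LINT x|lborel. K * t\<^sup>2 * (\<phi> x * classical_laplacian \<phi> x) + t * (h x * classical_laplacian \<phi> x))"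
        by (simp add: d_def algebra_simps)
      also have "\<dots> = K * t\<^sup>2 * (LINT x|lborel. \<phi> x * classical_laplacian \<phi> x) + t * (LINT x|lborel. h x * classical_laplacian \<phi> x)"
        using sqi_integrable_mult[OF \<phi>_sqi \<phi>_laplacian_sqi] sqi_integrable_mult[OF regD(3)[OF h] \<phi>_laplacian_sqi] by simp
      finally show ?thesis unfolding orth by (simp add: energy_def)
    qed
    also have "(LINT x|lborel. ?W x * d x * d x) = t\<^sup>2 * B + 2 * K * t ^ 3 * B1 + K\<^sup>2 * t ^ 4 * B2"
    proof -
      have "(LINT x|lborel. ?W x * d x * d x) =
          (LINT x|lborel. t\<^sup>2 * (?W x * h x * h x) + 2 * K * t ^ 3 * (?W x * h x * \<phi> x) + K\<^sup>2 * t ^ 4 * (?W x * \<phi> x * \<phi> x))"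
        by (rule Bochner_Integration.integral_cong[OF refl])
          (simp add: d_def power2_eq_square power3_eq_cube power4_eq_xxxx algebra_simps)
      also have "\<dots> = t\<^sup>2 * (LINT x|lborel. ?W x * h x * h x) + 2 * K * t ^ 3 * B1 + K\<^sup>2 * t ^ 4 * B2"
        unfolding B1_def B2_def using iW[OF regD(3)[OF h] regD(3)[OF h]] iW[OF regD(3)[OF h] \<phi>_sqi] iW[OF \<phi>_sqi \<phi>_sqi] by simp
      finally show ?thesis by (simp add: B_def power2_eq_square mult.assoc)
    qed
    also have "G \<phi> + - K * t\<^sup>2 * energy \<phi> + 1 / 2 * (t\<^sup>2 * B + 2 * K * t ^ 3 * B1 + K\<^sup>2 * t ^ 4 * B2) + C * t ^ 3 * (LINT x|lborel. k x ^ 3)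
        \<le> t\<^sup>2 * (- K * energy \<phi> + B / 2) + t ^ 3 * D"
    proof -
      have 1: "K * t ^ 3 * B1 \<le> \<bar>K\<bar> * \<bar>B1\<bar> * t ^ 3"
        using t abs_ge_self[of "K * B1"] mult_right_mono[of "K * B1" "\<bar>K * B1\<bar>" "t ^ 3"] by (simp add: abs_mult mult_ac)
      have "t ^ 4 \<le> t ^ 3" using t by (intro power_decreasing) auto
      then have "t ^ 4 * \<bar>B2\<bar> \<le> t ^ 3 * \<bar>B2\<bar>" by (intro mult_right_mono) auto
      moreover have "t ^ 4 * B2 \<le> t ^ 4 * \<bar>B2\<bar>" using t by (intro mult_left_mono) auto
      ultimately have "K\<^sup>2 / 2 * (t ^ 4 * B2) \<le> K\<^sup>2 / 2 * (t ^ 3 * \<bar>B2\<bar>)" by (intro mult_left_mono) auto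
      with 1 show ?thesis unfolding D_def G_\<phi> by (simp add: algebra_simps)
    qed
    finally show ?thesis by (simp add: d_def)
  qed
  then show ?thesis unfolding B_def by blast
qed

text \<open>If S = E(h) + B were negative, the t^2 coefficients of the changes of G and E, namely -K
  E(\<phi>) + B/2 and 2 K E(\<phi>) + E(h), could both be made negative by one choice of K. This
  contradicts minimality on G < 0.\<close>

lemma second_variation_nonneg:
  assumes h: "reg h" and orth: "(LINT x|lborel. h x * classical_laplacian \<phi> x) = 0"
  shows "0 \<le> qform \<omega> (\<lambda>x. V_plus \<mu> (\<phi> x)) h"
proof (rule ccontr)
  define S where "S = qform \<omega> (\<lambda>x. V_plus \<mu> (\<phi> x)) h"
  assume "\<not> 0 \<le> qform \<omega> (\<lambda>x. V_plus \<mu> (\<phi> x)) h"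
  then have S: "S < 0" by (simp add: S_def)
  define B where "B = (LINT x|lborel. (\<omega> - V_plus \<mu> (\<phi> x)) * (h x)\<^sup>2)"
  have SB: "S = energy h + B" by (simp add: S_def B_def qform_def energy_def)
  define A where "A = energy \<phi>"
  have A: "A > 0" using energy_\<phi>_pos by (simp add: A_def)
  \<comment> \<open>The two conditions require B/2 < K A < -E(h)/2 = (B - S)/2. This is the
    midpoint, which gives G the coefficient S/4 and the energy the coefficient S/2.\<close>
  define K where "K = (B / 2 - S / 4) / A"
  have KA: "K * A = B / 2 - S / 4" using A by (simp add: K_def)
  obtain D where D: "\<And>t. 0 < t \<Longrightarrow> t \<le> 1 \<Longrightarrow>
    G (\<lambda>x. \<phi> x + (K * t\<^sup>2 * \<phi> x + t * h x)) \<le> t\<^sup>2 * (- K * A + B / 2) + t ^ 3 * D"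
    using second_order_expansion[OF h orth, of K] unfolding A_def B_def by blast
  \<comment> \<open>The remainders t |D| and t K^2 A together stay below -S/8, too small to change
    the sign of S/4 or S/2.\<close>
  define t where "t = min 1 (- S / (8 * (\<bar>D\<bar> + K\<^sup>2 * A + 1)))"
  have den: "\<bar>D\<bar> + K\<^sup>2 * A + 1 > 0" using A by (simp add: add_nonneg_pos)
  have "0 < - S / (8 * (\<bar>D\<bar> + K\<^sup>2 * A + 1))" using S den by (intro divide_pos_pos) auto
  then have t: "0 < t" "t \<le> 1"
    unfolding t_def by (simp_all only: min_less_iff_conj zero_less_one simp_thms min.cobounded1)
  have "t \<le> - S / (8 * (\<bar>D\<bar> + K\<^sup>2 * A + 1))" by (simp add: t_def)
  then have tS: "8 * t * (\<bar>D\<bar> + K\<^sup>2 * A + 1) \<le> - S" using den by (simp add: field_simps)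
  have tD: "t * D \<le> t * \<bar>D\<bar>" "0 \<le> t * \<bar>D\<bar>" using t by auto
  have tK: "0 \<le> t * (K\<^sup>2 * A)" using t A by simp
  have pos: "t\<^sup>2 > 0" using t by simp
  have lin: "8 * (t * \<bar>D\<bar>) + 8 * (t * (K\<^sup>2 * A)) + 8 * t \<le> - S" using tS by (simp add: algebra_simps)
  let ?u = "\<lambda>x. \<phi> x + (K * t\<^sup>2 * \<phi> x + t * h x)"
  have u: "reg ?u" by (intro reg_add reg_cmult \<phi>_reg h)
  have "G ?u \<le> t\<^sup>2 * (- K * A + B / 2) + t ^ 3 * D" by (rule D[OF t])
  also have "- K * A + B / 2 = S / 4" using KA by simp
  also have "t\<^sup>2 * (S / 4) + t ^ 3 * D = t\<^sup>2 * (S / 4 + t * D)"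
    by (simp add: power2_eq_square power3_eq_cube algebra_simps)
  also have "\<dots> < 0"
    by (rule mult_pos_neg[OF pos]) (use t lin tD tK in linarith)
  finally have "A \<le> energy ?u" unfolding A_def by (rule energy_minimal[OF u])
  also have "energy ?u = energy (\<lambda>x. (1 + K * t\<^sup>2) * \<phi> x + t * h x)"
    by (simp add: algebra_simps)
  also have "\<dots> = (1 + K * t\<^sup>2)\<^sup>2 * A + t\<^sup>2 * energy h"
  proof -
    have "(LINT x|lborel. t * h x * ((1 + K * t\<^sup>2) * classical_laplacian \<phi> x)) =
        t * (1 + K * t\<^sup>2) * (LINT x|lborel. h x * classical_laplacian \<phi> x)"
      by (subst integral_mult_right_zero[symmetric]) (simp add: mult_ac)
    then show ?thesis
      unfolding energy_add[OF reg_cmult[OF \<phi>_reg] reg_cmult[OF h]] laplacian_cmult[OF \<phi>_C2]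
      by (simp add: orth energy_cmult \<phi>_reg h A_def)
  qed
  also have "\<dots> = A + t\<^sup>2 * (2 * (K * A) + energy h + t * (t * (K\<^sup>2 * A)))"
    by (simp add: power2_eq_square algebra_simps)
  also have "2 * (K * A) + energy h = S / 2" using KA SB by linarith
  finally have "0 \<le> t\<^sup>2 * (S / 2 + t * (t * (K\<^sup>2 * A)))" by simp
  moreover have "t * (t * (K\<^sup>2 * A)) \<le> t * (K\<^sup>2 * A)"
    using t tK by (simp add: mult_left_le_one_le)
  then have "S / 2 + t * (t * (K\<^sup>2 * A)) < 0" using t lin tD tK by linarith
  then have "t\<^sup>2 * (S / 2 + t * (t * (K\<^sup>2 * A))) < 0" by (rule mult_pos_neg[OF pos])
  ultimately show False by simp
qed

section \<open>The operator L-plus\<close>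

text \<open>The approximating test functions need not be orthogonal to \<Delta>\<phi>. Adding a
  multiple of \<phi> corrects this, since <\<phi>, \<Delta>\<phi>> = -E(\<phi>) is nonzero; the
  multiples tend to zero because the limit is orthogonal.\<close>

lemma L_plus_nonneg_on_hyperplane:
  assumes u: "u \<in> sobolev 2" and orth: "cinner u (to_L2 (classical_laplacian \<phi>)) = 0"
  shows "0 \<le> inner (L_plus \<omega> \<mu> \<phi> u) u"
proof -
  let ?L = "L_plus \<omega> \<mu> \<phi>" and ?l = "classical_laplacian \<phi>"
  define A where "A = energy \<phi>"
  have A: "A > 0" using energy_\<phi>_pos by (simp add: A_def)
  \<comment> \<open>Chosen so that f + c \<phi> is orthogonal to \<Delta>\<phi>.\<close>
  define c where "c f = (LINT x|lborel. f x * ?l x) / A" for f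
  define p where "p f x = f x + c f * \<phi> x" for f x
  obtain a b where ab: "\<And>n. testc (a n) (b n)" "(\<lambda>n. to_L2c (a n) (b n)) \<longlonglongrightarrow> u"
    "(\<lambda>n. ?L (to_L2c (a n) (b n))) \<longlonglongrightarrow> ?L u"
    unfolding L_plus_eq using schrodinger_approx[OF bpot_plus u, of \<omega>] by blast
  have t: "test_function (a n)" "test_function (b n)" for n using ab(1)[of n] by (auto simp: testc_def)
  have p_reg: "reg (p f)" if "test_function f" for f
    unfolding p_def[abs_def] by (intro reg_add reg_cmult reg_test that \<phi>_reg)
  have p_orth: "(LINT x|lborel. p f x * ?l x) = 0" if f: "test_function f" for f
  proof -
    have "(LINT x|lborel. p f x * ?l x) = (LINT x|lborel. f x * ?l x + c f * (\<phi> x * ?l x))"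
      by (simp add: p_def algebra_simps)
    also have "\<dots> = (LINT x|lborel. f x * ?l x) + c f * (LINT x|lborel. \<phi> x * ?l x)"
      using sqi_integrable_mult[OF test_function_sqi[OF f] \<phi>_laplacian_sqi] sqi_integrable_mult[OF \<phi>_sqi \<phi>_laplacian_sqi] by simp
    also have "(LINT x|lborel. \<phi> x * ?l x) = - A" by (simp add: A_def energy_def)
    finally show ?thesis using A by (simp add: c_def)
  qed
  define \<gamma> where "\<gamma> n = Complex (c (a n)) (c (b n))" for n
  have "(\<lambda>n. cinner (to_L2c (a n) (b n)) (to_L2 ?l)) \<longlonglongrightarrow> cinner u (to_L2 ?l)"
    by (intro tendsto_cinner ab(2) tendsto_const)
  then have "(\<lambda>n. cinner (to_L2c (a n) (b n)) (to_L2 ?l) / of_real A) \<longlonglongrightarrow> 0 / of_real A"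
    unfolding orth using A by (intro tendsto_divide tendsto_const) auto
  moreover have "cinner (to_L2c (a n) (b n)) (to_L2 ?l) / of_real A = \<gamma> n" for n
    unfolding cinner_to_L2c_to_L2[OF test_function_sqi[OF t(1)] test_function_sqi[OF t(2)] \<phi>_laplacian_sqi] \<gamma>_def c_def
    by (simp add: complex_eq_iff)
  ultimately have \<gamma>: "\<gamma> \<longlonglongrightarrow> 0" by simp
  have lim: "(\<lambda>n. cscale (\<gamma> n) v) \<longlonglongrightarrow> 0" for v
  proof -
    have "(\<lambda>n. cmod (\<gamma> n) * norm v) \<longlonglongrightarrow> 0 * norm v"
      by (intro tendsto_mult_right tendsto_norm_zero \<gamma>)
    then show ?thesis by (subst tendsto_norm_zero_iff[symmetric]) (simp add: norm_cscale)
  qed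
  have e: "to_L2c (p (a n)) (p (b n)) = to_L2c (a n) (b n) + cscale (\<gamma> n) (to_L2 \<phi>)" for n
  proof -
    have "to_L2 (p f) = to_L2 f + cscale (of_real (c f)) (to_L2 \<phi>)" if "test_function f" for f
      unfolding p_def[abs_def] by (simp add: to_L2_cscale \<phi>_sqi to_L2_add test_function_sqi that sqi_cmult)
    then show ?thesis
      unfolding to_L2c_def \<gamma>_def by (simp add: t Complex_eq cL2.scale_right_distrib cL2.scale_left_distrib)
  qed
  have Le: "?L (to_L2c (p (a n)) (p (b n))) = ?L (to_L2c (a n) (b n)) + cscale (\<gamma> n) (?L (to_L2 \<phi>))" for n
    unfolding e L_plus_eq
    using weak_laplacian_sobolev_2[OF weak_laplacian_testc[OF t]] \<phi>_sobolev
    by (simp add: schrodinger_add[OF bpot_plus] schrodinger_cscale[OF bpot_plus] cL2.subspace_scale[OF sobolev_2_subspace])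
  have "(\<lambda>n. inner (?L (to_L2c (p (a n)) (p (b n)))) (to_L2c (p (a n)) (p (b n)))) \<longlonglongrightarrow> inner (?L u + 0) (u + 0)"
    unfolding Le unfolding e by (intro tendsto_inner tendsto_add ab lim)
  moreover have "0 \<le> inner (?L (to_L2c (p (a n)) (p (b n)))) (to_L2c (p (a n)) (p (b n)))" for n
    unfolding L_plus_eq inner_schrodinger_to_L2c[OF bpot_plus p_reg[OF t(1)] p_reg[OF t(2)]]
    by (intro add_nonneg_nonneg second_variation_nonneg p_reg p_orth t)
  ultimately have "0 \<le> inner (?L u + 0) (u + 0)" by (intro LIMSEQ_le_const) auto
  then show ?thesis by simp
qed

text \<open>By the equation of \<phi>, the form of L-plus at \<phi> reduces to minus the integral of
  (\<open>V_plus\<close> - \<open>V_minus\<close>) \<phi>^2, whose integrand is strictly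
  positive.\<close>

lemma L_plus_\<phi>_negative: "inner (L_plus \<omega> \<mu> \<phi> (to_L2 \<phi>)) (to_L2 \<phi>) < 0"
proof -
  let ?g = "\<lambda>x. (V_plus \<mu> (\<phi> x) - V_minus \<mu> (\<phi> x)) * (\<phi> x)\<^sup>2"
  have i: "integrable lborel (\<lambda>x. V x * \<phi> x * \<phi> x)" if "bpot V" for V
    by (rule sqi_integrable_mult[OF sqi_mult_bpot[OF that \<phi>_sqi] \<phi>_sqi])
  have ip: "integrable lborel (\<lambda>x. \<phi> x * \<phi> x)" by (rule sqi_integrable_mult[OF \<phi>_sqi \<phi>_sqi])
  have gi: "integrable lborel ?g"
    using Bochner_Integration.integrable_diff[OF i[OF bpot_plus] i[OF bpot_minus]]
    by (simp add: power2_eq_square left_diff_distrib mult.assoc)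
  have "inner (L_plus \<omega> \<mu> \<phi> (to_L2 \<phi>)) (to_L2 \<phi>) = qform \<omega> (\<lambda>x. V_plus \<mu> (\<phi> x)) \<phi>"
    unfolding L_plus_eq by (rule inner_schrodinger_to_L2[OF bpot_plus \<phi>_C2 \<phi>_sqi \<phi>_laplacian_sqi])
  also have "\<dots> = - (LINT x|lborel. \<omega> * (\<phi> x * \<phi> x) - V_minus \<mu> (\<phi> x) * \<phi> x * \<phi> x)
      + (LINT x|lborel. \<omega> * (\<phi> x * \<phi> x) - V_plus \<mu> (\<phi> x) * \<phi> x * \<phi> x)"
    unfolding qform_def \<phi>_laplacian by (simp add: power2_eq_square algebra_simps)
  also have "\<dots> = - ((LINT x|lborel. V_plus \<mu> (\<phi> x) * \<phi> x * \<phi> x) - (LINT x|lborel. V_minus \<mu> (\<phi> x) * \<phi> x * \<phi> x))"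
    using ip i[OF bpot_plus] i[OF bpot_minus] by simp
  also have "(LINT x|lborel. V_plus \<mu> (\<phi> x) * \<phi> x * \<phi> x) - (LINT x|lborel. V_minus \<mu> (\<phi> x) * \<phi> x * \<phi> x) = (LINT x|lborel. ?g x)"
    using i[OF bpot_plus] i[OF bpot_minus]
    by (subst Bochner_Integration.integral_diff[symmetric]) (simp_all add: power2_eq_square left_diff_distrib mult.assoc)
  finally have e: "inner (L_plus \<omega> \<mu> \<phi> (to_L2 \<phi>)) (to_L2 \<phi>) = - (LINT x|lborel. ?g x)" .
  have pos: "0 < ?g x" for x
    using V_plus_gt_V_minus[OF \<mu> \<phi>_neq[of x]] \<phi>_neq[of x] by (intro mult_pos_pos) auto
  have "(LINT x|lborel. ?g x) \<noteq> 0"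
  proof
    assume "(LINT x|lborel. ?g x) = 0"
    then have "AE x in lborel. ?g x = 0"
      using integral_nonneg_eq_0_iff_AE[OF gi] pos by (simp add: less_imp_le)
    then have "AE x in lborel. \<phi> x = 0"
      by eventually_elim (use pos in \<open>metis less_irrefl\<close>)
    then show False using \<phi>_nonzero to_L2_eq_0_iff[OF \<phi>_sqi] by simp
  qed
  moreover have "(LINT x|lborel. ?g x) \<ge> 0"
    using pos by (intro Bochner_Integration.integral_nonneg) (simp add: less_imp_le)
  ultimately show ?thesis unfolding e by linarith
qed

lemma morse_index_L_plus: "has_morse_index (sobolev 2) (L_plus \<omega> \<mu> \<phi>) 1"
proof (rule codim_one_operator.has_morse_index_1[OF codim_one_operator.intro])
  show "self_adjoint (sobolev 2) (L_plus \<omega> \<mu> \<phi>)" "bounded_below (sobolev 2) (L_plus \<omega> \<mu> \<phi>)"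
    unfolding L_plus_eq by (rule self_adjoint_schrodinger[OF bpot_plus] bounded_below_schrodinger[OF bpot_plus])+
  show "0 \<le> inner (L_plus \<omega> \<mu> \<phi> u) u"
    if "u \<in> sobolev 2" "cinner u (to_L2 (classical_laplacian \<phi>)) = 0" for u
    by (rule L_plus_nonneg_on_hyperplane[OF that])
qed (rule \<phi>_sobolev L_plus_\<phi>_negative)+

end

theorem proposition2:
  fixes \<omega> \<mu> :: real and \<phi> :: "real^2 \<Rightarrow> real"
  assumes "\<omega> > 0" and "\<mu> \<in> {0, 1}" and "ruf_sani_soliton \<omega> \<mu> \<phi>"
  shows "nonneg_operator (sobolev 2) (L_minus \<omega> \<mu> \<phi>)
    \<and> simple_eigenvalue (sobolev 2) (L_minus \<omega> \<mu> \<phi>) 0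
    \<and> op_kernel (sobolev 2) (L_minus \<omega> \<mu> \<phi>) = cL2.span {to_L2 \<phi>}
    \<and> has_morse_index (sobolev 2) (L_plus \<omega> \<mu> \<phi>) 1"
proof -
  obtain Q where "ruf_sani_profile \<omega> \<mu> Q" "\<phi> = (\<lambda>x. Q (sqrt \<omega> *\<^sub>R x))"
    using assms(3) unfolding ruf_sani_soliton_def by blast
  then interpret soliton \<omega> \<mu> Q \<phi>
    using assms(1,2) by unfold_locales
  show ?thesis
    using nonneg_L_minus simple_eigenvalue_L_minus op_kernel_L_minus morse_index_L_plus by blast
qed

end
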